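(* Let $K$ be a field and $\mathcal{A}$ a generic set on some property $\mathcal{C}$ on $\mathcal{I}$. Suppose that for all $I,J\in\mathcal{I}(\mathcal{C})$ we have $$\operatorname{pd}_{K[X(I)]}K[X(I)]/(I\cap K[X(I)])=\operatorname{pd}_{K[X(J)]}K[X(J)]/(J\cap K[X(J)]).$$ Assume also that $$\operatorname{ara}(I\cap K[X(I)])=\operatorname{pd}_{K[X(I)]}K[X(I)]/(I\cap K[X(I)])$$ for all $I\in\mathcal{A}$. Then $$\operatorname{ara}(I\cap K[X(I)])=\operatorname{pd}_{K[X(I)]}K[X(I)]/(I\cap K[X(I)])$$ for all $I\in\mathcal{I}(\mathcal{C})$.
   Context: Let $S_\infty=K[x_1,x_2,\ldots]$ be the polynomial ring in countably infinitely many variables over $K$, and let $\mathcal{I}$ be the set of all finitely generated squarefree monomial ideals of $S_\infty$. For $I\in\mathcal{I}$, $G(I)$ is its minimal set of monomial generators and $X(I)$ is the set of all variables appearing in one of the elements of $G(I)$. A property $\mathcal{C}$ on $\mathcal{I}$ determines the subset $\mathcal{I}(\mathcal{C})=\{I\in\mathcal{I}: I\text{ satisfies }\mathcal{C}\}$. A subset $\mathcal{A}\subset\mathcal{I}$ is a generic set on $\mathcal{C}$ if: (1) $\mathcal{A}\subset\mathcal{I}(\mathcal{C})$; and (2) for any $J\in\mathcal{I}(\mathcal{C})$ with $G(J)=\{m_1,\ldots,m_\mu\}$ there exist $I\in\mathcal{A}$ with $X(I)=\{x_1,\ldots,x_n\}$ (after naming the variables of $X(I)$ this way) and $G(I)=\{m_1',\ldots,m_\mu'\}$,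 where $m_i'=x_{t_{i1}}\cdots x_{t_{ij_i}}$, and (possibly trivial) squarefree monomials $M_1,\ldots,M_n$ in the variables $X(J)$ that are pairwise coprime such that $M_{t_{i1}}\cdots M_{t_{ij_i}}=m_i$ for $i=1,\ldots,\mu$. For an ideal $\mathfrak a$ of a polynomial ring $R$ over $K$, the arithmetical rank $\operatorname{ara}\mathfrak a$ is the minimal number $r$ such that there exist $a_1,\ldots,a_r\in R$ with $\sqrt{(a_1,\ldots,a_r)}=\sqrt{\mathfrak a}$; $\operatorname{pd}$ denotes projective dimension. *)

theory Defs
  imports
    "HOL-Library.Poly_Mapping"
    "HOL-Library.Extended_Nat"
    "HOL-Library.Disjoint_Sets"
    "HOL-Algebra.Module"
    "HOL-Algebra.QuotRing"
begin

section \<open>Homological algebra and radicals over commutative rings\<close>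

definition mod_hom ::
    "('a, 'm) ring_scheme \<Rightarrow> ('a, 'b, 'n) module_scheme \<Rightarrow> ('a, 'c, 'p) module_scheme \<Rightarrow> ('b \<Rightarrow> 'c) set"
  where "mod_hom R M N =
    {f \<in> carrier M \<rightarrow> carrier N.
      (\<forall>x\<in>carrier M. \<forall>y\<in>carrier M. f (x \<oplus>\<^bsub>M\<^esub> y) = f x \<oplus>\<^bsub>N\<^esub> f y) \<and>
      (\<forall>r\<in>carrier R. \<forall>x\<in>carrier M. f (r \<odot>\<^bsub>M\<^esub> x) = r \<odot>\<^bsub>N\<^esub> f x)}"

text \<open>The free module on a set \<open>B\<close>: finitely supported functions from \<open>B\<close> to \<open>R\<close>, extended by zero
  outside \<open>B\<close>. The multiplicative fields of a module record carry no meaning for modules.\<close>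

definition free_module :: "('a, 'm) ring_scheme \<Rightarrow> 'c set \<Rightarrow> ('a, 'c \<Rightarrow> 'a) module"
  where "free_module R B =
    \<lparr>carrier = {f. (\<forall>b\<in>B. f b \<in> carrier R) \<and> (\<forall>b. b \<notin> B \<longrightarrow> f b = \<zero>\<^bsub>R\<^esub>) \<and> finite {b. f b \<noteq> \<zero>\<^bsub>R\<^esub>}},
     mult = undefined, one = undefined,
     zero = (\<lambda>_. \<zero>\<^bsub>R\<^esub>), add = (\<lambda>f g b. f b \<oplus>\<^bsub>R\<^esub> g b),
     smult = (\<lambda>r f b. r \<otimes>\<^bsub>R\<^esub> f b)\<rparr>"

text \<open>A module is projective if it is (isomorphic to) a direct summand of a free module, i.e. a
  retract of one. Index sets \<open>B\<close> in the type of elements of \<open>P\<close> suffice: if \<open>P\<close> is a retract of any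
  free module, then the canonical surjection onto \<open>P\<close> from the free module on \<open>carrier P\<close> splits.\<close>

definition projective_module :: "('a, 'm) ring_scheme \<Rightarrow> ('a, 'b, 'n) module_scheme \<Rightarrow> bool"
  where "projective_module R P \<longleftrightarrow> module R P \<and>
    (\<exists>B :: 'b set. \<exists>s \<in> mod_hom R P (free_module R B). \<exists>p \<in> mod_hom R (free_module R B) P.
       \<forall>x\<in>carrier P. p (s x) = x)"

definition mod_ker ::
    "('a, 'b, 'm) module_scheme \<Rightarrow> ('a, 'c, 'n) module_scheme \<Rightarrow> ('b \<Rightarrow> 'c) \<Rightarrow> 'b set"
  where "mod_ker M N f = {x \<in> carrier M. f x = \<zero>\<^bsub>N\<^esub>}"

text \<open>An exact complex \<open>\<dots> \<rightarrow> P 2 \<rightarrow> P 1 \<rightarrow> P 0 \<rightarrow> M \<rightarrow> 0\<close> with augmentation \<open>e : P 0 \<rightarrow> M\<close> and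
  differentials \<open>d i : P (Suc i) \<rightarrow> P i\<close>.\<close>

definition projective_resolution ::
    "('a, 'm) ring_scheme \<Rightarrow> ('a, 'b, 'n) module_scheme \<Rightarrow> (nat \<Rightarrow> ('a, 'c) module) \<Rightarrow>
     (nat \<Rightarrow> 'c \<Rightarrow> 'c) \<Rightarrow> ('c \<Rightarrow> 'b) \<Rightarrow> bool"
  where "projective_resolution R M P d e \<longleftrightarrow>
    (\<forall>i. projective_module R (P i)) \<and>
    e \<in> mod_hom R (P 0) M \<and> (\<forall>i. d i \<in> mod_hom R (P (Suc i)) (P i)) \<and>
    e ` carrier (P 0) = carrier M \<and>
    d 0 ` carrier (P 1) = mod_ker (P 0) M e \<and>
    (\<forall>i. d (Suc i) ` carrier (P (Suc (Suc i))) = mod_ker (P (Suc i)) (P i) (d i))"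

text \<open>Least length of a projective resolution, \<open>\<infinity>\<close> if there is no finite one (and 0 for the zero
  module). The resolving modules have elements in \<open>'b + nat \<Rightarrow> 'a\<close>. This is no restriction: the
  successive free modules on the elements of the previous syzygy have at most
  \<open>max |R| |M| \<aleph>\<^sub>0\<close> elements, which fits into this type.\<close>

definition proj_dim :: "('a, 'm) ring_scheme \<Rightarrow> ('a, 'b, 'n) module_scheme \<Rightarrow> enat"
  where "proj_dim R M = Inf {enat n | n.
    \<exists>(P :: nat \<Rightarrow> ('a, 'b + nat \<Rightarrow> 'a) module) d e.
      projective_resolution R M P d e \<and> (\<forall>i>n. carrier (P i) = {\<zero>\<^bsub>P i\<^esub>})}"

text \<open>The quotient ring \<open>R Quot I\<close> as a module over \<open>R\<close>.\<close>

definition quot_module :: "('a, 'm) ring_scheme \<Rightarrow> 'a set \<Rightarrow> ('a, 'a set) module"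
  where "quot_module R I =
    ring.extend (R Quot I) \<lparr>smult = (\<lambda>r A. (I +>\<^bsub>R\<^esub> r) \<otimes>\<^bsub>R Quot I\<^esub> A)\<rparr>"

definition radical :: "('a, 'm) ring_scheme \<Rightarrow> 'a set \<Rightarrow> 'a set"
  where "radical R I = {x \<in> carrier R. \<exists>n::nat. x [^]\<^bsub>R\<^esub> n \<in> I}"

definition arith_rank :: "('a, 'm) ring_scheme \<Rightarrow> 'a set \<Rightarrow> enat"
  where "arith_rank R I = Inf {enat r | r.
    \<exists>a. a ` {..<r} \<subseteq> carrier R \<and> radical R (Idl\<^bsub>R\<^esub> (a ` {..<r})) = radical R I}"


section \<open>Squarefree monomial ideals in countably many variables\<close>

text \<open>Elements of \<open>K[x\<^sub>0, x\<^sub>1, \<dots>]\<close>, mapping exponent vectors to coefficients.\<close>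

type_synonym 'k mpoly = "(nat \<Rightarrow>\<^sub>0 nat) \<Rightarrow>\<^sub>0 'k"

definition vars :: "'k::zero mpoly \<Rightarrow> nat set"
  where "vars p = (\<Union>m\<in>Poly_Mapping.keys p. Poly_Mapping.keys m)"

definition poly_ring :: "nat set \<Rightarrow> 'k::field mpoly ring"
  where "poly_ring X =
    \<lparr>carrier = {p. vars p \<subseteq> X}, mult = (*), one = 1, zero = 0, add = (+)\<rparr>"

abbreviation S_inf :: "'k::field mpoly ring"
  where "S_inf \<equiv> poly_ring UNIV"

definition monomials :: "'k::field mpoly set"
  where "monomials = {Poly_Mapping.single m 1 | m. True}"

definition sqfree_monomials :: "'k::field mpoly set"
  where "sqfree_monomials = {Poly_Mapping.single m 1 | m. \<forall>i. Poly_Mapping.lookup m i \<le> 1}"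

definition sqfree_ideals :: "'k::field mpoly set set"
  where "sqfree_ideals = {Idl\<^bsub>S_inf\<^esub> G | G. finite G \<and> G \<subseteq> sqfree_monomials}"

text \<open>\<open>G(I)\<close>: the set of monomials generating \<open>I\<close> that is minimal with this property; it is unique
  for a monomial ideal.\<close>

definition min_gens :: "'k::field mpoly set \<Rightarrow> 'k mpoly set"
  where "min_gens I = (THE G. G \<subseteq> monomials \<and> Idl\<^bsub>S_inf\<^esub> G = I \<and> (\<forall>G'. G' \<subset> G \<longrightarrow> Idl\<^bsub>S_inf\<^esub> G' \<noteq> I))"

text \<open>\<open>X(I)\<close>, as a set of indices of variables.\<close>

definition ideal_vars :: "'k::field mpoly set \<Rightarrow> nat set"
  where "ideal_vars I = (\<Union>p\<in>min_gens I. vars p)"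

abbreviation ideal_ring :: "'k::field mpoly set \<Rightarrow> 'k mpoly ring"
  where "ideal_ring I \<equiv> poly_ring (ideal_vars I)"

abbreviation restr_ideal :: "'k::field mpoly set \<Rightarrow> 'k mpoly set"
  where "restr_ideal I \<equiv> I \<inter> carrier (ideal_ring I)"

definition satisfying :: "('k::field mpoly set \<Rightarrow> bool) \<Rightarrow> 'k mpoly set set"
  where "satisfying C = {I \<in> sqfree_ideals. C I}"

text \<open>The monomials \<open>M t\<close> are indexed by the variables \<open>t \<in> X(I)\<close>, so no renaming of these variables
  is needed; as \<open>m' i\<close> is squarefree, \<open>\<Prod>t\<in>vars (m' i). M t\<close> is the result of substituting \<open>M t\<close> for
  each \<open>x\<^sub>t\<close> in \<open>m' i\<close>. Monomials are coprime iff they involve disjoint sets of variables.\<close>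

definition generic_set :: "('k::field mpoly set \<Rightarrow> bool) \<Rightarrow> 'k mpoly set set \<Rightarrow> bool"
  where "generic_set C A \<longleftrightarrow>
    A \<subseteq> satisfying C \<and>
    (\<forall>J \<in> satisfying C. \<forall>(\<mu>::nat) m. bij_betw m {1..\<mu>} (min_gens J) \<longrightarrow>
      (\<exists>I \<in> A. \<exists>m' M.
        bij_betw m' {1..\<mu>} (min_gens I) \<and>
        (\<forall>t\<in>ideal_vars I. M t \<in> sqfree_monomials \<and> vars (M t) \<subseteq> ideal_vars J) \<and>
        disjoint_family_on (\<lambda>t. vars (M t)) (ideal_vars I) \<and>
        (\<forall>i\<in>{1..\<mu>}. (\<Prod>t\<in>vars (m' i). M t) = m i)))"


section \<open>Well-formedness\<close>

lemma vars_add_subset: "vars (p + q) \<subseteq> vars p \<union> vars q"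
  unfolding vars_def using Poly_Mapping.keys_add[of p q] by blast

lemma vars_zero: "vars 0 = {}"
  by (simp add: vars_def)

lemma vars_one: "vars (1 :: 'k::field mpoly) = {}"
  by (simp add: vars_def)

lemma vars_uminus: "vars (- p) = vars (p :: 'k::field mpoly)"
  unfolding vars_def by (simp add: Poly_Mapping.keys_def)

lemma vars_mult_subset: "vars (p * q) \<subseteq> vars p \<union> vars (q :: 'k::field mpoly)"
proof
  fix t assume "t \<in> vars (p * q)"
  then obtain m where m: "m \<in> Poly_Mapping.keys (p * q)" "t \<in> Poly_Mapping.keys m"
    unfolding vars_def by blast
  with Poly_Mapping.keys_mult[of p q] obtain a b where
    ab: "m = a + b" "a \<in> Poly_Mapping.keys p" "b \<in> Poly_Mapping.keys q" by blast
  with m(2) Poly_Mapping.keys_add[of a b] have "t \<in> Poly_Mapping.keys a \<union> Poly_Mapping.keys b" by blast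
  with ab show "t \<in> vars p \<union> vars q" unfolding vars_def by blast
qed

lemma poly_ring_cring: "cring (poly_ring X)"
proof (rule cringI)
  show "abelian_group (poly_ring X :: 'k::field mpoly ring)"
  proof (rule abelian_groupI)
    fix x :: "'k mpoly" assume "x \<in> carrier (poly_ring X)"
    then show "\<exists>y\<in>carrier (poly_ring X). y \<oplus>\<^bsub>poly_ring X\<^esub> x = \<zero>\<^bsub>poly_ring X\<^esub>"
      by (intro bexI[of _ "- x"]) (auto simp: poly_ring_def vars_uminus)
  qed (auto simp: poly_ring_def algebra_simps vars_zero dest!: subsetD[OF vars_add_subset])
  show "Group.comm_monoid (poly_ring X :: 'k::field mpoly ring)"
    by (rule comm_monoidI)
      (auto simp: poly_ring_def algebra_simps vars_one dest!: subsetD[OF vars_mult_subset])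
qed (auto simp: poly_ring_def algebra_simps)

lemma free_module_module:
  fixes R (structure)
  assumes "cring R"
  shows "module R (free_module R B)"
proof -
  interpret cring R by fact
  have mem: "f b \<in> carrier R" if "f \<in> carrier (free_module R B)" for f b
    using that by (cases "b \<in> B") (auto simp: free_module_def)
  have ops: "add (free_module R B) = (\<lambda>f g b. f b \<oplus> g b)" "zero (free_module R B) = (\<lambda>_. \<zero>)"
    "smult (free_module R B) = (\<lambda>r f b. r \<otimes> f b)"
    by (simp_all add: free_module_def)
  show ?thesis
  proof (rule moduleI[OF assms])
    show "abelian_group (free_module R B)"
    proof (rule abelian_groupI)
      fix f g assume f: "f \<in> carrier (free_module R B)" and g: "g \<in> carrier (free_module R B)"
      have "{b. f b \<oplus> g b \<noteq> \<zero>} \<subseteq> {b. f b \<noteq> \<zero>} \<union> {b. g b \<noteq> \<zero>}" by auto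
      then have "finite {b. f b \<oplus> g b \<noteq> \<zero>}"
        using f g by (auto simp: free_module_def intro: finite_subset)
      then show "f \<oplus>\<^bsub>free_module R B\<^esub> g \<in> carrier (free_module R B)"
        using f g by (auto simp: free_module_def)
      show "f \<oplus>\<^bsub>free_module R B\<^esub> g = g \<oplus>\<^bsub>free_module R B\<^esub> f"
        using f g by (simp add: ops mem a_comm)
    next
      fix f g h assume "f \<in> carrier (free_module R B)" "g \<in> carrier (free_module R B)"
        "h \<in> carrier (free_module R B)"
      then show "f \<oplus>\<^bsub>free_module R B\<^esub> g \<oplus>\<^bsub>free_module R B\<^esub> h =
          f \<oplus>\<^bsub>free_module R B\<^esub> (g \<oplus>\<^bsub>free_module R B\<^esub> h)"
        by (simp add: ops mem a_assoc)
    next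
      fix f assume f: "f \<in> carrier (free_module R B)"
      then show "\<zero>\<^bsub>free_module R B\<^esub> \<oplus>\<^bsub>free_module R B\<^esub> f = f"
        by (simp add: ops mem)
      have "{b. \<ominus> f b \<noteq> \<zero>} \<subseteq> {b. f b \<noteq> \<zero>}" by auto
      then have "finite {b. \<ominus> f b \<noteq> \<zero>}"
        using f by (auto simp: free_module_def intro: finite_subset)
      then show "\<exists>g\<in>carrier (free_module R B).
          g \<oplus>\<^bsub>free_module R B\<^esub> f = \<zero>\<^bsub>free_module R B\<^esub>"
        using f mem[OF f]
        by (intro bexI[of _ "\<lambda>b. \<ominus> f b"]) (auto simp: free_module_def l_neg)
    qed (auto simp: free_module_def)
  next
    fix r f assume r: "r \<in> carrier R" and f: "f \<in> carrier (free_module R B)"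
    have "{b. r \<otimes> f b \<noteq> \<zero>} \<subseteq> {b. f b \<noteq> \<zero>}" using r by auto
    then have "finite {b. r \<otimes> f b \<noteq> \<zero>}"
      using f by (auto simp: free_module_def intro: finite_subset)
    then show "r \<odot>\<^bsub>free_module R B\<^esub> f \<in> carrier (free_module R B)"
      using r f by (auto simp: free_module_def)
  qed (simp_all add: ops mem l_distr r_distr m_assoc)
qed

lemma quot_module_module:
  assumes "cring R" "ideal I R"
  shows "module R (quot_module R I)"
proof -
  interpret R: cring R by fact
  interpret I: ideal I R by fact
  interpret Q: cring "R Quot I" by (rule I.quotient_is_cring[OF assms(1)])
  have proj: "(+>\<^bsub>R\<^esub>) I \<in> ring_hom R (R Quot I)" by (rule I.rcos_ring_hom)
  note hom = ring_hom_closed[OF proj] ring_hom_add[OF proj] ring_hom_mult[OF proj] ring_hom_one[OF proj]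
  have fields: "carrier (quot_module R I) = carrier (R Quot I)"
    "add (quot_module R I) = add (R Quot I)" "zero (quot_module R I) = zero (R Quot I)"
    "smult (quot_module R I) = (\<lambda>r A. (I +>\<^bsub>R\<^esub> r) \<otimes>\<^bsub>R Quot I\<^esub> A)"
    by (simp_all add: quot_module_def ring.extend_def)
  show ?thesis
  proof (rule moduleI[OF assms(1)])
    show "abelian_group (quot_module R I)"
    proof (rule abelian_groupI)
      fix x assume "x \<in> carrier (quot_module R I)"
      then show "\<exists>y\<in>carrier (quot_module R I). y \<oplus>\<^bsub>quot_module R I\<^esub> x = \<zero>\<^bsub>quot_module R I\<^esub>"
        unfolding fields by (intro bexI[of _ "\<ominus>\<^bsub>R Quot I\<^esub> x"]) (simp_all only: Q.l_neg Q.a_inv_closed)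
    qed (unfold fields, simp_all only: Q.a_closed Q.zero_closed Q.a_assoc Q.l_zero, rule Q.a_comm)
  qed (simp_all only: fields hom Q.m_closed Q.l_distr Q.r_distr Q.m_assoc Q.l_one)
qed

end

theory Submission
  imports Defs "HOL-Library.Function_Algebras" "HOL-Library.Nat_Bijection"
begin

text \<open>
  Write \<open>ara\<close> and \<open>pd\<close> for the two invariants of the ideal restricted to its own variables. For \<open>J\<close>
  with the property and \<open>I\<close> the member of the generic set that specializes to \<open>J\<close>, the theorem is the
  chain \<open>ara J \<le> ara I = pd I = pd J \<le> ara J\<close>; both equalities are hypotheses.

  The first inequality (\<open>arith_rank_specialization\<close>) holds because substituting \<open>M t\<close> for \<open>x\<^sub>t\<close> is a ring
  homomorphism that sends the generators of \<open>I\<close> to those of \<open>J\<close>: elements that generate \<open>I\<close> up to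
  radical are sent to elements that generate \<open>J\<close> up to radical.

  The last inequality (\<open>proj_dim_le_arith_rank\<close>) is Lyubeznik's theorem, valid for every squarefree
  monomial ideal. Let \<open>m\<^sub>0, \<dots>, m\<^bsub>n-1\<^esub>\<close> be the generators and suppose that \<open>f\<^sub>0, \<dots>, f\<^bsub>r-1\<^esub>\<close> in the
  ideal generate it up to radical. The Taylor complex \<open>T\<close> is a free resolution. Because the \<open>m\<^sub>j\<close> are
  squarefree, the endomorphism \<open>\<phi>: x \<mapsto> x\<^sup>N\<close> of the polynomial ring acts on \<open>T\<close> coefficientwise, and so
  does its additive left inverse \<open>\<theta>\<close>, which satisfies \<open>\<theta> (\<phi> s * p) = s * \<theta> p\<close>. On the other hand a power
  of each \<open>m\<^sub>j\<close> is a combination of the \<open>f\<^sub>k\<close>. For large \<open>N\<close> this yields a second \<open>\<phi>\<close>-semilinear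
  endomorphism of \<open>T\<close>, a composite through the Koszul complex of the \<open>f\<^sub>k\<close>, hence zero in degrees
  above \<open>r\<close>, and it is homotopic to \<open>\<phi>\<close> by an explicit semilinear homotopy \<open>\<eta>\<close>. Applying \<open>\<theta>\<close> turns \<open>\<eta>\<close>
  into a linear homotopy \<open>\<theta> \<circ> \<eta>\<close> that contracts \<open>T\<close> in degrees above \<open>r\<close>. So the boundaries in
  \<open>T\<^sub>r\<close> form a direct summand (\<open>syzygy_retraction\<close>), and replacing \<open>T\<^sub>r\<close> by a complement of them
  gives a projective resolution of length \<open>r\<close> (\<open>proj_dim_le\<close>).

  The Taylor complex is realized inside the exterior algebra on \<open>n\<close> generators over the polynomial
  ring: the basis element indexed by \<open>\<sigma>\<close> is the lcm of the \<open>m\<^sub>j\<close>, \<open>j \<in> \<sigma>\<close>, times the wedge of \<open>\<sigma>\<close>. With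
  this choice the Taylor differential becomes the simplicial boundary, whose coefficients are
  signs, so that it commutes with every additive map applied to the coefficients.
\<close>

section \<open>Monomials and maps of exponents\<close>

abbreviation mon :: "(nat \<Rightarrow>\<^sub>0 nat) \<Rightarrow> 'k::field mpoly"
  where "mon m \<equiv> Poly_Mapping.single m 1"

lemma mon_add: "mon (a + b) = mon a * (mon b :: 'k::field mpoly)"
  by (simp add: Poly_Mapping.mult_single)

lemma sum_monomials:
  "(\<Sum>m\<in>Poly_Mapping.keys p. Poly_Mapping.single m (Poly_Mapping.lookup p m)) = p"
  by (rule poly_mapping_eqI)
    (auto simp: lookup_sum lookup_single when_def not_in_keys_iff_lookup_eq_zero)

lemma mpoly_induct [case_names zero single add]:
  fixes p :: "'k::field mpoly"
  assumes "P 0" and "\<And>m c. P (Poly_Mapping.single m c)" and "\<And>p q. P p \<Longrightarrow> P q \<Longrightarrow> P (p + q)"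
  shows "P p"
proof -
  have "P (\<Sum>m\<in>M. Poly_Mapping.single m (Poly_Mapping.lookup p m))" if "finite M" for M
    using that by induction (auto intro: assms)
  from this[of "Poly_Mapping.keys p"] show ?thesis
    by (simp add: sum_monomials)
qed

text \<open>Relabels every monomial. For additive \<open>h\<close> this is a ring endomorphism; both the power map
  \<open>x \<mapsto> x\<^sup>N\<close> and the substitution of monomials for variables are of this form.\<close>

definition exp_map :: "((nat \<Rightarrow>\<^sub>0 nat) \<Rightarrow> (nat \<Rightarrow>\<^sub>0 nat)) \<Rightarrow> 'k::field mpoly \<Rightarrow> 'k mpoly"
  where "exp_map h p = (\<Sum>m\<in>Poly_Mapping.keys p. Poly_Mapping.single (h m) (Poly_Mapping.lookup p m))"

lemma exp_map_superset:
  assumes "finite M" "Poly_Mapping.keys p \<subseteq> M"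
  shows "exp_map h p = (\<Sum>m\<in>M. Poly_Mapping.single (h m) (Poly_Mapping.lookup p m))"
  unfolding exp_map_def
  by (rule sum.mono_neutral_left) (use assms in \<open>auto simp: in_keys_iff\<close>)

lemma exp_map_add:
  fixes p q :: "'k::field mpoly"
  shows "exp_map h (p + q) = exp_map h p + exp_map h q"
proof -
  let ?M = "Poly_Mapping.keys p \<union> Poly_Mapping.keys q"
  have "exp_map h f = (\<Sum>m\<in>?M. Poly_Mapping.single (h m) (Poly_Mapping.lookup f m))"
    if "Poly_Mapping.keys f \<subseteq> ?M" for f :: "'k mpoly"
    using that by (intro exp_map_superset) auto
  then show ?thesis
    using Poly_Mapping.keys_add[of p q]
    by (simp add: lookup_add single_add sum.distrib)
qed

lemma exp_map_zero [simp]: "exp_map h 0 = 0"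
  by (simp add: exp_map_def)

lemma exp_map_single [simp]: "exp_map h (Poly_Mapping.single m c) = Poly_Mapping.single (h m) c"
  by (subst exp_map_superset[of "{m}"]) auto

lemma exp_map_mult:
  assumes "\<And>a b. h (a + b) = h a + h b"
  shows "exp_map h (p * q) = exp_map h p * exp_map h q"
proof (induction p rule: mpoly_induct)
  case (single m c)
  show ?case
    by (induction q rule: mpoly_induct)
      (simp_all add: Poly_Mapping.mult_single assms exp_map_add distrib_left)
qed (simp_all add: exp_map_add distrib_right)

lemma exp_map_one:
  assumes "h 0 = 0"
  shows "exp_map h 1 = 1"
  unfolding single_one[symmetric] exp_map_single assms ..

lemma keys_exp_map: "Poly_Mapping.keys (exp_map h p) \<subseteq> h ` Poly_Mapping.keys p"
  unfolding exp_map_def by (rule order_trans[OF keys_sum]) (auto split: if_splits)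

lemma lookup_exp_map:
  assumes "inj h"
  shows "Poly_Mapping.lookup (exp_map h p) (h m) = Poly_Mapping.lookup p m"
  by (induction p rule: mpoly_induct)
    (use assms in \<open>auto simp: exp_map_add lookup_add lookup_single when_def dest: injD\<close>)

lemma lookup_mon_mult:
  "Poly_Mapping.lookup (mon e * p) (e + m) = Poly_Mapping.lookup (p :: 'k::field mpoly) m"
  by (induction p rule: mpoly_induct)
    (auto simp: distrib_left lookup_add Poly_Mapping.mult_single lookup_single when_def)

text \<open>Terms that \<open>x\<^sup>e\<close> does not divide are dropped, so this inverts multiplication by \<open>x\<^sup>e\<close> only on
  multiples of \<open>x\<^sup>e\<close>.\<close>

definition mon_quot :: "(nat \<Rightarrow>\<^sub>0 nat) \<Rightarrow> 'k::field mpoly \<Rightarrow> 'k mpoly"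
  where "mon_quot e p = Poly_Mapping.map_key (\<lambda>m. e + m) p"

lemma lookup_mon_quot: "Poly_Mapping.lookup (mon_quot e p) m = Poly_Mapping.lookup p (e + m)"
  unfolding mon_quot_def by (subst map_key.rep_eq) (auto simp: inj_on_def)

lemma mon_quot_mult [simp]: "mon_quot e (mon e * p) = p"
  by (rule poly_mapping_eqI) (simp add: lookup_mon_quot lookup_mon_mult)

lemma mon_quot_zero [simp]: "mon_quot e 0 = 0"
  using mon_quot_mult[of e 0] by simp

lemma mon_quot_add: "mon_quot e (p + q) = mon_quot e p + mon_quot e q"
  by (rule poly_mapping_eqI) (simp add: lookup_mon_quot lookup_add)

lemma exponent_dvd:
  fixes e m :: "nat \<Rightarrow>\<^sub>0 nat"
  assumes "\<And>i. Poly_Mapping.lookup e i \<le> Poly_Mapping.lookup m i"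
  shows "m = e + (m - e)"
  by (rule poly_mapping_eqI) (simp add: lookup_add lookup_minus assms)

lemma mon_dvd:
  assumes "\<And>m. m \<in> Poly_Mapping.keys p \<Longrightarrow> \<exists>d. m = e + d"
  shows "p = mon e * mon_quot e p"
proof -
  have "\<exists>q. (\<Sum>m\<in>M. Poly_Mapping.single m (Poly_Mapping.lookup p m)) = mon e * q"
    if "finite M" "M \<subseteq> Poly_Mapping.keys p" for M
    using that
  proof induction
    case (insert m M)
    then obtain q where q: "(\<Sum>m\<in>M. Poly_Mapping.single m (Poly_Mapping.lookup p m)) = mon e * q"
      by auto
    obtain d where d: "m = e + d"
      using insert.prems assms by blast
    have "Poly_Mapping.single m (Poly_Mapping.lookup p m)
        = mon e * Poly_Mapping.single d (Poly_Mapping.lookup p m)"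
      by (simp add: d Poly_Mapping.mult_single)
    then show ?case
      using insert.hyps q by (intro exI[of _ "Poly_Mapping.single d (Poly_Mapping.lookup p m) + q"])
        (simp add: distrib_left)
  qed (auto intro: exI[of _ 0])
  from this[of "Poly_Mapping.keys p"] obtain q where "p = mon e * q"
    by (auto simp: sum_monomials)
  then show ?thesis
    by simp
qed

section \<open>Exterior algebra\<close>

text \<open>Elements of the exterior algebra are given by their coefficients: \<open>v \<sigma>\<close> is the coefficient of the
  wedge of the generators indexed by \<open>\<sigma>\<close> in increasing order.\<close>

type_synonym 'r ext = "nat set \<Rightarrow> 'r"

definition scl :: "'r::comm_ring_1 \<Rightarrow> 'r ext \<Rightarrow> 'r ext" (infixr \<open>\<bullet>\<close> 75)
  where "s \<bullet> v = (\<lambda>\<sigma>. s * v \<sigma>)"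

lemma scl_apply: "(s \<bullet> v) \<sigma> = s * v \<sigma>"
  by (simp add: scl_def)

lemmas fun_ops = plus_fun_apply zero_fun_apply minus_apply uminus_apply scl_apply

text \<open>Left as simp rules, these eta-expand equations between functions.\<close>

declare fun_ops [simp del]

lemma scl_simps [simp]: "s \<bullet> t \<bullet> v = (s * t) \<bullet> v" "1 \<bullet> v = v" "s \<bullet> 0 = 0" "0 \<bullet> v = 0"
  "(- s) \<bullet> v = - (s \<bullet> v)" "s \<bullet> (- v) = - (s \<bullet> v)"
  by (auto simp: fun_eq_iff fun_ops mult.assoc)

lemma scl_add: "s \<bullet> (v + w) = s \<bullet> v + s \<bullet> w" "(s + t) \<bullet> v = s \<bullet> v + t \<bullet> v"
  "s \<bullet> (v - w) = s \<bullet> v - s \<bullet> w"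
  by (auto simp: fun_eq_iff fun_ops algebra_simps)

lemma sum_fun_apply: "(\<Sum>i\<in>I. v i) \<sigma> = (\<Sum>i\<in>I. v i \<sigma> :: 'r::comm_monoid_add)"
  by (induction I rule: infinite_finite_induct) (auto simp: fun_ops)

lemma scl_sum: "s \<bullet> (\<Sum>i\<in>I. v i) = (\<Sum>i\<in>I. s \<bullet> v i)" "(\<Sum>i\<in>I. t i) \<bullet> w = (\<Sum>i\<in>I. t i \<bullet> w)"
  by (auto simp: fun_eq_iff fun_ops sum_fun_apply sum_distrib_left sum_distrib_right)

definition lin :: "('r::comm_ring_1 ext \<Rightarrow> 'r ext) \<Rightarrow> bool"
  where "lin f \<longleftrightarrow> (\<forall>v w. f (v + w) = f v + f w) \<and> (\<forall>s v. f (s \<bullet> v) = s \<bullet> f v)"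

lemma lin_add: "lin f \<Longrightarrow> f (v + w) = f v + f w"
  and lin_scl: "lin f \<Longrightarrow> f (s \<bullet> v) = s \<bullet> f v"
  by (auto simp: lin_def)

lemma lin_zero: "lin f \<Longrightarrow> f 0 = 0"
  using lin_scl[of f 0 0] by simp

lemma lin_minus: "lin f \<Longrightarrow> f (- v) = - f v"
  using lin_scl[of f "-1" v] by simp

lemma lin_diff: "lin f \<Longrightarrow> f (v - w) = f v - f w"
  using lin_add[of f v "- w"] by (simp add: lin_minus[of f])

lemma lin_sum: "lin f \<Longrightarrow> f (\<Sum>i\<in>I. v i) = (\<Sum>i\<in>I. f (v i))"
  by (induction I rule: infinite_finite_induct) (auto simp: lin_zero[of f] lin_add[of f])

lemma lin_id: "lin (\<lambda>v. v)"
  by (simp add: lin_def)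

lemma lin_comp: "lin f \<Longrightarrow> lin g \<Longrightarrow> lin (\<lambda>v. f (g v))"
  by (simp add: lin_def)

lemma lin_scaled: "lin f \<Longrightarrow> lin (\<lambda>v. s \<bullet> f v)"
  by (simp add: lin_def scl_add mult.commute)

lemma lin_sums: "(\<And>i. i \<in> I \<Longrightarrow> lin (f i)) \<Longrightarrow> lin (\<lambda>v. \<Sum>i\<in>I. f i v)"
  by (simp add: lin_def sum.distrib scl_sum)

text \<open>The sign of moving the generator \<open>j\<close> to its place among those of \<open>\<sigma>\<close>.\<close>

definition sgn_at :: "nat \<Rightarrow> nat set \<Rightarrow> 'r::comm_ring_1"
  where "sgn_at j \<sigma> = (-1) ^ card {i \<in> \<sigma>. i < j}"

definition wedge :: "nat \<Rightarrow> 'r::comm_ring_1 ext \<Rightarrow> 'r ext"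
  where "wedge j v = (\<lambda>\<sigma>. if j \<in> \<sigma> then sgn_at j \<sigma> * v (\<sigma> - {j}) else 0)"

definition contr :: "nat \<Rightarrow> 'r::comm_ring_1 ext \<Rightarrow> 'r ext"
  where "contr j v = (\<lambda>\<sigma>. if j \<in> \<sigma> then 0 else sgn_at j \<sigma> * v (insert j \<sigma>))"

text \<open>Contraction with \<open>(1, \<dots>, 1)\<close>, that is, the boundary of the augmented \<open>(n - 1)\<close>-simplex.\<close>

definition bd :: "nat \<Rightarrow> 'r::comm_ring_1 ext \<Rightarrow> 'r ext"
  where "bd n v = (\<Sum>j<n. contr j v)"

lemma sgn_at_sq [simp]: "sgn_at j \<sigma> * sgn_at j \<sigma> = (1 :: 'r::comm_ring_1)"
  "sgn_at j \<sigma> * (sgn_at j \<sigma> * x) = (x :: 'r)"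
  by (simp_all add: sgn_at_def flip: mult.assoc power_mult_distrib)

lemma sgn_at_insert:
  assumes "k \<notin> \<sigma>"
  shows "sgn_at j (insert k \<sigma>) = (if k < j then - sgn_at j \<sigma> else sgn_at j \<sigma> :: 'r::comm_ring_1)"
proof (cases "k < j")
  case True
  then have "{i \<in> insert k \<sigma>. i < j} = insert k {i \<in> \<sigma>. i < j}"
    by auto
  then show ?thesis
    using assms True by (simp add: sgn_at_def)
next
  case False
  then have "{i \<in> insert k \<sigma>. i < j} = {i \<in> \<sigma>. i < j}"
    by auto
  then show ?thesis
    using False by (simp add: sgn_at_def)
qed

lemma sgn_at_remove:
  assumes "k \<in> \<sigma>"
  shows "sgn_at j (\<sigma> - {k}) = (if k < j then - sgn_at j \<sigma> else sgn_at j \<sigma> :: 'r::comm_ring_1)"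
  using sgn_at_insert[of k "\<sigma> - {k}" j, where 'r = 'r] assms by (simp add: insert_absorb)

lemma sgn_at_min:
  assumes "\<forall>i\<in>\<sigma>. j < i"
  shows "sgn_at j (insert j \<sigma>) = 1"
proof -
  have "{i \<in> insert j \<sigma>. i < j} = {}"
    using assms by (auto dest: less_asym)
  then show ?thesis
    by (simp only: sgn_at_def card.empty power_0)
qed

lemma lin_wedge: "lin (wedge j)"
  by (auto simp: lin_def wedge_def fun_ops fun_eq_iff algebra_simps)

lemma lin_contr: "lin (contr j)"
  by (auto simp: lin_def contr_def fun_ops fun_eq_iff algebra_simps)

lemma lin_bd: "lin (bd n)"
  unfolding bd_def by (rule lin_sums) (rule lin_contr)

lemma wedge_wedge_same: "wedge j (wedge j v) = 0"
  by (auto simp: wedge_def fun_ops fun_eq_iff)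

lemma wedge_anticomm: "wedge j (wedge k v) = - wedge k (wedge j v)"
  by (cases "j = k") (auto simp: wedge_def fun_ops fun_eq_iff sgn_at_remove Diff_insert2[symmetric]
      insert_commute)

lemma contr_contr_same: "contr j (contr j v) = 0"
  by (auto simp: contr_def fun_ops fun_eq_iff)

lemma contr_anticomm: "contr j (contr k v) = - contr k (contr j v)"
  by (cases "j = k") (auto simp: contr_def fun_ops fun_eq_iff sgn_at_insert insert_commute)

lemma contr_wedge: "contr j (wedge k v) = (if j = k then v else 0) - wedge k (contr j v)"
proof (cases "j = k")
  case True
  then show ?thesis
    by (auto simp: contr_def wedge_def fun_ops fun_eq_iff sgn_at_insert sgn_at_remove insert_absorb)
next
  case False
  have "insert j \<sigma> - {k} = insert j (\<sigma> - {k})" for \<sigma>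
    using False by auto
  with False show ?thesis
    by (auto simp: contr_def wedge_def fun_ops fun_eq_iff sgn_at_insert sgn_at_remove)
qed

text \<open>The square of a sum of anticommuting operators is the sum of their squares.\<close>

lemma sum_anticomm_square:
  fixes f :: "nat \<Rightarrow> 'r::comm_ring_1 ext \<Rightarrow> 'r ext"
  assumes "\<And>i. lin (f i)" and "\<And>i v. f i (f i v) = 0" and "\<And>i j v. f i (f j v) = - f j (f i v)"
  shows "(\<Sum>i<n. f i (\<Sum>j<n. f j v)) = 0"
proof (induction n)
  case (Suc n)
  have "(\<Sum>i<n. f i (f n v)) = - f n (\<Sum>i<n. f i v)"
    unfolding lin_sum[OF assms(1)] sum_negf[symmetric] by (intro sum.cong refl assms(3))
  then show ?case
    using Suc assms(2) by (simp add: lin_add[OF assms(1)] sum.distrib)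
qed simp

lemma bd_bd: "bd n (bd n v) = 0"
  unfolding bd_def
  using sum_anticomm_square[of contr v n] lin_contr contr_contr_same contr_anticomm by blast

lemma bd_wedge:
  assumes "k < n"
  shows "bd n (wedge k v) = v - wedge k (bd n v)"
  using assms by (simp add: bd_def contr_wedge sum_subtractf lin_sum[OF lin_wedge] sum.delta')

text \<open>Left multiplication by the degree one element with coefficients \<open>g\<close>.\<close>

definition wedge_comb :: "nat \<Rightarrow> (nat \<Rightarrow> 'r) \<Rightarrow> 'r::comm_ring_1 ext \<Rightarrow> 'r ext"
  where "wedge_comb n g v = (\<Sum>i<n. g i \<bullet> wedge i v)"

lemma lin_wedge_comb: "lin (wedge_comb n g)"
  unfolding wedge_comb_def by (intro lin_sums lin_scaled lin_wedge)

lemma wedge_comb_square: "wedge_comb n g (wedge_comb n g v) = 0"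
  unfolding wedge_comb_def
proof (rule sum_anticomm_square[of "\<lambda>i v. g i \<bullet> wedge i v"])
  show "g i \<bullet> wedge i (g j \<bullet> wedge j v) = - (g j \<bullet> wedge j (g i \<bullet> wedge i v))" for i j v
    by (simp add: lin_scl[OF lin_wedge] mult.commute) (subst wedge_anticomm, simp)
qed (simp_all add: lin_scl[OF lin_wedge] wedge_wedge_same lin_scaled lin_wedge)

lemma wedge_comb_anticomm: "wedge_comb n g (wedge_comb n h v) = - wedge_comb n h (wedge_comb n g v)"
proof -
  have eq: "wedge_comb n g (wedge_comb n h v) = (\<Sum>i<n. \<Sum>j<n. (g i * h j) \<bullet> wedge i (wedge j v))" for g h
    by (simp add: wedge_comb_def lin_sum[OF lin_wedge] scl_sum lin_scl[OF lin_wedge])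
  show ?thesis
    unfolding eq sum_negf[symmetric]
    by (subst sum.swap, intro sum.cong refl) (subst wedge_anticomm, simp add: mult.commute)
qed

text \<open>The boundary is an antiderivation. So left multiplication by a degree one element is a null-homotopy
  for multiplication by the sum of its coefficients.\<close>

lemma bd_wedge_comb: "bd n (wedge_comb n g v) = (\<Sum>i<n. g i) \<bullet> v - wedge_comb n g (bd n v)"
  by (simp add: wedge_comb_def lin_sum[OF lin_bd] lin_scl[OF lin_bd] bd_wedge scl_add sum_subtractf
      scl_sum)

definition ext_basis :: "nat set \<Rightarrow> 'r::comm_ring_1 ext"
  where "ext_basis \<sigma> = (\<lambda>\<tau>. if \<tau> = \<sigma> then 1 else 0)"

abbreviation ext_one :: "'r::comm_ring_1 ext"
  where "ext_one \<equiv> ext_basis {}"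

lemma bd_ext_one: "bd n ext_one = 0"
  by (auto simp: bd_def contr_def ext_basis_def fun_ops fun_eq_iff sum_fun_apply intro!: sum.neutral)

lemma wedge_basis_min:
  assumes "\<forall>i\<in>\<sigma>. j < i"
  shows "wedge j (ext_basis \<sigma>) = (ext_basis (insert j \<sigma>) :: 'r::comm_ring_1 ext)"
proof -
  have "j \<in> \<tau> \<Longrightarrow> \<tau> - {j} = \<sigma> \<longleftrightarrow> \<tau> = insert j \<sigma>" for \<tau>
    using assms by auto
  then show ?thesis
    using sgn_at_min[OF assms] by (auto simp: wedge_def ext_basis_def fun_eq_iff)
qed

text \<open>If each \<open>Y j\<close> is a null-homotopy for multiplication by \<open>c j\<close>, then \<open>\<sigma> \<mapsto> Y\<^bsub>j\<^sub>1\<^esub> \<dots> Y\<^bsub>j\<^sub>s\<^esub> 1\<close>, for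
  \<open>\<sigma> = {j\<^sub>1 < \<dots> < j\<^sub>s}\<close>, is a chain map from the Koszul complex of \<open>c\<close> (see \<open>bd_op_prod\<close>).\<close>

definition op_prod :: "(nat \<Rightarrow> 'r::comm_ring_1 ext \<Rightarrow> 'r ext) \<Rightarrow> nat set \<Rightarrow> 'r ext"
  where "op_prod Y \<sigma> = foldr Y (sorted_list_of_set \<sigma>) ext_one"

text \<open>If \<open>bd \<circ> B j - B j \<circ> bd = Y j - Z j\<close>, then the products of the \<open>Y j\<close> and of the \<open>Z j\<close> define homotopic
  chain maps; this is the homotopy, obtained by changing one factor at a time (see \<open>bd_htpy\<close>).\<close>

primrec htpy_list ::
    "(nat \<Rightarrow> 'r::comm_ring_1 ext \<Rightarrow> 'r ext) \<Rightarrow> (nat \<Rightarrow> 'r ext \<Rightarrow> 'r ext) \<Rightarrow> (nat \<Rightarrow> 'r ext \<Rightarrow> 'r ext) \<Rightarrow>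
     nat list \<Rightarrow> 'r ext" where
  "htpy_list B Y Z [] = 0"
| "htpy_list B Y Z (j # L) = B j (foldr Z L ext_one) - Y j (htpy_list B Y Z L)"

definition htpy ::
    "(nat \<Rightarrow> 'r::comm_ring_1 ext \<Rightarrow> 'r ext) \<Rightarrow> (nat \<Rightarrow> 'r ext \<Rightarrow> 'r ext) \<Rightarrow> (nat \<Rightarrow> 'r ext \<Rightarrow> 'r ext) \<Rightarrow>
     nat set \<Rightarrow> 'r ext"
  where "htpy B Y Z \<sigma> = htpy_list B Y Z (sorted_list_of_set \<sigma>)"

lemma sorted_list_of_set_insert_min:
  fixes \<sigma> :: "nat set"
  assumes "finite \<sigma>" "\<forall>i\<in>\<sigma>. j < i"
  shows "sorted_list_of_set (insert j \<sigma>) = j # sorted_list_of_set \<sigma>"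
proof -
  have "Min (insert j \<sigma>) = j"
    using assms by (intro Min_eqI) (auto intro: less_imp_le)
  moreover have "insert j \<sigma> - {j} = \<sigma>"
    using assms by auto
  ultimately show ?thesis
    using assms sorted_list_of_set_nonempty[of "insert j \<sigma>"] by simp
qed

lemma op_prod_insert_min:
  assumes "finite \<sigma>" "\<forall>i\<in>\<sigma>. j < i"
  shows "op_prod Y (insert j \<sigma>) = Y j (op_prod Y \<sigma>)"
    and "htpy B Y Z (insert j \<sigma>) = B j (op_prod Z \<sigma>) - Y j (htpy B Y Z \<sigma>)"
  unfolding op_prod_def htpy_def sorted_list_of_set_insert_min[OF assms] by simp_all

lemma op_prod_empty [simp]: "op_prod Y {} = ext_one" "htpy B Y Z {} = 0"
  by (simp_all add: op_prod_def htpy_def)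

text \<open>The differential of the Koszul complex of \<open>c\<close>, composed with the linear map that has the value
  \<open>F \<sigma>\<close> on the basis element \<open>\<sigma>\<close>.\<close>

definition koszul_bd :: "(nat \<Rightarrow> 'r) \<Rightarrow> (nat set \<Rightarrow> 'r::comm_ring_1 ext) \<Rightarrow> nat set \<Rightarrow> 'r ext"
  where "koszul_bd c F \<sigma> = (\<Sum>i\<in>\<sigma>. (sgn_at i \<sigma> * c i) \<bullet> F (\<sigma> - {i}))"

text \<open>The recursion that drives both inductions below: adding a new least index \<open>j\<close> to \<open>\<sigma>\<close> leaves the
  face opposite to \<open>j\<close> and flips the signs of all others.\<close>

lemma koszul_bd_insert_min:
  fixes F :: "nat set \<Rightarrow> 'r::comm_ring_1 ext"
  assumes "finite \<sigma>" "\<forall>i\<in>\<sigma>. j < i"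
  shows "koszul_bd c F (insert j \<sigma>)
    = c j \<bullet> F \<sigma> - (\<Sum>i\<in>\<sigma>. (sgn_at i \<sigma> * c i) \<bullet> F (insert j (\<sigma> - {i})))"
proof -
  have j: "j \<notin> \<sigma>"
    using assms by auto
  have "(sgn_at i (insert j \<sigma>) * c i) \<bullet> F (insert j \<sigma> - {i})
      = - ((sgn_at i \<sigma> * c i) \<bullet> F (insert j (\<sigma> - {i})))" if "i \<in> \<sigma>" for i
  proof -
    have "insert j \<sigma> - {i} = insert j (\<sigma> - {i})" "j < i"
      using assms that by auto
    then show ?thesis
      using j by (simp add: sgn_at_insert)
  qed
  moreover have "insert j \<sigma> - {j} = \<sigma>"
    using j by auto
  ultimately show ?thesis
    using assms j by (simp add: koszul_bd_def sum_negf sgn_at_min)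
qed

text \<open>Moving \<open>bd\<close> past the factors one at a time, each \<open>Y j\<close> contributes the term in which it is replaced
  by the scalar \<open>c j\<close>.\<close>

lemma bd_op_prod:
  assumes "\<And>j. lin (Y j)" and "\<And>j v. j < n \<Longrightarrow> bd n (Y j v) = c j \<bullet> v - Y j (bd n v)"
    and "finite \<sigma>" "\<sigma> \<subseteq> {..<n}"
  shows "bd n (op_prod Y \<sigma>) = koszul_bd c (op_prod Y) \<sigma>"
  using assms(3,4)
proof (induction \<sigma> rule: finite_linorder_min_induct)
  case (insert j \<sigma>)
  have "op_prod Y (insert j (\<sigma> - {i})) = Y j (op_prod Y (\<sigma> - {i}))" for i
    using insert.hyps by (intro op_prod_insert_min) auto
  then have "Y j (koszul_bd c (op_prod Y) \<sigma>)
      = (\<Sum>i\<in>\<sigma>. (sgn_at i \<sigma> * c i) \<bullet> op_prod Y (insert j (\<sigma> - {i})))"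
    by (simp add: koszul_bd_def lin_sum[OF assms(1)] lin_scl[OF assms(1)])
  then show ?case
    using insert assms(2) by (simp add: op_prod_insert_min koszul_bd_insert_min)
qed (simp add: koszul_bd_def bd_ext_one)

lemma bd_htpy:
  assumes Y: "\<And>j. lin (Y j)" "\<And>j v. j < n \<Longrightarrow> bd n (Y j v) = c j \<bullet> v - Y j (bd n v)"
    and Z: "\<And>j. lin (Z j)" "\<And>j v. j < n \<Longrightarrow> bd n (Z j v) = c j \<bullet> v - Z j (bd n v)"
    and B: "\<And>j. lin (B j)" "\<And>j v. j < n \<Longrightarrow> bd n (B j v) = B j (bd n v) + Y j v - Z j v"
    and \<sigma>: "finite \<sigma>" "\<sigma> \<subseteq> {..<n}"
  shows "bd n (htpy B Y Z \<sigma>) = op_prod Y \<sigma> - op_prod Z \<sigma> - koszul_bd c (htpy B Y Z) \<sigma>"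
  using \<sigma>
proof (induction \<sigma> rule: finite_linorder_min_induct)
  case (insert j \<sigma>)
  have "htpy B Y Z (insert j (\<sigma> - {i})) = B j (op_prod Z (\<sigma> - {i})) - Y j (htpy B Y Z (\<sigma> - {i}))" for i
    using insert.hyps by (intro op_prod_insert_min) auto
  then have "(\<Sum>i\<in>\<sigma>. (sgn_at i \<sigma> * c i) \<bullet> htpy B Y Z (insert j (\<sigma> - {i})))
      = B j (koszul_bd c (op_prod Z) \<sigma>) - Y j (koszul_bd c (htpy B Y Z) \<sigma>)"
    by (simp add: koszul_bd_def lin_sum[OF Y(1)] lin_scl[OF Y(1)] lin_sum[OF B(1)] lin_scl[OF B(1)]
        sum_subtractf scl_add)
  moreover have "bd n (op_prod Z \<sigma>) = koszul_bd c (op_prod Z) \<sigma>"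
    using insert.prems insert.hyps by (intro bd_op_prod Z) auto
  ultimately have K: "koszul_bd c (htpy B Y Z) (insert j \<sigma>)
      = c j \<bullet> htpy B Y Z \<sigma> - (B j (bd n (op_prod Z \<sigma>)) - Y j (koszul_bd c (htpy B Y Z) \<sigma>))"
    using insert.hyps by (simp add: koszul_bd_insert_min)
  have "j < n" and IH: "bd n (htpy B Y Z \<sigma>) = op_prod Y \<sigma> - op_prod Z \<sigma> - koszul_bd c (htpy B Y Z) \<sigma>"
    using insert.prems insert.IH by auto
  then show ?case
    unfolding K using insert.hyps
    by (simp add: op_prod_insert_min lin_diff[OF lin_bd] lin_diff[OF Y(1)] Y(2) B(2) IH)
qed (simp add: koszul_bd_def lin_zero[OF lin_bd])

lemma lin_foldr: "(\<And>j. lin (Y j)) \<Longrightarrow> lin (foldr Y L)"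
  by (induction L) (simp_all add: lin_id id_def comp_def lin_comp)

lemma foldr_anticomm_zero:
  assumes "\<And>k. lin (E k)" "\<And>k v. E k (E k v) = 0" "\<And>k l v. E k (E l v) = - E l (E k v)"
    and "k \<in> set l"
  shows "E k (foldr E l u) = 0"
  using assms(4)
proof (induction l)
  case (Cons l ls)
  show ?case
  proof (cases "k = l")
    case False
    then have "E l (E k (foldr E ls u)) = 0"
      using Cons by (simp add: lin_zero[OF assms(1)])
    then show ?thesis
      using assms(3)[of k l] by simp
  qed (simp add: assms(2))
qed simp

text \<open>Expanding the \<open>Y j\<close> from the right produces words in the \<open>r\<close> anticommuting operators \<open>E k\<close>. A word
  with a repeated letter is zero, and a word longer than \<open>r\<close> repeats a letter. This is where the
  number of generators up to radical bounds the degree.\<close>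

lemma foldr_pigeonhole:
  fixes E :: "nat \<Rightarrow> 'r::comm_ring_1 ext \<Rightarrow> 'r ext"
  assumes E: "\<And>k. lin (E k)" "\<And>k v. E k (E k v) = 0" "\<And>k l v. E k (E l v) = - E l (E k v)"
    and Y: "\<And>j v. Y j v = (\<Sum>k<r. c j k \<bullet> E k v)"
    and "distinct l" "set l \<subseteq> {..<r}" "r < length L + length l"
  shows "foldr Y L (foldr E l u) = 0"
  using assms(5-)
proof (induction L arbitrary: l rule: rev_induct)
  case Nil
  then have "length l \<le> r"
    using card_mono[of "{..<r}" "set l"] by (simp add: distinct_card)
  with Nil show ?case
    by simp
next
  case (snoc j L)
  have "lin (Y j)" for j
    unfolding Y by (intro lin_sums lin_scaled E)
  then have lin: "lin (foldr Y L)"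
    by (rule lin_foldr)
  have "foldr Y L (E k (foldr E l u)) = 0" if "k < r" for k
  proof (cases "k \<in> set l")
    case True
    then show ?thesis
      using foldr_anticomm_zero[of E, OF E] lin_zero[OF lin] by simp
  next
    case False
    then show ?thesis
      using snoc.IH[of "k # l"] snoc.prems that by simp
  qed
  then show ?case
    by (simp add: Y[of j] lin_sum[OF lin] lin_scl[OF lin])
qed

lemma op_prod_pigeonhole:
  fixes E :: "nat \<Rightarrow> 'r::comm_ring_1 ext \<Rightarrow> 'r ext"
  assumes "\<And>k. lin (E k)" "\<And>k v. E k (E k v) = 0" "\<And>k l v. E k (E l v) = - E l (E k v)"
    and "\<And>j v. Y j v = (\<Sum>k<r. c j k \<bullet> E k v)" and "finite \<sigma>" "r < card \<sigma>"
  shows "op_prod Y \<sigma> = 0"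
  using foldr_pigeonhole[of E Y c r "[]" "sorted_list_of_set \<sigma>" ext_one, OF assms(1-4)] assms(5,6)
  by (simp add: op_prod_def)

section \<open>The power map and its splitting\<close>

definition flat_exp :: "nat \<Rightarrow> nat set \<Rightarrow> (nat \<Rightarrow>\<^sub>0 nat)"
  where "flat_exp k S = (\<Sum>x\<in>S. Poly_Mapping.single x k)"

lemma lookup_flat_exp: "finite S \<Longrightarrow> Poly_Mapping.lookup (flat_exp k S) x = (if x \<in> S then k else 0)"
  by (auto simp: flat_exp_def lookup_sum lookup_single when_def sum.delta)

lemma keys_flat_exp: "finite S \<Longrightarrow> Poly_Mapping.keys (flat_exp k S) = (if k = 0 then {} else S)"
  by (auto simp: in_keys_iff lookup_flat_exp split: if_splits intro!: poly_mapping_eqI)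

lemma flat_exp_add: "flat_exp (k + l) S = flat_exp k S + flat_exp l S"
  by (simp add: flat_exp_def single_add sum.distrib)

lemma keys_add_exp: "Poly_Mapping.keys (a + b) = Poly_Mapping.keys a \<union> Poly_Mapping.keys (b :: nat \<Rightarrow>\<^sub>0 nat)"
  by (auto simp: in_keys_iff lookup_add)

definition stretch :: "nat \<Rightarrow> (nat \<Rightarrow>\<^sub>0 nat) \<Rightarrow> (nat \<Rightarrow>\<^sub>0 nat)"
  where "stretch N m = Poly_Mapping.map ((*) N) m"

lemma lookup_stretch [simp]: "Poly_Mapping.lookup (stretch N m) x = N * Poly_Mapping.lookup m x"
  by (simp add: stretch_def Poly_Mapping.map.rep_eq when_def)

lemma stretch_add: "stretch N (a + b) = stretch N a + stretch N b"
  by (rule poly_mapping_eqI) (simp add: lookup_add distrib_left)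

lemma inj_stretch: "0 < N \<Longrightarrow> inj (stretch N)"
proof (rule injI)
  fix a b assume "0 < N" "stretch N a = stretch N b"
  then have "N * Poly_Mapping.lookup a x = N * Poly_Mapping.lookup b x" for x
    using lookup_stretch by metis
  with \<open>0 < N\<close> show "a = b"
    by (intro poly_mapping_eqI) simp
qed

lemma keys_stretch: "0 < N \<Longrightarrow> Poly_Mapping.keys (stretch N m) = Poly_Mapping.keys m"
  by (auto simp: in_keys_iff)

text \<open>The ring endomorphism \<open>x \<mapsto> x\<^sup>N\<close>, which plays the role of the Frobenius map in every characteristic.\<close>

definition frob :: "nat \<Rightarrow> 'k::field mpoly \<Rightarrow> 'k mpoly"
  where "frob N = exp_map (stretch N)"

text \<open>Keeps the monomials that are \<open>N\<close>-th powers and replaces each by its \<open>N\<close>-th root: a splitting of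
  \<open>frob N\<close> that is linear over its image (see \<open>frob_split_mult\<close>).\<close>

definition frob_split :: "nat \<Rightarrow> 'k::field mpoly \<Rightarrow> 'k mpoly"
  where "frob_split N p = Poly_Mapping.map_key (stretch N) p"

lemma frob_simps: "frob N (p + q) = frob N p + frob N q" "frob N (p * q) = frob N p * frob N q"
  "frob N 0 = 0"
  by (simp_all add: frob_def exp_map_add exp_map_mult stretch_add)

lemma lookup_frob_split:
  "0 < N \<Longrightarrow> Poly_Mapping.lookup (frob_split N p) m = Poly_Mapping.lookup p (stretch N m)"
  by (simp add: frob_split_def map_key.rep_eq[OF inj_stretch])

lemma frob_split_add: "0 < N \<Longrightarrow> frob_split N (p + q) = frob_split N p + frob_split N q"
  by (rule poly_mapping_eqI) (simp add: lookup_frob_split lookup_add)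

lemma frob_split_zero: "0 < N \<Longrightarrow> frob_split N 0 = 0"
  by (rule poly_mapping_eqI) (simp add: lookup_frob_split)

lemma frob_split_frob: "0 < N \<Longrightarrow> frob_split N (frob N p) = p"
  by (rule poly_mapping_eqI) (simp add: lookup_frob_split frob_def lookup_exp_map inj_stretch)

lemma frob_split_single:
  assumes "0 < N"
  shows "frob_split N (frob N (Poly_Mapping.single a c) * Poly_Mapping.single b d)
    = Poly_Mapping.single a c * frob_split N (Poly_Mapping.single b d)"
proof (cases "\<exists>b'. b = stretch N b'")
  case True
  then obtain b' where b: "b = stretch N b'" by blast
  have "frob_split N (Poly_Mapping.single (stretch N e) u) = Poly_Mapping.single e u" for e and u :: 'a
    using assms frob_split_frob[of N "Poly_Mapping.single e u"] by (simp add: frob_def)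
  then show ?thesis
    by (simp add: b frob_def Poly_Mapping.mult_single flip: stretch_add)
next
  case False
  then have "frob_split N (Poly_Mapping.single b d) = 0"
    using assms by (intro poly_mapping_eqI) (auto simp: lookup_frob_split lookup_single when_def)
  moreover have "stretch N a + b \<noteq> stretch N m" for m
  proof
    assume eq: "stretch N a + b = stretch N m"
    have "b = stretch N (m - a)"
    proof (rule poly_mapping_eqI)
      fix x
      have "N * Poly_Mapping.lookup a x + Poly_Mapping.lookup b x = N * Poly_Mapping.lookup m x"
        using arg_cong[OF eq, of "\<lambda>e. Poly_Mapping.lookup e x"] by (simp add: lookup_add)
      then show "Poly_Mapping.lookup b x = Poly_Mapping.lookup (stretch N (m - a)) x"
        by (simp add: lookup_minus right_diff_distrib')
    qed
    with False show False by blast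
  qed
  then have "frob_split N (Poly_Mapping.single (stretch N a + b) (c * d)) = 0"
    using assms by (intro poly_mapping_eqI) (auto simp: lookup_frob_split lookup_single when_def)
  ultimately show ?thesis
    by (simp add: frob_def Poly_Mapping.mult_single)
qed

lemma frob_split_mult:
  assumes "0 < N"
  shows "frob_split N (frob N s * p) = s * frob_split N p"
proof (induction s rule: mpoly_induct)
  case (single a c)
  show ?case
    by (induction p rule: mpoly_induct)
      (simp_all add: assms frob_split_zero frob_split_add distrib_left frob_split_single)
qed (simp_all add: assms frob_split_zero frob_split_add distrib_right frob_simps)

definition restrict_keys :: "((nat \<Rightarrow>\<^sub>0 nat) \<Rightarrow> bool) \<Rightarrow> 'k::field mpoly \<Rightarrow> 'k mpoly"
  where "restrict_keys P p = Poly_Mapping.mapp (\<lambda>m c. if P m then c else 0) p"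

lemma lookup_restrict_keys:
  "Poly_Mapping.lookup (restrict_keys P p) m = (if P m then Poly_Mapping.lookup p m else 0)"
  by (auto simp: restrict_keys_def lookup_mapp in_keys_iff when_def)

lemma restrict_keys_add: "restrict_keys P (p + q) = restrict_keys P p + restrict_keys P q"
  by (rule poly_mapping_eqI) (simp add: lookup_restrict_keys lookup_add)

definition coeffwise :: "('r \<Rightarrow> 'r) \<Rightarrow> 'r ext \<Rightarrow> 'r ext"
  where "coeffwise t v = (\<lambda>\<sigma>. t (v \<sigma>))"

lemma coeffwise_signed:
  fixes t :: "'r::comm_ring_1 \<Rightarrow> 'r"
  assumes t: "\<And>p q. t (p + q) = t p + t q"
  shows "t (sgn_at j \<sigma> * p) = sgn_at j \<sigma> * t p" and "t (sum f I) = (\<Sum>i\<in>I. t (f i))"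
    and "t 0 = 0" and "t (- p) = - t p"
proof -
  show z: "t 0 = 0"
    using t[of 0 0] by simp
  show u: "t (- p) = - t p" for p
    using t[of p "- p"] z by (simp add: eq_neg_iff_add_eq_0 add.commute)
  have "t ((-1) ^ k * p) = (-1) ^ k * t p" for k
    by (induction k) (simp_all add: u)
  then show "t (sgn_at j \<sigma> * p) = sgn_at j \<sigma> * t p"
    by (simp add: sgn_at_def)
  show "t (sum f I) = (\<Sum>i\<in>I. t (f i))"
    by (induction I rule: infinite_finite_induct) (simp_all add: z t)
qed

text \<open>The boundary only multiplies coefficients by signs, which additive maps respect.\<close>

lemma bd_coeffwise:
  fixes t :: "'r::comm_ring_1 \<Rightarrow> 'r"
  assumes "\<And>p q. t (p + q) = t p + t q"
  shows "bd n (coeffwise t v) = coeffwise t (bd n v)"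
  by (simp add: bd_def contr_def coeffwise_def fun_eq_iff sum_fun_apply coeffwise_signed[of t, OF assms]
      if_distrib[of t] cong: if_cong)

section \<open>The Taylor complex\<close>

text \<open>The generators of the ideal are the squarefree monomials with supports \<open>A 0, \<dots>, A (n - 1)\<close>, in the
  variables \<open>X\<close>.\<close>

locale taylor =
  fixes X :: "nat set" and n :: nat and A :: "nat \<Rightarrow> nat set"
  assumes finite_A: "\<And>j. j < n \<Longrightarrow> finite (A j)" and A_sub: "\<And>j. j < n \<Longrightarrow> A j \<subseteq> X"
begin

text \<open>The ideal generated by the lcm of the generators in \<open>\<sigma>\<close>. That lcm is squarefree, so divisibility by
  it is a condition on the support of a monomial; this makes the ideal stable under \<open>frob N\<close> and
  \<open>frob_split N\<close>, for \<open>N > 0\<close>. For \<open>\<sigma> = {}\<close> it is the whole polynomial ring in \<open>X\<close>.\<close>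

definition lcm_ideal :: "nat set \<Rightarrow> 'k::field mpoly set"
  where "lcm_ideal \<sigma> = {p. \<forall>m\<in>Poly_Mapping.keys p. (\<Union>j\<in>\<sigma>. A j) \<subseteq> Poly_Mapping.keys m \<and> Poly_Mapping.keys m \<subseteq> X}"

text \<open>The degree \<open>i\<close> part of the Taylor complex, with \<open>lcm m\<^sub>\<sigma>\<close> times the wedge of \<open>\<sigma>\<close> as basis. Its
  differential is \<open>bd n\<close>.\<close>

definition taylor_mod :: "nat \<Rightarrow> 'k::field mpoly ext set"
  where "taylor_mod i = {v. (\<forall>\<sigma>. v \<sigma> \<in> lcm_ideal \<sigma>) \<and> (\<forall>\<sigma>. v \<sigma> \<noteq> 0 \<longrightarrow> \<sigma> \<subseteq> {..<n} \<and> card \<sigma> = i)}"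

lemma lcm_ideal_empty: "lcm_ideal {} = {p. vars p \<subseteq> X}"
  by (auto simp: lcm_ideal_def vars_def)

lemma lcm_ideal_zero: "0 \<in> lcm_ideal \<sigma>"
  by (simp add: lcm_ideal_def)

lemma lcm_ideal_add: "p \<in> lcm_ideal \<sigma> \<Longrightarrow> q \<in> lcm_ideal \<sigma> \<Longrightarrow> p + q \<in> lcm_ideal \<sigma>"
  unfolding lcm_ideal_def using Poly_Mapping.keys_add[of p q] by blast

lemma lcm_ideal_uminus: "p \<in> lcm_ideal \<sigma> \<Longrightarrow> - p \<in> lcm_ideal \<sigma>"
  by (simp add: lcm_ideal_def Poly_Mapping.keys_def)

lemma lcm_ideal_mult:
  assumes "p \<in> lcm_ideal \<sigma>" "q \<in> lcm_ideal \<tau>"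
  shows "p * q \<in> lcm_ideal (\<sigma> \<union> \<tau>)"
proof -
  have "(\<Union>j\<in>\<sigma> \<union> \<tau>. A j) \<subseteq> Poly_Mapping.keys m \<and> Poly_Mapping.keys m \<subseteq> X"
    if "m \<in> Poly_Mapping.keys (p * q)" for m
  proof -
    obtain a b where m: "m = a + b" and ab: "a \<in> Poly_Mapping.keys p" "b \<in> Poly_Mapping.keys q"
      using \<open>m \<in> Poly_Mapping.keys (p * q)\<close> keys_mult[of p q] by blast
    have "(\<Union>j\<in>\<sigma>. A j) \<subseteq> Poly_Mapping.keys a \<and> Poly_Mapping.keys a \<subseteq> X"
      "(\<Union>j\<in>\<tau>. A j) \<subseteq> Poly_Mapping.keys b \<and> Poly_Mapping.keys b \<subseteq> X"
      using assms ab by (simp_all add: lcm_ideal_def)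
    then show ?thesis
      unfolding m keys_add_exp UN_Un by blast
  qed
  then show ?thesis
    by (simp add: lcm_ideal_def)
qed

lemma lcm_ideal_antimono: "\<sigma> \<subseteq> \<tau> \<Longrightarrow> lcm_ideal \<tau> \<subseteq> lcm_ideal \<sigma>"
  unfolding lcm_ideal_def by blast

lemma lcm_ideal_scale: "s \<in> lcm_ideal {} \<Longrightarrow> p \<in> lcm_ideal \<sigma> \<Longrightarrow> s * p \<in> lcm_ideal \<sigma>"
  using lcm_ideal_mult[of s "{}" p \<sigma>] by simp

lemma lcm_ideal_one: "1 \<in> lcm_ideal {}"
  by (simp add: lcm_ideal_def)

lemma lcm_ideal_sgn: "p \<in> lcm_ideal \<sigma> \<Longrightarrow> sgn_at j \<tau> * p \<in> lcm_ideal \<sigma>"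
proof -
  have "(-1) ^ k * p \<in> lcm_ideal \<sigma>" if "p \<in> lcm_ideal \<sigma>" for k
    using that by (induction k) (auto intro: lcm_ideal_uminus)
  then show "p \<in> lcm_ideal \<sigma> \<Longrightarrow> sgn_at j \<tau> * p \<in> lcm_ideal \<sigma>"
    by (simp add: sgn_at_def)
qed

lemma lcm_ideal_mon: "j < n \<Longrightarrow> 0 < k \<Longrightarrow> mon (flat_exp k (A j)) \<in> lcm_ideal {j}"
  using finite_A A_sub by (auto simp: lcm_ideal_def keys_flat_exp)

lemma lcm_ideal_frob:
  assumes "0 < N" "p \<in> lcm_ideal \<sigma>"
  shows "frob N p \<in> lcm_ideal \<sigma>"
proof -
  have "\<exists>m'\<in>Poly_Mapping.keys p. Poly_Mapping.keys m = Poly_Mapping.keys m'"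
    if "m \<in> Poly_Mapping.keys (frob N p)" for m
    using that keys_exp_map[of "stretch N" p] keys_stretch[OF assms(1)] unfolding frob_def by blast
  then show ?thesis
    using assms(2) unfolding lcm_ideal_def by force
qed

lemma lcm_ideal_frob_split:
  assumes "0 < N" "p \<in> lcm_ideal \<sigma>"
  shows "frob_split N p \<in> lcm_ideal \<sigma>"
proof -
  have "stretch N m \<in> Poly_Mapping.keys p" if "m \<in> Poly_Mapping.keys (frob_split N p)" for m
    using that by (simp add: in_keys_iff lookup_frob_split assms(1))
  then show ?thesis
    using assms(2) keys_stretch[OF assms(1)] unfolding lcm_ideal_def by fastforce
qed

lemma lcm_ideal_mon_quot:
  assumes "p \<in> lcm_ideal \<sigma>"
  shows "mon_quot e p \<in> lcm_ideal {}"
proof -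
  have "Poly_Mapping.keys m \<subseteq> X" if "m \<in> Poly_Mapping.keys (mon_quot e p)" for m
  proof -
    have "e + m \<in> Poly_Mapping.keys p"
      using that by (simp add: in_keys_iff lookup_mon_quot)
    then have "Poly_Mapping.keys (e + m) \<subseteq> X"
      using assms by (simp add: lcm_ideal_def)
    then show ?thesis
      by (simp add: keys_add_exp)
  qed
  then show ?thesis
    by (simp add: lcm_ideal_def)
qed

lemma taylor_mod_D: "v \<in> taylor_mod i \<Longrightarrow> v \<sigma> \<in> lcm_ideal \<sigma>" "v \<in> taylor_mod i \<Longrightarrow> v \<sigma> \<noteq> 0 \<Longrightarrow> \<sigma> \<subseteq> {..<n} \<and> card \<sigma> = i"
  by (auto simp: taylor_mod_def)

lemma taylor_mod_I: "(\<And>\<sigma>. v \<sigma> \<in> lcm_ideal \<sigma>) \<Longrightarrow> (\<And>\<sigma>. v \<sigma> \<noteq> 0 \<Longrightarrow> \<sigma> \<subseteq> {..<n} \<and> card \<sigma> = i) \<Longrightarrow> v \<in> taylor_mod i"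
  by (auto simp: taylor_mod_def)

lemma taylor_mod_zero: "0 \<in> taylor_mod i"
  by (auto simp: taylor_mod_def lcm_ideal_zero fun_ops)

lemma taylor_mod_add:
  assumes "v \<in> taylor_mod i" "w \<in> taylor_mod i"
  shows "v + w \<in> taylor_mod i"
proof (rule taylor_mod_I)
  fix \<sigma>
  show "(v + w) \<sigma> \<in> lcm_ideal \<sigma>"
    using assms by (simp add: fun_ops lcm_ideal_add taylor_mod_D(1))
  assume "(v + w) \<sigma> \<noteq> 0"
  then have "v \<sigma> \<noteq> 0 \<or> w \<sigma> \<noteq> 0"
    by (auto simp: fun_ops)
  then show "\<sigma> \<subseteq> {..<n} \<and> card \<sigma> = i"
    using assms taylor_mod_D(2) by blast
qed

lemma taylor_mod_uminus: "v \<in> taylor_mod i \<Longrightarrow> - v \<in> taylor_mod i"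
  by (auto simp: taylor_mod_def lcm_ideal_uminus fun_ops)

lemma taylor_mod_diff: "v \<in> taylor_mod i \<Longrightarrow> w \<in> taylor_mod i \<Longrightarrow> v - w \<in> taylor_mod i"
  using taylor_mod_add[of v i "- w"] taylor_mod_uminus[of w i] by simp

lemma taylor_mod_sum: "(\<And>i. i \<in> I \<Longrightarrow> f i \<in> taylor_mod k) \<Longrightarrow> sum f I \<in> taylor_mod k"
  by (induction I rule: infinite_finite_induct) (auto intro: taylor_mod_zero taylor_mod_add)

lemma taylor_mod_scale: "s \<in> lcm_ideal {} \<Longrightarrow> v \<in> taylor_mod i \<Longrightarrow> s \<bullet> v \<in> taylor_mod i"
  by (auto simp: taylor_mod_def lcm_ideal_scale fun_ops)

lemma taylor_mod_ext_one: "ext_one \<in> taylor_mod 0"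
  by (auto simp: taylor_mod_def ext_basis_def lcm_ideal_one lcm_ideal_zero)

lemma taylor_mod_coeffwise:
  assumes "v \<in> taylor_mod i" "\<And>\<sigma> p. p \<in> lcm_ideal \<sigma> \<Longrightarrow> t p \<in> lcm_ideal \<sigma>" "t 0 = 0"
  shows "coeffwise t v \<in> taylor_mod i"
proof (rule taylor_mod_I)
  fix \<sigma>
  show "coeffwise t v \<sigma> \<in> lcm_ideal \<sigma>"
    using assms taylor_mod_D(1)[OF assms(1)] by (simp add: coeffwise_def)
  assume "coeffwise t v \<sigma> \<noteq> 0"
  then have "v \<sigma> \<noteq> 0"
    using assms(3) by (auto simp: coeffwise_def)
  then show "\<sigma> \<subseteq> {..<n} \<and> card \<sigma> = i"
    by (rule taylor_mod_D(2)[OF assms(1)])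
qed

lemma taylor_mod_wedge:
  assumes "v \<in> taylor_mod i" "j < n" and p: "\<And>\<sigma>. p * v \<sigma> \<in> lcm_ideal (insert j \<sigma>)"
  shows "p \<bullet> wedge j v \<in> taylor_mod (Suc i)"
proof (rule taylor_mod_I)
  fix \<sigma>
  show "(p \<bullet> wedge j v) \<sigma> \<in> lcm_ideal \<sigma>"
    using lcm_ideal_sgn[OF p[of "\<sigma> - {j}"], of j \<sigma>]
    by (auto simp: wedge_def fun_ops lcm_ideal_zero insert_absorb mult.left_commute)
  assume nz: "(p \<bullet> wedge j v) \<sigma> \<noteq> 0"
  then have "j \<in> \<sigma>" "v (\<sigma> - {j}) \<noteq> 0"
    by (auto simp: wedge_def fun_ops split: if_splits)
  with taylor_mod_D(2)[OF assms(1), of "\<sigma> - {j}"] assms(2) have "\<sigma> \<subseteq> {..<n}" "card (\<sigma> - {j}) = i"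
    by auto
  with \<open>j \<in> \<sigma>\<close> show "\<sigma> \<subseteq> {..<n} \<and> card \<sigma> = Suc i"
    using card_Suc_Diff1[of \<sigma> j] finite_subset[of \<sigma> "{..<n}"] by auto
qed

lemma taylor_mod_wedge_scale:
  assumes "v \<in> taylor_mod i" "j < n" "p \<in> lcm_ideal {j}"
  shows "p \<bullet> wedge j v \<in> taylor_mod (Suc i)"
  using assms lcm_ideal_mult[OF assms(3) taylor_mod_D(1)[OF assms(1)]] by (intro taylor_mod_wedge) auto

lemma taylor_mod_bd:
  assumes "v \<in> taylor_mod (Suc i)"
  shows "bd n v \<in> taylor_mod i"
  unfolding bd_def
proof (rule taylor_mod_sum)
  fix j assume "j \<in> {..<n}"
  show "contr j v \<in> taylor_mod i"
  proof (rule taylor_mod_I)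
    fix \<sigma>
    show "contr j v \<sigma> \<in> lcm_ideal \<sigma>"
      using lcm_ideal_antimono[of \<sigma> "insert j \<sigma>"] taylor_mod_D(1)[OF assms, of "insert j \<sigma>"]
      by (auto simp: contr_def lcm_ideal_zero intro: lcm_ideal_sgn)
    assume "contr j v \<sigma> \<noteq> 0"
    then have "j \<notin> \<sigma>" "v (insert j \<sigma>) \<noteq> 0"
      by (auto simp: contr_def split: if_splits)
    with taylor_mod_D(2)[OF assms, of "insert j \<sigma>"] show "\<sigma> \<subseteq> {..<n} \<and> card \<sigma> = i"
      using finite_subset[of \<sigma> "{..<n}"] by auto
  qed
qed

text \<open>The contraction is defined monomial by monomial: the part of \<open>v\<close> in multidegree \<open>m\<close> is wedged with
  the first generator that divides \<open>m\<close>. Since \<open>bd n\<close> preserves multidegrees, on each of these parts the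
  wedge with a fixed generator is a contracting homotopy. Only for \<open>i = 0\<close> can a monomial of \<open>v\<close> fail
  to have such a generator, whence the condition on the coefficient of \<open>{}\<close>.\<close>

lemma taylor_mod_exact:
  assumes v: "v \<in> taylor_mod i" "bd n v = 0"
    and I: "\<And>m. m \<in> Poly_Mapping.keys (v {}) \<Longrightarrow> \<exists>j<n. A j \<subseteq> Poly_Mapping.keys m"
  shows "\<exists>w\<in>taylor_mod (Suc i). bd n w = v"
proof -
  define fst_gen where "fst_gen (m :: nat \<Rightarrow>\<^sub>0 nat) = (LEAST j. A j \<subseteq> Poly_Mapping.keys m)" for m
  define part :: "nat \<Rightarrow> 'a mpoly \<Rightarrow> 'a mpoly" where "part j = restrict_keys (\<lambda>m. fst_gen m = j \<and> A j \<subseteq> Poly_Mapping.keys m)" for j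
  have part_add: "part j (p + q) = part j p + part j q" for j p q
    by (simp add: part_def restrict_keys_add)
  have ex: "\<exists>j<n. A j \<subseteq> Poly_Mapping.keys m" if m: "m \<in> Poly_Mapping.keys (v \<sigma>)" for m \<sigma>
  proof (cases "\<sigma> = {}")
    case False
    then obtain j where "j \<in> \<sigma>" by blast
    moreover have "\<sigma> \<subseteq> {..<n}"
      using taylor_mod_D(2)[OF v(1), of \<sigma>] m by force
    ultimately show ?thesis
      using m taylor_mod_D(1)[OF v(1), of \<sigma>] by (fastforce simp: lcm_ideal_def)
  qed (use I m in blast)
  have sum_part: "(\<Sum>j<n. part j (v \<sigma>)) = v \<sigma>" for \<sigma>
  proof (rule poly_mapping_eqI)
    fix m
    show "Poly_Mapping.lookup (\<Sum>j<n. part j (v \<sigma>)) m = Poly_Mapping.lookup (v \<sigma>) m"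
    proof (cases "m \<in> Poly_Mapping.keys (v \<sigma>)")
      case True
      then obtain j where j: "j < n" "A j \<subseteq> Poly_Mapping.keys m"
        using ex by blast
      then have "A (fst_gen m) \<subseteq> Poly_Mapping.keys m" "fst_gen m < n"
        unfolding fst_gen_def
        using LeastI[of "\<lambda>j. A j \<subseteq> Poly_Mapping.keys m" j] Least_le[of "\<lambda>j. A j \<subseteq> Poly_Mapping.keys m" j]
        by auto
      then have "Poly_Mapping.lookup (part j (v \<sigma>)) m
          = (if fst_gen m = j then Poly_Mapping.lookup (v \<sigma>) m else 0)" for j
        by (auto simp: part_def lookup_restrict_keys)
      with \<open>fst_gen m < n\<close> show ?thesis
        by (simp add: lookup_sum)
    qed (auto simp: lookup_sum part_def lookup_restrict_keys in_keys_iff intro!: sum.neutral)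
  qed
  define w where "w = (\<Sum>j<n. wedge j (coeffwise (part j) v))"
  have "wedge j (coeffwise (part j) v) \<in> taylor_mod (Suc i)" if "j < n" for j
  proof -
    have part_keys: "m \<in> Poly_Mapping.keys (part j p) \<Longrightarrow> m \<in> Poly_Mapping.keys p \<and> A j \<subseteq> Poly_Mapping.keys m" for m p
      by (auto simp: in_keys_iff part_def lookup_restrict_keys split: if_splits)
    then have "coeffwise (part j) v \<in> taylor_mod i"
      by (intro taylor_mod_coeffwise v coeffwise_signed(3)[of "part j"] part_add) (auto simp: lcm_ideal_def)
    moreover have "coeffwise (part j) v \<sigma> \<in> lcm_ideal (insert j \<sigma>)" for \<sigma>
      using taylor_mod_D(1)[OF v(1), of \<sigma>] part_keys by (auto simp: lcm_ideal_def coeffwise_def)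
    ultimately show ?thesis
      using taylor_mod_wedge[of "coeffwise (part j) v" i j 1] that by simp
  qed
  then have "w \<in> taylor_mod (Suc i)"
    unfolding w_def by (intro taylor_mod_sum) auto
  moreover have "bd n w = v"
  proof -
    have "bd n (coeffwise (part j) v) = 0" for j
      by (subst bd_coeffwise) (simp_all add: part_add v coeffwise_def fun_ops fun_eq_iff
          coeffwise_signed(3)[of "part j"])
    then have "bd n w = (\<Sum>j<n. coeffwise (part j) v)"
      by (simp add: w_def lin_sum[OF lin_bd] bd_wedge lin_zero[OF lin_wedge])
    also have "\<dots> = v"
      by (simp add: fun_eq_iff sum_fun_apply coeffwise_def sum_part)
    finally show ?thesis .
  qed
  ultimately show ?thesis by blast
qed

lemma op_prod_T:
  assumes Y: "\<And>j v i. j < n \<Longrightarrow> v \<in> taylor_mod i \<Longrightarrow> Y j v \<in> taylor_mod (Suc i)"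
    and "finite \<sigma>" "\<sigma> \<subseteq> {..<n}"
  shows "op_prod Y \<sigma> \<in> taylor_mod (card \<sigma>)"
  using assms(2,3)
proof (induction \<sigma> rule: finite_linorder_min_induct)
  case (insert j \<sigma>)
  then have "j \<notin> \<sigma>" by auto
  with insert show ?case
    by (simp add: op_prod_insert_min Y)
qed (simp add: taylor_mod_ext_one)

lemma htpy_T:
  assumes Y: "\<And>j v i. j < n \<Longrightarrow> v \<in> taylor_mod i \<Longrightarrow> Y j v \<in> taylor_mod (Suc i)"
    and Z: "\<And>j v i. j < n \<Longrightarrow> v \<in> taylor_mod i \<Longrightarrow> Z j v \<in> taylor_mod (Suc i)"
    and B: "\<And>j v i. j < n \<Longrightarrow> v \<in> taylor_mod i \<Longrightarrow> B j v \<in> taylor_mod (Suc (Suc i))"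
    and "finite \<sigma>" "\<sigma> \<subseteq> {..<n}"
  shows "htpy B Y Z \<sigma> \<in> taylor_mod (Suc (card \<sigma>))"
  using assms(4,5)
proof (induction \<sigma> rule: finite_linorder_min_induct)
  case (insert j \<sigma>)
  then have "j \<notin> \<sigma>" by auto
  with insert show ?case
    by (simp add: op_prod_insert_min taylor_mod_diff Y B op_prod_T[OF Z])
qed (simp add: taylor_mod_zero)

end

section \<open>Contracting the Taylor complex in high degrees\<close>

context taylor
begin

text \<open>The exponent of the product of the powers \<open>m\<^sub>j\<^bsup>a j\<^esup>\<close>, \<open>j \<in> \<sigma>\<close>.\<close>

definition prod_exp :: "(nat \<Rightarrow> nat) \<Rightarrow> nat set \<Rightarrow> (nat \<Rightarrow>\<^sub>0 nat)"
  where "prod_exp a \<sigma> = (\<Sum>j\<in>\<sigma>. flat_exp (a j) (A j))"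

text \<open>The \<open>frob N\<close>-semilinear map on the Taylor complex that sends \<open>p\<close> times the wedge of \<open>\<sigma>\<close>, for \<open>p\<close> in
  \<open>lcm_ideal \<sigma>\<close>, to the quotient of \<open>frob N p\<close> by the product of the \<open>m\<^sub>j\<^bsup>a j\<^esup>\<close>, \<open>j \<in> \<sigma>\<close>, times \<open>F \<sigma>\<close>.
  It is the composite of the power map, the
  comparison map from the Taylor complex of the \<open>m\<^sub>j\<^sup>N\<close> to the Koszul complex of the \<open>m\<^sub>j\<^bsup>a j\<^esup>\<close>, and the
  linear map on the latter with values \<open>F\<close>. The division is exact once \<open>N\<close> is at least the sum of the
  exponents \<open>a j\<close>.\<close>

definition semilin :: "nat \<Rightarrow> (nat \<Rightarrow> nat) \<Rightarrow> (nat set \<Rightarrow> 'k::field mpoly ext) \<Rightarrow> 'k mpoly ext \<Rightarrow> 'k mpoly ext"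
  where "semilin N a F v = (\<Sum>\<sigma>\<in>Pow {..<n}. mon_quot (prod_exp a \<sigma>) (frob N (v \<sigma>)) \<bullet> F \<sigma>)"

lemma frob_divisible:
  assumes "(\<Sum>j<n. a j) \<le> N" "\<sigma> \<subseteq> {..<n}" "p \<in> lcm_ideal \<sigma>"
  shows "frob N p = mon (prod_exp a \<sigma>) * mon_quot (prod_exp a \<sigma>) (frob N p)"
proof (rule mon_dvd)
  fix m assume "m \<in> Poly_Mapping.keys (frob N p)"
  then obtain m' where m: "m = stretch N m'" and "m' \<in> Poly_Mapping.keys p"
    unfolding frob_def using keys_exp_map by blast
  then have sub: "(\<Union>j\<in>\<sigma>. A j) \<subseteq> Poly_Mapping.keys m'"
    using assms(3) by (simp add: lcm_ideal_def)
  have "Poly_Mapping.lookup (prod_exp a \<sigma>) x \<le> Poly_Mapping.lookup m x" for x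
  proof (cases "x \<in> (\<Union>j\<in>\<sigma>. A j)")
    case True
    then have "1 \<le> Poly_Mapping.lookup m' x"
      using sub by (auto simp: in_keys_iff)
    have "Poly_Mapping.lookup (prod_exp a \<sigma>) x \<le> (\<Sum>j\<in>\<sigma>. a j)"
      unfolding prod_exp_def lookup_sum
      using assms(2) finite_A by (intro sum_mono) (auto simp: lookup_flat_exp)
    also have "\<dots> \<le> (\<Sum>j<n. a j)"
      using assms(2) by (intro sum_mono2) auto
    also have "\<dots> \<le> N * Poly_Mapping.lookup m' x"
      using assms(1) mult_le_mono[OF assms(1) \<open>1 \<le> Poly_Mapping.lookup m' x\<close>] by simp
    finally show ?thesis
      by (simp add: m)
  next
    case False
    then have "Poly_Mapping.lookup (prod_exp a \<sigma>) x = 0"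
      using assms(2) finite_A by (auto simp: prod_exp_def lookup_sum lookup_flat_exp intro!: sum.neutral)
    then show ?thesis
      by simp
  qed
  then show "\<exists>d. m = prod_exp a \<sigma> + d"
    using exponent_dvd by blast
qed

lemma frob_quot_scale:
  assumes "(\<Sum>j<n. a j) \<le> N" "\<sigma> \<subseteq> {..<n}" "p \<in> lcm_ideal \<sigma>"
  shows "mon_quot (prod_exp a \<sigma>) (frob N (s * p)) = frob N s * mon_quot (prod_exp a \<sigma>) (frob N p)"
proof -
  have "frob N (s * p) = mon (prod_exp a \<sigma>) * (frob N s * mon_quot (prod_exp a \<sigma>) (frob N p))"
    using frob_divisible[OF assms] by (simp add: frob_simps mult.left_commute)
  then show ?thesis
    by simp
qed

lemma frob_quot_remove:
  assumes "(\<Sum>j<n. a j) \<le> N" "\<sigma> \<subseteq> {..<n}" "p \<in> lcm_ideal \<sigma>" "j \<in> \<sigma>"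
  shows "mon_quot (prod_exp a (\<sigma> - {j})) (frob N p)
    = mon (flat_exp (a j) (A j)) * mon_quot (prod_exp a \<sigma>) (frob N p)"
proof -
  have "prod_exp a \<sigma> = prod_exp a (\<sigma> - {j}) + flat_exp (a j) (A j)"
    using assms(2,4) finite_subset[of \<sigma> "{..<n}"] by (simp add: prod_exp_def sum.remove add.commute)
  then have "frob N p = mon (prod_exp a (\<sigma> - {j})) * (mon (flat_exp (a j) (A j)) * mon_quot (prod_exp a \<sigma>) (frob N p))"
    using frob_divisible[OF assms(1-3)] by (simp add: mon_add mult.assoc)
  then show ?thesis
    by (metis mon_quot_mult)
qed

lemma semilin_add:
  "semilin N a F (v + w) = semilin N a F v + semilin N a F w"
  by (simp add: semilin_def fun_ops frob_simps mon_quot_add scl_add sum.distrib)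

lemma semilin_scale:
  assumes "(\<Sum>j<n. a j) \<le> N" "v \<in> taylor_mod i"
  shows "semilin N a F (s \<bullet> v) = frob N s \<bullet> semilin N a F v"
  using frob_quot_scale[OF assms(1) _ taylor_mod_D(1)[OF assms(2)]] by (simp add: semilin_def scl_sum fun_ops)

text \<open>The comparison from the Taylor to the Koszul complex is a chain map: deleting \<open>j\<close> from \<open>\<sigma>\<close> divides by
  one factor \<open>m\<^sub>j\<^bsup>a j\<^esup>\<close> less, which is the coefficient of the Koszul differential.\<close>

lemma semilin_bd:
  assumes "(\<Sum>j<n. a j) \<le> N" "v \<in> taylor_mod (Suc i)"
  shows "semilin N a F (bd n v) = semilin N a (koszul_bd (\<lambda>j. mon (flat_exp (a j) (A j))) F) v"
proof -
  let ?q = "\<lambda>\<sigma>. mon_quot (prod_exp a \<sigma>)" and ?c = "\<lambda>j. mon (flat_exp (a j) (A j))"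
  let ?f = "\<lambda>\<tau> j. (sgn_at j \<tau> * ?q \<tau> (frob N (v (insert j \<tau>)))) \<bullet> F \<tau>"
  have q: "?q \<tau> (frob N (p + p')) = ?q \<tau> (frob N p) + ?q \<tau> (frob N p')" for \<tau> p p'
    by (simp add: frob_simps mon_quot_add)
  have lhs: "?q \<tau> (frob N (bd n v \<tau>)) \<bullet> F \<tau> = (\<Sum>j\<in>{..<n} - \<tau>. ?f \<tau> j)" for \<tau>
  proof -
    have "bd n v \<tau> = (\<Sum>j\<in>{..<n} - \<tau>. sgn_at j \<tau> * v (insert j \<tau>))"
      by (simp add: bd_def sum_fun_apply contr_def sum.If_cases Diff_eq)
    then show ?thesis
      by (simp add: coeffwise_signed(1,2)[of "\<lambda>p. ?q \<tau> (frob N p)", OF q] scl_sum)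
  qed
  have R: "?q \<sigma> (frob N (v \<sigma>)) \<bullet> koszul_bd ?c F \<sigma> = (\<Sum>j\<in>\<sigma>. ?f (\<sigma> - {j}) j)" if "\<sigma> \<subseteq> {..<n}" for \<sigma>
  proof -
    have "(?q \<sigma> (frob N (v \<sigma>)) * (sgn_at j \<sigma> * ?c j)) \<bullet> F (\<sigma> - {j}) = ?f (\<sigma> - {j}) j" if "j \<in> \<sigma>" for j
    proof -
      have "insert j (\<sigma> - {j}) = \<sigma>" "sgn_at j (\<sigma> - {j}) = (sgn_at j \<sigma> :: 'a mpoly)"
        using that by (auto simp: sgn_at_remove)
      then show ?thesis
        using frob_quot_remove[OF assms(1) \<open>\<sigma> \<subseteq> {..<n}\<close> taylor_mod_D(1)[OF assms(2)] that] by (simp add: ac_simps)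
    qed
    then show ?thesis
      by (simp add: koszul_bd_def scl_sum)
  qed
  have "semilin N a F (bd n v) = (\<Sum>\<tau>\<in>Pow {..<n}. \<Sum>j\<in>{..<n} - \<tau>. ?f \<tau> j)"
    unfolding semilin_def lhs ..
  also have "\<dots> = (\<Sum>(\<tau>, j)\<in>Sigma (Pow {..<n}) (\<lambda>\<tau>. {..<n} - \<tau>). ?f \<tau> j)"
    by (rule sum.Sigma) auto
  also have "\<dots> = (\<Sum>(\<sigma>, j)\<in>Sigma (Pow {..<n}) (\<lambda>\<sigma>. \<sigma>). ?f (\<sigma> - {j}) j)"
    by (rule sum.reindex_bij_witness[of _ "\<lambda>(\<sigma>, j). (\<sigma> - {j}, j)" "\<lambda>(\<tau>, j). (insert j \<tau>, j)"]) auto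
  also have "\<dots> = (\<Sum>\<sigma>\<in>Pow {..<n}. \<Sum>j\<in>\<sigma>. ?f (\<sigma> - {j}) j)"
    by (rule sum.Sigma[symmetric]) (auto intro: finite_subset)
  also have "\<dots> = semilin N a (koszul_bd ?c F) v"
    unfolding semilin_def by (intro sum.cong refl R[symmetric]) simp
  finally show ?thesis .
qed

lemma op_prod_mon:
  assumes "finite \<sigma>"
  shows "op_prod (\<lambda>j v. mon (flat_exp (a j) (A j)) \<bullet> wedge j v) \<sigma> = mon (prod_exp a \<sigma>) \<bullet> ext_basis \<sigma>"
  using assms
proof (induction \<sigma> rule: finite_linorder_min_induct)
  case empty
  show ?case
    by (simp add: prod_exp_def)
next
  case (insert j \<sigma>)
  then have "j \<notin> \<sigma>" by auto
  with insert show ?case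
    by (simp add: op_prod_insert_min lin_scl[OF lin_wedge] wedge_basis_min prod_exp_def mon_add)
qed

text \<open>The products of the trivial null-homotopies \<open>m\<^sub>j\<^bsup>a j\<^esup>\<close> times the wedge with \<open>j\<close> cancel the denominators
  exactly, leaving the power map itself.\<close>

lemma semilin_mon:
  assumes "(\<Sum>j<n. a j) \<le> N" "v \<in> taylor_mod i"
  shows "semilin N a (op_prod (\<lambda>j v. mon (flat_exp (a j) (A j)) \<bullet> wedge j v)) v = coeffwise (frob N) v"
proof
  fix \<tau>
  have "semilin N a (op_prod (\<lambda>j v. mon (flat_exp (a j) (A j)) \<bullet> wedge j v)) v
      = (\<Sum>\<sigma>\<in>Pow {..<n}. frob N (v \<sigma>) \<bullet> ext_basis \<sigma>)"
    unfolding semilin_def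
  proof (intro sum.cong refl)
    fix \<sigma> assume "\<sigma> \<in> Pow {..<n}"
    then show "mon_quot (prod_exp a \<sigma>) (frob N (v \<sigma>)) \<bullet> op_prod (\<lambda>j v. mon (flat_exp (a j) (A j)) \<bullet> wedge j v) \<sigma>
        = frob N (v \<sigma>) \<bullet> ext_basis \<sigma>"
      using frob_divisible[OF assms(1) _ taylor_mod_D(1)[OF assms(2)], of \<sigma>] finite_subset[of \<sigma> "{..<n}"]
      by (simp add: op_prod_mon mult.commute)
  qed
  then have "semilin N a (op_prod (\<lambda>j v. mon (flat_exp (a j) (A j)) \<bullet> wedge j v)) v \<tau>
      = (\<Sum>\<sigma>\<in>Pow {..<n}. if \<tau> = \<sigma> then frob N (v \<sigma>) else 0)"
    by (simp add: sum_fun_apply fun_ops ext_basis_def if_distrib cong: if_cong)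
  also have "\<dots> = (if \<tau> \<subseteq> {..<n} then frob N (v \<tau>) else 0)"
    by (subst sum.delta') auto
  also have "\<dots> = coeffwise (frob N) v \<tau>"
    using taylor_mod_D(2)[OF assms(2), of \<tau>] by (cases "v \<tau> = 0") (auto simp: coeffwise_def frob_simps)
  finally show "semilin N a (op_prod (\<lambda>j v. mon (flat_exp (a j) (A j)) \<bullet> wedge j v)) v \<tau> = coeffwise (frob N) v \<tau>" .
qed

lemma semilin_T:
  assumes "0 < N" "v \<in> taylor_mod i" and F: "\<And>\<sigma>. \<sigma> \<subseteq> {..<n} \<Longrightarrow> F \<sigma> \<in> taylor_mod (Suc (card \<sigma>))"
  shows "semilin N a F v \<in> taylor_mod (Suc i)"
  unfolding semilin_def
proof (rule taylor_mod_sum)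
  fix \<sigma> assume "\<sigma> \<in> Pow {..<n}"
  show "mon_quot (prod_exp a \<sigma>) (frob N (v \<sigma>)) \<bullet> F \<sigma> \<in> taylor_mod (Suc i)"
  proof (cases "v \<sigma> = 0")
    case True
    then show ?thesis
      by (simp add: frob_simps taylor_mod_zero)
  next
    case False
    then have "card \<sigma> = i"
      using taylor_mod_D(2)[OF assms(2)] by blast
    then show ?thesis
      using F[of \<sigma>] \<open>\<sigma> \<in> Pow {..<n}\<close> lcm_ideal_mon_quot[OF lcm_ideal_frob[OF assms(1) taylor_mod_D(1)[OF assms(2)]]]
      by (auto intro: taylor_mod_scale)
  qed
qed

text \<open>Write \<open>f\<^sub>k = \<Sum>\<^sub>i g\<^sub>k\<^sub>i m\<^sub>i\<close>, so that \<open>m\<^sub>j\<^bsup>a j\<^esup> = \<Sum>\<^sub>k c\<^sub>j\<^sub>k f\<^sub>k\<close>. There are two null-homotopies for \<open>m\<^sub>j\<^bsup>a j + 1\<^esup>\<close> on the Taylor complex: \<open>Y j\<close>, a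
  combination of the \<open>r\<close> anticommuting null-homotopies \<open>E k\<close> for the \<open>f\<^sub>k\<close>, and the trivial one \<open>Z j\<close>. Their
  products extend to homotopic semilinear chain maps. The second one is the power map, the first one
  vanishes above degree \<open>r\<close>, and \<open>frob_split\<close> turns the homotopy between them into the linear map \<open>s\<close>.
  By the last property \<open>bd n \<circ> s\<close> retracts \<open>taylor_mod r\<close> onto the boundaries.\<close>

theorem syzygy_retraction:
  fixes c :: "nat \<Rightarrow> nat \<Rightarrow> 'k::field mpoly" and g :: "nat \<Rightarrow> nat \<Rightarrow> 'k mpoly"
  assumes comb: "\<And>j. j < n \<Longrightarrow> mon (flat_exp (a j) (A j))
      = (\<Sum>k<r. c j k * (\<Sum>i<n. g k i * mon (flat_exp 1 (A i))))"
    and c: "\<And>j k. j < n \<Longrightarrow> k < r \<Longrightarrow> c j k \<in> lcm_ideal {}"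
    and g: "\<And>k i. k < r \<Longrightarrow> i < n \<Longrightarrow> g k i \<in> lcm_ideal {}"
  obtains s :: "'k mpoly ext \<Rightarrow> 'k mpoly ext" where
    "\<And>v. v \<in> taylor_mod r \<Longrightarrow> s v \<in> taylor_mod (Suc r)"
    "\<And>v w. v \<in> taylor_mod r \<Longrightarrow> w \<in> taylor_mod r \<Longrightarrow> s (v + w) = s v + s w"
    "\<And>p v. v \<in> taylor_mod r \<Longrightarrow> s (p \<bullet> v) = p \<bullet> s v"
    "\<And>y. y \<in> taylor_mod (Suc r) \<Longrightarrow> bd n (s (bd n y)) = bd n y"
proof -
  \<comment> \<open>The additional factor \<open>m\<^sub>j\<close> makes \<open>wedge j (Y j v)\<close> divisible by the lcm that the degree
    of the wedge demands, so that the homotopy \<open>B j\<close> stays inside the Taylor complex.\<close>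
  define b where "b j = Suc (a j)" for j
  define N where "N = Suc (\<Sum>j<n. b j)"
  have N: "0 < N" "(\<Sum>j<n. b j) \<le> N"
    by (auto simp: N_def)
  define M :: "nat \<Rightarrow> 'k mpoly" where "M j = mon (flat_exp 1 (A j))" for j
  define E where "E k = wedge_comb n (\<lambda>i. g k i * M i)" for k
  define S where "S j v = (\<Sum>k<r. c j k \<bullet> E k v)" for j v
  define Y where "Y j v = M j \<bullet> S j v" for j v
  define Z :: "nat \<Rightarrow> 'k mpoly ext \<Rightarrow> 'k mpoly ext"
    where "Z = (\<lambda>j v. mon (flat_exp (b j) (A j)) \<bullet> wedge j v)"
  define B where "B j v = wedge j (Y j v)" for j v
  have lin_S: "lin (S j)" and lin_Y: "lin (Y j)" and lin_Z: "lin (Z j)" and lin_B: "lin (B j)" for j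
  proof -
    show S: "lin (S j)"
      unfolding S_def E_def by (intro lin_sums lin_scaled lin_wedge_comb)
    show Y: "lin (Y j)"
      unfolding Y_def by (rule lin_scaled[OF S])
    show "lin (Z j)"
      unfolding Z_def by (intro lin_scaled lin_wedge)
    show "lin (B j)"
      unfolding B_def by (intro lin_comp[OF lin_wedge Y])
  qed
  let ?c = "\<lambda>j. mon (flat_exp (b j) (A j)) :: 'k mpoly"
  have bd_Y: "bd n (Y j v) = ?c j \<bullet> v - Y j (bd n v)" if "j < n" for j v
  proof -
    have "bd n (E k v) = (\<Sum>i<n. g k i * M i) \<bullet> v - E k (bd n v)" for k
      by (simp add: E_def bd_wedge_comb)
    then have "bd n (S j v) = (\<Sum>k<r. (c j k * (\<Sum>i<n. g k i * M i)) \<bullet> v) - S j (bd n v)"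
      by (simp add: S_def lin_sum[OF lin_bd] lin_scl[OF lin_bd] scl_add sum_subtractf)
    then have "bd n (S j v) = (\<Sum>k<r. c j k * (\<Sum>i<n. g k i * M i)) \<bullet> v - S j (bd n v)"
      unfolding scl_sum(2) .
    then have "bd n (S j v) = mon (flat_exp (a j) (A j)) \<bullet> v - S j (bd n v)"
      using comb[OF that] by (simp add: M_def)
    moreover have "M j * mon (flat_exp (a j) (A j)) = ?c j"
      using flat_exp_add[of 1 "a j" "A j"] by (simp add: b_def M_def flip: mon_add)
    ultimately show ?thesis
      by (simp add: Y_def lin_scl[OF lin_bd] scl_add)
  qed
  have bd_Z: "bd n (Z j v) = ?c j \<bullet> v - Z j (bd n v)" if "j < n" for j v
    using that by (simp add: Z_def lin_scl[OF lin_bd] bd_wedge scl_add)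
  have bd_B: "bd n (B j v) = B j (bd n v) + Y j v - Z j v" if "j < n" for j v
    using that
    by (simp add: B_def Z_def bd_wedge bd_Y lin_diff[OF lin_wedge] lin_scl[OF lin_wedge])
  define H where "H = htpy B Y Z"
  have M: "M j \<in> lcm_ideal {j}" if "j < n" for j
    unfolding M_def using lcm_ideal_mon[OF that, of 1] by simp
  have S_T: "S j v \<in> taylor_mod (Suc i)" if "j < n" "v \<in> taylor_mod i" for j v i
    unfolding S_def E_def wedge_comb_def
    using that by (intro taylor_mod_sum taylor_mod_scale c taylor_mod_wedge_scale lcm_ideal_scale g M) auto
  have Y_T: "Y j v \<in> taylor_mod (Suc i)" if "j < n" "v \<in> taylor_mod i" for j v i
    unfolding Y_def using M[OF that(1)] lcm_ideal_antimono[of "{}" "{j}"] by (intro taylor_mod_scale S_T that) auto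
  have Z_T: "Z j v \<in> taylor_mod (Suc i)" if "j < n" "v \<in> taylor_mod i" for j v i
    unfolding Z_def using that by (intro taylor_mod_wedge_scale lcm_ideal_mon) (auto simp: b_def)
  have B_T: "B j v \<in> taylor_mod (Suc (Suc i))" if "j < n" "v \<in> taylor_mod i" for j v i
    unfolding B_def Y_def lin_scl[OF lin_wedge] by (intro taylor_mod_wedge_scale S_T M that)
  have H_T: "H \<sigma> \<in> taylor_mod (Suc (card \<sigma>))" if "\<sigma> \<subseteq> {..<n}" for \<sigma>
    unfolding H_def using that finite_subset[OF that] by (intro htpy_T Y_T Z_T B_T) auto
  have bd_H: "bd n (H \<sigma>) = op_prod Y \<sigma> - op_prod Z \<sigma> - koszul_bd ?c H \<sigma>" if "\<sigma> \<subseteq> {..<n}" for \<sigma>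
    unfolding H_def using that finite_subset[OF that]
    by (intro bd_htpy lin_Y lin_Z lin_B bd_Y bd_Z bd_B) auto
  have bd_semilin: "bd n (semilin N b F v) = semilin N b (\<lambda>\<sigma>. bd n (F \<sigma>)) v" for F v
    by (simp add: semilin_def lin_sum[OF lin_bd] lin_scl[OF lin_bd])
  have semilin_cong: "semilin N b F v = semilin N b G v" if "\<And>\<sigma>. \<sigma> \<subseteq> {..<n} \<Longrightarrow> F \<sigma> = G \<sigma>" for F G v
    unfolding semilin_def by (intro sum.cong refl) (simp add: that)
  have semilin_diff: "semilin N b (\<lambda>\<sigma>. F \<sigma> - G \<sigma>) v = semilin N b F v - semilin N b G v" for F G v
    by (simp add: semilin_def scl_add sum_subtractf)
  have chain: "bd n (semilin N b H (bd n y)) = - coeffwise (frob N) (bd n y)" if y: "y \<in> taylor_mod (Suc r)" for y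
  proof -
    have "bd n (semilin N b H (bd n y))
        = semilin N b (\<lambda>\<sigma>. op_prod Y \<sigma> - op_prod Z \<sigma> - koszul_bd ?c H \<sigma>) (bd n y)"
      unfolding bd_semilin by (rule semilin_cong) (rule bd_H)
    also have "\<dots> = semilin N b (op_prod Y) (bd n y) - semilin N b (op_prod Z) (bd n y)
        - semilin N b (koszul_bd ?c H) (bd n y)"
      by (simp add: semilin_diff)
    also have "semilin N b (op_prod Z) (bd n y) = coeffwise (frob N) (bd n y)"
      unfolding Z_def by (rule semilin_mon[OF N(2) taylor_mod_bd[OF y]])
    also have "semilin N b (koszul_bd ?c H) (bd n y) = 0"
    \<comment> \<open>For positive \<open>r\<close> this is \<open>bd \<circ> bd = 0\<close>. For \<open>r = 0\<close> only \<open>\<sigma> = {}\<close> contributes, where the Koszul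
        differential is an empty sum.\<close>
    proof (cases r)
      case 0
      have y0: "bd n y \<sigma> = 0 \<or> \<sigma> = {}" for \<sigma>
        using taylor_mod_D(2)[OF taylor_mod_bd[OF y], of \<sigma>] finite_subset[of \<sigma> "{..<n}"] by (auto simp: 0)
      have "koszul_bd ?c H {} = 0"
        by (simp add: koszul_bd_def)
      then have "mon_quot (prod_exp b \<sigma>) (frob N (bd n y \<sigma>)) \<bullet> koszul_bd ?c H \<sigma> = 0" for \<sigma>
        using y0[of \<sigma>] by (elim disjE) (simp_all add: frob_simps)
      then show ?thesis
        unfolding semilin_def by (intro sum.neutral ballI)
    next
      case (Suc r')
      have "semilin N b (koszul_bd ?c H) (bd n y) = semilin N b H (bd n (bd n y))"
        using semilin_bd[OF N(2), of "bd n y" r'] taylor_mod_bd[OF y] Suc by simp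
      then show ?thesis
        by (simp add: bd_bd semilin_def fun_ops frob_simps)
    qed
    also have "semilin N b (op_prod Y) (bd n y) = 0"
    proof -
      have "semilin N b (op_prod Y) (bd n y) = bd n (semilin N b (op_prod Y) y)"
        unfolding bd_semilin semilin_bd[OF N(2) y]
        by (rule semilin_cong[symmetric])
          (auto intro!: bd_op_prod lin_Y bd_Y intro: finite_subset)
      also have "semilin N b (op_prod Y) y = 0"
        unfolding semilin_def
      proof (intro sum.neutral ballI)
        fix \<sigma> assume "\<sigma> \<in> Pow {..<n}"
        show "mon_quot (prod_exp b \<sigma>) (frob N (y \<sigma>)) \<bullet> op_prod Y \<sigma> = 0"
        proof (cases "y \<sigma> = 0")
          case True
          then show ?thesis
            by (simp add: frob_simps)
        next
          case False
          then have "finite \<sigma>" "r < card \<sigma>"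
            using taylor_mod_D(2)[OF y, of \<sigma>] finite_subset[of \<sigma> "{..<n}"] by auto
          have Y: "op_prod Y \<sigma> = 0"
          proof (rule op_prod_pigeonhole[of E Y "\<lambda>j k. M j * c j k" r \<sigma>])
            show "E k (E l v) = - E l (E k v)" for k l v
              unfolding E_def by (rule wedge_comb_anticomm)
            show "Y j v = (\<Sum>k<r. (M j * c j k) \<bullet> E k v)" for j v
              by (simp add: Y_def S_def scl_sum)
          qed (simp_all add: E_def lin_wedge_comb wedge_comb_square \<open>finite \<sigma>\<close> \<open>r < card \<sigma>\<close>)
          then show ?thesis
            by (simp only: Y scl_simps)
        qed
      qed
      finally show ?thesis
        by (simp add: lin_zero[OF lin_bd])
    qed
    finally show ?thesis
      by simp
  qed
  define s where "s v = - coeffwise (frob_split N) (semilin N b H v)" for v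
  show thesis
  proof (rule that[of s])
    show "s v \<in> taylor_mod (Suc r)" if "v \<in> taylor_mod r" for v
      unfolding s_def
      by (intro taylor_mod_uminus taylor_mod_coeffwise[where t = "frob_split N"] semilin_T N(1) that H_T lcm_ideal_frob_split
          frob_split_zero)
    show "s (v + w) = s v + s w" for v w
      by (simp add: s_def semilin_add fun_eq_iff coeffwise_def fun_ops frob_split_add N)
    show "s (p \<bullet> v) = p \<bullet> s v" if "v \<in> taylor_mod r" for p v
      by (simp add: s_def semilin_scale[OF N(2) that] fun_eq_iff coeffwise_def fun_ops
          frob_split_mult[OF N(1)])
    show "bd n (s (bd n y)) = bd n y" if "y \<in> taylor_mod (Suc r)" for y
    proof -
      have "bd n (s (bd n y)) = - coeffwise (frob_split N) (bd n (semilin N b H (bd n y)))"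
        using bd_coeffwise[of "frob_split N" n, OF frob_split_add[OF N(1)]]
        by (simp add: s_def lin_minus[OF lin_bd])
      also have "\<dots> = bd n y"
        unfolding chain[OF that]
        by (simp add: coeffwise_signed(4)[of "frob_split N", OF frob_split_add[OF N(1)]] fun_eq_iff coeffwise_def fun_ops frob_split_frob[OF N(1)])
      finally show ?thesis .
    qed
  qed
qed

end

section \<open>Ideals and modules over polynomial rings\<close>

lemma poly_ring_simps [simp]:
  "carrier (poly_ring X) = {p. vars p \<subseteq> X}" "zero (poly_ring X) = 0" "one (poly_ring X) = 1"
  "add (poly_ring X) = (+)" "mult (poly_ring X) = (*)"
  by (simp_all add: poly_ring_def)

lemma poly_idealI:
  assumes "J \<subseteq> {p. vars p \<subseteq> X}" "0 \<in> J"
    and add: "\<And>p q. p \<in> J \<Longrightarrow> q \<in> J \<Longrightarrow> p + q \<in> J"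
    and mult: "\<And>r p. vars r \<subseteq> X \<Longrightarrow> p \<in> J \<Longrightarrow> r * p \<in> J"
  shows "ideal (J :: 'k::field mpoly set) (poly_ring X)"
proof -
  interpret R: cring "poly_ring X :: 'k mpoly ring" by (rule poly_ring_cring)
  show ?thesis
  proof (rule idealI[OF R.ring_axioms])
    show "subgroup J (add_monoid (poly_ring X))"
    proof (rule R.add.subgroupI)
      fix p assume p: "p \<in> J"
      have "-1 * p \<in> J"
        by (rule mult[OF _ p]) (simp add: vars_uminus vars_one)
      then have m: "- p \<in> J"
        by simp
      have "\<ominus>\<^bsub>poly_ring X\<^esub> p = - p"
        using p m assms(1) by (intro R.minus_equality) auto
      with m show "\<ominus>\<^bsub>poly_ring X\<^esub> p \<in> J"
        by simp
    next
      show "J \<noteq> {}"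
        using assms(2) by blast
      show "J \<subseteq> carrier (poly_ring X)"
        using assms(1) by simp
    qed (simp add: add)
  next
    fix p q :: "'k mpoly" assume "p \<in> J" "q \<in> carrier (poly_ring X)"
    then show "q \<otimes>\<^bsub>poly_ring X\<^esub> p \<in> J"
      using mult[of q p] by simp
    then show "p \<otimes>\<^bsub>poly_ring X\<^esub> q \<in> J"
      by (simp add: mult.commute)
  qed
qed

definition fun_module :: "('z \<Rightarrow> 'k::field mpoly) set \<Rightarrow> ('k mpoly, 'z \<Rightarrow> 'k mpoly) module"
  where "fun_module Q = \<lparr>carrier = Q, mult = undefined, one = undefined, zero = (\<lambda>_. 0),
    add = (\<lambda>f g z. f z + g z), smult = (\<lambda>p f z. p * f z)\<rparr>"

lemma fun_module_simps [simp]: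
  "carrier (fun_module Q) = Q" "zero (fun_module Q) = (\<lambda>_. 0)"
  "add (fun_module Q) = (\<lambda>f g z. f z + g z)" "smult (fun_module Q) = (\<lambda>p f z. p * f z)"
  by (simp_all add: fun_module_def)

lemma fun_module_module:
  assumes "(\<lambda>_. 0) \<in> Q" and "\<And>f g. f \<in> Q \<Longrightarrow> g \<in> Q \<Longrightarrow> (\<lambda>z. f z + g z) \<in> Q"
    and sm: "\<And>p f. vars p \<subseteq> X \<Longrightarrow> f \<in> Q \<Longrightarrow> (\<lambda>z. p * f z) \<in> Q"
  shows "module (poly_ring X) (fun_module Q)"
proof (rule moduleI[OF poly_ring_cring])
  show "abelian_group (fun_module Q)"
  proof (rule abelian_groupI)
    fix f assume "f \<in> carrier (fun_module Q)"
    then have "(\<lambda>z. - 1 * f z) \<in> Q"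
      by (intro sm) (simp_all add: vars_uminus vars_one)
    then show "\<exists>g\<in>carrier (fun_module Q). g \<oplus>\<^bsub>fun_module Q\<^esub> f = \<zero>\<^bsub>fun_module Q\<^esub>"
      by (intro bexI[of _ "\<lambda>z. - 1 * f z"]) auto
  qed (use assms in \<open>auto simp: algebra_simps\<close>)
qed (use assms in \<open>auto simp: algebra_simps\<close>)

text \<open>The resolving modules in \<open>proj_dim\<close> consist of functions on a sum type with \<open>nat\<close>. Finite sets of indices are
  encoded there as natural numbers.\<close>

definition emb :: "'k::field mpoly ext \<Rightarrow> ('b + nat \<Rightarrow> 'k mpoly)"
  where "emb v = (\<lambda>z. case z of Inl _ \<Rightarrow> 0 | Inr k \<Rightarrow> v (set_decode k))"

definition prj :: "('b + nat \<Rightarrow> 'k::field mpoly) \<Rightarrow> 'k mpoly ext"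
  where "prj x = (\<lambda>\<sigma>. if finite \<sigma> then x (Inr (set_encode \<sigma>)) else 0)"

lemma emb_ops: "emb (v + w) = (\<lambda>z. emb v z + emb w z)" "emb (p \<bullet> v) = (\<lambda>z. p * emb v z)"
  "emb 0 = (\<lambda>_. 0)"
  by (auto simp: emb_def fun_eq_iff fun_ops split: sum.splits)

lemma prj_emb: "(\<And>\<sigma>. v \<sigma> \<noteq> 0 \<Longrightarrow> finite \<sigma>) \<Longrightarrow> prj (emb v) = v"
  by (auto simp: prj_def emb_def fun_eq_iff)

lemma prj_ops: "prj (\<lambda>z. x z + y z) = prj x + prj y" "prj (\<lambda>z. p * x z) = p \<bullet> prj x"
  by (auto simp: prj_def fun_eq_iff fun_ops)

section \<open>The truncated Taylor resolution\<close>

context taylor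
begin

abbreviation R :: "'k::field mpoly ring"
  where "R \<equiv> poly_ring X"

definition submod :: "nat \<Rightarrow> 'k::field mpoly ext set \<Rightarrow> bool"
  where "submod i Q \<longleftrightarrow> Q \<subseteq> taylor_mod i \<and> 0 \<in> Q \<and> (\<forall>v\<in>Q. \<forall>w\<in>Q. v + w \<in> Q) \<and> (\<forall>p\<in>lcm_ideal {}. \<forall>v\<in>Q. p \<bullet> v \<in> Q)"

definition lin_on :: "'k::field mpoly ext set \<Rightarrow> ('k mpoly ext \<Rightarrow> 'k mpoly ext) \<Rightarrow> bool"
  where "lin_on Q f \<longleftrightarrow> (\<forall>v\<in>Q. \<forall>w\<in>Q. f (v + w) = f v + f w) \<and> (\<forall>p\<in>lcm_ideal {}. \<forall>v\<in>Q. f (p \<bullet> v) = p \<bullet> f v)"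

lemma prj_emb_T: "v \<in> taylor_mod i \<Longrightarrow> prj (emb v) = v"
  by (rule prj_emb) (auto dest: taylor_mod_D(2) intro: finite_subset)

lemma submod_module:
  assumes "submod i Q"
  shows "module R (fun_module (emb ` Q :: ('b + nat \<Rightarrow> 'k::field mpoly) set))"
proof (rule fun_module_module)
  have "emb 0 \<in> (emb ` Q :: ('b + nat \<Rightarrow> 'k mpoly) set)"
    using assms unfolding submod_def by blast
  then show "(\<lambda>_. 0) \<in> (emb ` Q :: ('b + nat \<Rightarrow> 'k mpoly) set)"
    unfolding emb_ops .
  fix f :: "'b + nat \<Rightarrow> 'k mpoly" assume "f \<in> emb ` Q"
  then obtain v where v: "v \<in> Q" "f = emb v"
    by blast
  show "(\<lambda>z. f z + g z) \<in> emb ` Q" if "g \<in> emb ` Q" for g :: "'b + nat \<Rightarrow> 'k mpoly"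
  proof -
    obtain w where w: "w \<in> Q" "g = emb w"
      using \<open>g \<in> emb ` Q\<close> by blast
    have "emb (v + w) \<in> emb ` Q"
      using assms v w unfolding submod_def by blast
    then show ?thesis
      unfolding emb_ops v w .
  qed
  show "(\<lambda>z. p * f z) \<in> emb ` Q" if "vars p \<subseteq> X" for p
  proof -
    have "emb (p \<bullet> v) \<in> emb ` Q"
      using assms v that unfolding submod_def lcm_ideal_empty by blast
    then show ?thesis
      unfolding emb_ops v .
  qed
qed

lemma mod_hom_transport:
  assumes Q: "submod i Q" and "lin_on Q f" and "\<And>v. v \<in> Q \<Longrightarrow> f v \<in> Q'"
  shows "(\<lambda>x. emb (f (prj x))) \<in> mod_hom R (fun_module (emb ` Q)) (fun_module (emb ` Q'))"
proof -
  have prj: "prj (emb v) = v" if "v \<in> Q" for v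
    using Q that prj_emb_T unfolding submod_def by blast
  show ?thesis
    using assms unfolding mod_hom_def
    by (auto simp: prj prj_ops lin_on_def submod_def lcm_ideal_empty emb_ops)
qed

text \<open>The degree \<open>i\<close> part of the Taylor complex is free, since each \<open>lcm_ideal \<sigma>\<close> is principal. The basis is
  labelled by the indicator functions of the codes of the sets \<open>\<sigma>\<close>, because free modules are to
  be indexed by elements of the type of the module itself.\<close>

lemma projective_retract:
  assumes Q: "submod i Q" and \<rho>: "lin_on (taylor_mod i) \<rho>" "\<And>v. v \<in> taylor_mod i \<Longrightarrow> \<rho> v \<in> Q" "\<And>v. v \<in> Q \<Longrightarrow> \<rho> v = v"
  shows "projective_module R (fun_module (emb ` Q :: ('b + nat \<Rightarrow> 'k::field mpoly) set))"
proof -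
  define F where "F = {\<sigma>. \<sigma> \<subseteq> {..<n} \<and> card \<sigma> = i}"
  define \<beta> :: "nat set \<Rightarrow> 'b + nat \<Rightarrow> 'k mpoly"
    where "\<beta> \<sigma> = (\<lambda>z. if z = Inr (set_encode \<sigma>) then 1 else 0)" for \<sigma>
  define u where "u \<sigma> = flat_exp 1 (\<Union>j\<in>\<sigma>. A j)" for \<sigma>
  have finF: "finite \<sigma>" if "\<sigma> \<in> F" for \<sigma>
    using that by (auto simp: F_def intro: finite_subset)
  have inj: "inj_on \<beta> F"
  proof (rule inj_onI)
    fix \<sigma> \<tau> assume *: "\<sigma> \<in> F" "\<tau> \<in> F" "\<beta> \<sigma> = \<beta> \<tau>"
    then have "\<beta> \<tau> (Inr (set_encode \<sigma>)) = 1"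
      by (metis \<beta>_def)
    then have "set_encode \<sigma> = set_encode \<tau>"
      by (auto simp: \<beta>_def split: if_splits)
    with * show "\<sigma> = \<tau>"
      using finF set_encode_eq by blast
  qed
  define \<gamma> where "\<gamma> = the_inv_into F \<beta>"
  have \<gamma>: "\<gamma> (\<beta> \<sigma>) = \<sigma>" if "\<sigma> \<in> F" for \<sigma>
    unfolding \<gamma>_def by (rule the_inv_into_f_f[OF inj that])
  have finU: "finite (\<Union>j\<in>\<sigma>. A j)" if "\<sigma> \<in> F" for \<sigma>
    using that finF[OF that] finite_A by (auto simp: F_def)
  have keys_u: "Poly_Mapping.keys (u \<sigma>) = (\<Union>j\<in>\<sigma>. A j)" if "\<sigma> \<in> F" for \<sigma>
    unfolding u_def by (simp add: keys_flat_exp[OF finU[OF that]])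
  have div: "q = mon (u \<sigma>) * mon_quot (u \<sigma>) q" if "\<sigma> \<in> F" "q \<in> lcm_ideal \<sigma>" for q \<sigma>
  proof (rule mon_dvd)
    fix m assume "m \<in> Poly_Mapping.keys q"
    then have "(\<Union>j\<in>\<sigma>. A j) \<subseteq> Poly_Mapping.keys m"
      using that(2) by (simp add: lcm_ideal_def)
    then have "Poly_Mapping.lookup (u \<sigma>) x \<le> Poly_Mapping.lookup m x" for x
      unfolding u_def by (subst lookup_flat_exp[OF finU[OF that(1)]]) (auto simp: in_keys_iff Suc_le_eq)
    then show "\<exists>d. m = u \<sigma> + d"
      using exponent_dvd by blast
  qed
  have quot_scale: "mon_quot (u \<sigma>) (p * q) = p * mon_quot (u \<sigma>) q" if "\<sigma> \<in> F" "q \<in> lcm_ideal \<sigma>" for p q \<sigma>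
  proof -
    have "p * (mon (u \<sigma>) * mon_quot (u \<sigma>) q) = mon (u \<sigma>) * (p * mon_quot (u \<sigma>) q)"
      by (rule mult.left_commute)
    then have eq: "p * q = mon (u \<sigma>) * (p * mon_quot (u \<sigma>) q)"
      by (simp only: div[OF that, symmetric])
    show ?thesis
      by (simp only: eq mon_quot_mult)
  qed
  define s :: "('b + nat \<Rightarrow> 'k mpoly) \<Rightarrow> ('b + nat \<Rightarrow> 'k mpoly) \<Rightarrow> 'k mpoly"
    where "s x = (\<lambda>b. if b \<in> \<beta> ` F then mon_quot (u (\<gamma> b)) (prj x (\<gamma> b)) else 0)" for x
  define w :: "(('b + nat \<Rightarrow> 'k mpoly) \<Rightarrow> 'k mpoly) \<Rightarrow> 'k mpoly ext"
    where "w f = (\<lambda>\<sigma>. if \<sigma> \<in> F then mon (u \<sigma>) * f (\<beta> \<sigma>) else 0)" for f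
  have QT: "Q \<subseteq> taylor_mod i"
    using Q by (simp add: submod_def)
  have prjQ: "prj x \<in> Q" "emb (prj x) = x" if x: "x \<in> emb ` Q" for x :: "'b + nat \<Rightarrow> 'k mpoly"
  proof -
    obtain v where v: "v \<in> Q" "x = emb v"
      using x by blast
    then have "prj x = v"
      using QT prj_emb_T by blast
    with v show "prj x \<in> Q" "emb (prj x) = x" by simp_all
  qed
  have prjL: "prj x \<sigma> \<in> lcm_ideal \<sigma>" if x: "x \<in> emb ` Q" for x :: "'b + nat \<Rightarrow> 'k mpoly" and \<sigma>
    using prjQ(1)[OF x] QT taylor_mod_D(1) by blast
  have finF': "finite F"
    by (rule finite_subset[of _ "Pow {..<n}"]) (auto simp: F_def)
  have s: "s \<in> mod_hom R (fun_module (emb ` Q)) (free_module R (\<beta> ` F))"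
    unfolding mod_hom_def
  proof (intro CollectI conjI ballI)
    show "s \<in> carrier (fun_module (emb ` Q)) \<rightarrow> carrier (free_module R (\<beta> ` F))"
    proof
      fix x :: "'b + nat \<Rightarrow> 'k mpoly" assume "x \<in> carrier (fun_module (emb ` Q))"
      then have "s x b \<in> lcm_ideal {}" for b
        using prjL by (auto simp: s_def lcm_ideal_zero intro: lcm_ideal_mon_quot)
      moreover have s_out: "s x b = 0" if "b \<notin> \<beta> ` F" for b
        using that by (simp add: s_def)
      then have "{b. s x b \<noteq> 0} \<subseteq> \<beta> ` F"
        by blast
      then have "finite {b. s x b \<noteq> 0}"
        using finF' finite_subset by blast
      ultimately show "s x \<in> carrier (free_module R (\<beta> ` F))"
        using s_out by (simp add: free_module_def lcm_ideal_empty)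
    qed
    show "s (x \<oplus>\<^bsub>fun_module (emb ` Q)\<^esub> y) = s x \<oplus>\<^bsub>free_module R (\<beta> ` F)\<^esub> s y" for x y
      by (simp add: free_module_def s_def fun_eq_iff prj_ops fun_ops mon_quot_add)
    show "s (p \<odot>\<^bsub>fun_module (emb ` Q)\<^esub> x) = p \<odot>\<^bsub>free_module R (\<beta> ` F)\<^esub> s x"
      if "x \<in> carrier (fun_module (emb ` Q))" for p x
      using that prjL[of x] by (auto simp: free_module_def s_def fun_eq_iff prj_ops fun_ops quot_scale \<gamma>)
  qed
  have wT: "w f \<in> taylor_mod i" if f: "f \<in> carrier (free_module R (\<beta> ` F))" for f
  proof (rule taylor_mod_I)
    fix \<sigma>
    have "f (\<beta> \<sigma>) \<in> lcm_ideal {}" if "\<sigma> \<in> F"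
      using f that by (simp add: free_module_def lcm_ideal_empty)
    moreover have "mon (u \<sigma>) \<in> lcm_ideal \<sigma>" if "\<sigma> \<in> F"
      using that A_sub keys_u[OF that] by (auto simp: lcm_ideal_def F_def)
    ultimately show "w f \<sigma> \<in> lcm_ideal \<sigma>"
      using lcm_ideal_scale[of "f (\<beta> \<sigma>)" "mon (u \<sigma>)" \<sigma>] by (auto simp: w_def lcm_ideal_zero mult.commute)
    assume "w f \<sigma> \<noteq> 0"
    then show "\<sigma> \<subseteq> {..<n} \<and> card \<sigma> = i"
      by (auto simp: w_def F_def split: if_splits)
  qed
  have p: "(\<lambda>f. emb (\<rho> (w f))) \<in> mod_hom R (free_module R (\<beta> ` F)) (fun_module (emb ` Q :: ('b + nat \<Rightarrow> 'k mpoly) set))"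
    unfolding mod_hom_def
  proof (intro CollectI conjI ballI)
    show "(\<lambda>f. emb (\<rho> (w f))) \<in> carrier (free_module R (\<beta> ` F)) \<rightarrow> carrier (fun_module (emb ` Q))"
      using wT \<rho>(2) by auto
    fix f :: "('b + nat \<Rightarrow> 'k mpoly) \<Rightarrow> 'k mpoly" assume f: "f \<in> carrier (free_module R (\<beta> ` F))"
    show "emb (\<rho> (w (f \<oplus>\<^bsub>free_module R (\<beta> ` F)\<^esub> g))) = emb (\<rho> (w f)) \<oplus>\<^bsub>fun_module (emb ` Q)\<^esub> emb (\<rho> (w g))"
      if g: "g \<in> carrier (free_module R (\<beta> ` F))" for g :: "('b + nat \<Rightarrow> 'k mpoly) \<Rightarrow> 'k mpoly"
    proof -
      have "w (f \<oplus>\<^bsub>free_module R (\<beta> ` F)\<^esub> g) = w f + w g"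
        by (simp add: w_def free_module_def fun_eq_iff fun_ops distrib_left)
      then show ?thesis
        using \<rho>(1) wT[OF f] wT[OF g] by (simp add: lin_on_def emb_ops)
    qed
    show "emb (\<rho> (w (q \<odot>\<^bsub>free_module R (\<beta> ` F)\<^esub> f))) = q \<odot>\<^bsub>fun_module (emb ` Q)\<^esub> emb (\<rho> (w f))"
      if q: "q \<in> carrier R" for q
    proof -
      have "w (q \<odot>\<^bsub>free_module R (\<beta> ` F)\<^esub> f) = q \<bullet> w f"
        by (simp add: w_def free_module_def fun_eq_iff fun_ops mult.left_commute)
      then show ?thesis
        using \<rho>(1) wT[OF f] q by (simp add: lin_on_def emb_ops lcm_ideal_empty)
    qed
  qed
  have ps: "emb (\<rho> (w (s x))) = x" if "x \<in> carrier (fun_module (emb ` Q))" for x :: "'b + nat \<Rightarrow> 'k mpoly"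
  proof -
    have x: "x \<in> emb ` Q"
      using that by simp
    have "w (s x) \<sigma> = prj x \<sigma>" for \<sigma>
    proof (cases "\<sigma> \<in> F")
      case True
      then show ?thesis
        using div[OF True prjL[OF x]] by (simp add: w_def s_def \<gamma>)
    next
      case False
      then show ?thesis
        using taylor_mod_D(2)[of "prj x" i \<sigma>] prjQ(1)[OF x] QT by (auto simp: w_def F_def)
    qed
    then have "w (s x) = prj x" ..
    then show ?thesis
      using \<rho>(3) prjQ[OF x] by simp
  qed
  show ?thesis
    unfolding projective_module_def
    by (intro conjI submod_module[OF Q] exI[of _ "\<beta> ` F"] bexI[OF _ s] bexI[OF _ p] ballI) (rule ps)
qed

text \<open>The ideal generated by the monomials with supports \<open>A j\<close>, which the Taylor complex resolves.\<close>

definition sqfree_ideal :: "'k::field mpoly set"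
  where "sqfree_ideal = {p \<in> lcm_ideal {}. \<forall>m\<in>Poly_Mapping.keys p. \<exists>j<n. A j \<subseteq> Poly_Mapping.keys m}"

lemma sqfree_ideal_add: "p \<in> sqfree_ideal \<Longrightarrow> q \<in> sqfree_ideal \<Longrightarrow> p + q \<in> sqfree_ideal"
  using Poly_Mapping.keys_add[of p q] lcm_ideal_add by (auto simp: sqfree_ideal_def)

lemma sqfree_ideal_mult:
  assumes "p \<in> lcm_ideal {}" "q \<in> sqfree_ideal"
  shows "p * q \<in> sqfree_ideal"
proof -
  have "\<exists>j<n. A j \<subseteq> Poly_Mapping.keys m" if m: "m \<in> Poly_Mapping.keys (p * q)" for m
  proof -
    obtain a b where m: "m = a + b" "b \<in> Poly_Mapping.keys q"
      using m keys_mult[of p q] by blast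
    have "\<forall>m\<in>Poly_Mapping.keys q. \<exists>j<n. A j \<subseteq> Poly_Mapping.keys m"
      using assms(2) by (simp add: sqfree_ideal_def)
    with m(2) obtain j where "j < n" "A j \<subseteq> Poly_Mapping.keys b"
      by blast
    then show ?thesis
      unfolding m(1) keys_add_exp by blast
  qed
  moreover have "p * q \<in> lcm_ideal {}"
    using lcm_ideal_mult[of p "{}" q "{}"] assms by (simp add: sqfree_ideal_def)
  ultimately show ?thesis
    by (simp add: sqfree_ideal_def)
qed

lemma sqfree_ideal_zero: "0 \<in> sqfree_ideal"
  by (simp add: sqfree_ideal_def lcm_ideal_zero)

lemma sqfree_ideal_vars: "p \<in> sqfree_ideal \<Longrightarrow> vars p \<subseteq> X"
  by (simp add: sqfree_ideal_def lcm_ideal_empty)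

lemma ideal_sqfree_ideal: "ideal (sqfree_ideal :: 'k::field mpoly set) R"
proof (rule poly_idealI)
  show "r * p \<in> sqfree_ideal" if "vars r \<subseteq> X" "p \<in> sqfree_ideal" for r p :: "'k mpoly"
    using that by (intro sqfree_ideal_mult) (simp add: lcm_ideal_empty)
qed (auto intro: sqfree_ideal_add sqfree_ideal_zero dest: sqfree_ideal_vars)

lemma bd_sqfree_ideal:
  assumes "v \<in> taylor_mod (Suc 0)"
  shows "bd n v {} \<in> sqfree_ideal"
proof -
  have "contr j v {} \<in> sqfree_ideal" if "j < n" for j
  proof -
    have "contr j v {} = v {j}"
      by (simp add: contr_def sgn_at_def)
    moreover have "v {j} \<in> lcm_ideal {j}"
      by (rule taylor_mod_D(1)[OF assms])
    ultimately show ?thesis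
      using that by (auto simp: sqfree_ideal_def lcm_ideal_def)
  qed
  then have "(\<Sum>j<k. contr j v {}) \<in> sqfree_ideal" if "k \<le> n" for k
    using that by (induction k) (simp_all add: sqfree_ideal_zero sqfree_ideal_add)
  then show ?thesis
    by (simp add: bd_def sum_fun_apply)
qed

lemma bd_T0: "v \<in> taylor_mod 0 \<Longrightarrow> bd n v = 0"
proof -
  assume v: "v \<in> taylor_mod 0"
  have "v (insert j \<sigma>) = 0" for j \<sigma>
    using taylor_mod_D(2)[OF v, of "insert j \<sigma>"] finite_subset[of "insert j \<sigma>" "{..<n}"] by force
  then show ?thesis
    by (auto simp: bd_def contr_def fun_eq_iff sum_fun_apply fun_ops intro!: sum.neutral)
qed

text \<open>The Taylor complex is cut off at degree \<open>r\<close>: \<open>bd n \<circ> s\<close> projects \<open>taylor_mod r\<close> onto the boundaries, and the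
  kernel of this projection takes the place of \<open>taylor_mod r\<close>. It has the same image under the differential and
  meets the boundaries only in \<open>0\<close>, so nothing is left to resolve in higher degrees.\<close>

theorem proj_dim_le:
  fixes s :: "'k::field mpoly ext \<Rightarrow> 'k mpoly ext"
  assumes sT: "\<And>v. v \<in> taylor_mod r \<Longrightarrow> s v \<in> taylor_mod (Suc r)"
    and sadd: "\<And>v w. v \<in> taylor_mod r \<Longrightarrow> w \<in> taylor_mod r \<Longrightarrow> s (v + w) = s v + s w"
    and sscl: "\<And>p v. v \<in> taylor_mod r \<Longrightarrow> s (p \<bullet> v) = p \<bullet> s v"
    and retr: "\<And>y. y \<in> taylor_mod (Suc r) \<Longrightarrow> bd n (s (bd n y)) = bd n y"
  shows "proj_dim (R :: 'k mpoly ring) (quot_module R sqfree_ideal) \<le> enat r"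
proof -
  interpret R: cring "R :: 'k mpoly ring" by (rule poly_ring_cring)
  interpret I: ideal "sqfree_ideal :: 'k mpoly set" R by (rule ideal_sqfree_ideal)
  let ?M = "quot_module R (sqfree_ideal :: 'k mpoly set)"
  define Q where "Q i = (if i < r then taylor_mod i else if i = r then {v \<in> taylor_mod r. bd n (s v) = 0} else {0})" for i
  \<comment> \<open>The projection of the Taylor complex onto the truncated one, in each degree.\<close>
  define \<rho> where "\<rho> i v = (if i < r then v else if i = r then v - bd n (s v) else 0)" for i v
  have QT: "Q i \<subseteq> taylor_mod i" for i
    by (auto simp: Q_def taylor_mod_zero)
  have s0: "s 0 = 0"
    using sscl[OF taylor_mod_zero, of 0] by simp
  have submod: "submod i (Q i)" for i
    by (auto simp: submod_def Q_def taylor_mod_zero taylor_mod_add taylor_mod_scale s0 sadd sscl lin_zero[OF lin_bd]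
        lin_add[OF lin_bd] lin_scl[OF lin_bd])
  have \<rho>Q: "\<rho> i v \<in> Q i" if v: "v \<in> taylor_mod i" for i v
  proof (cases "i = r")
    case True
    have bT: "bd n (s v) \<in> taylor_mod r"
      using taylor_mod_bd[OF sT] v True by simp
    have "s (v - bd n (s v) + bd n (s v)) = s (v - bd n (s v)) + s (bd n (s v))"
      using v True bT by (intro sadd taylor_mod_diff) auto
    then have "s (v - bd n (s v)) = s v - s (bd n (s v))"
      by (metis add_diff_cancel_right' diff_add_cancel)
    then have "bd n (s (v - bd n (s v))) = 0"
      using retr[OF sT] v True by (simp add: lin_diff[OF lin_bd])
    then show ?thesis
      using v True bT by (simp add: \<rho>_def Q_def taylor_mod_diff)
  qed (use v in \<open>auto simp: \<rho>_def Q_def\<close>)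
  have \<rho>id: "\<rho> i v = v" if "v \<in> Q i" for i v
    using that by (auto simp: \<rho>_def Q_def split: if_splits)
  have \<rho>lin: "lin_on (taylor_mod i) (\<rho> i)" for i
    by (auto simp: lin_on_def \<rho>_def sadd sscl lin_add[OF lin_bd] lin_scl[OF lin_bd] scl_add)
  have bdQ: "bd n v \<in> Q i" if "v \<in> Q (Suc i)" for v i
    using that QT[of "Suc i"] taylor_mod_bd[of v i]
    by (auto simp: Q_def lin_zero[OF lin_bd] taylor_mod_zero s0 split: if_splits)
  have bd_\<rho>: "bd n (\<rho> (Suc i) v) = bd n v" if "i < r" for v i
    using that by (auto simp: \<rho>_def lin_diff[OF lin_bd] bd_bd)
  \<comment> \<open>The condition on the coefficient of \<open>{}\<close> is automatic in positive degree; in degree \<open>0\<close> it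
    says that \<open>v\<close> is in the kernel of the augmentation. So one statement covers all degrees.\<close>
  have exact: "v \<in> bd n ` Q (Suc i)" if v: "v \<in> Q i" "bd n v = 0" "v {} \<in> sqfree_ideal" for v i
  proof -
    consider "i < r" | "i = r" | "r < i" by linarith
    then show ?thesis
    proof cases
      case 1
      obtain w where w: "w \<in> taylor_mod (Suc i)" "bd n w = v"
        using taylor_mod_exact[of v i] v QT by (auto simp: sqfree_ideal_def)
      then show ?thesis
        using bd_\<rho>[OF 1, of w] \<rho>Q[OF w(1)] by (metis image_eqI)
    next
      case 2
      obtain w where w: "w \<in> taylor_mod (Suc i)" "bd n w = v"
        using taylor_mod_exact[of v i] v QT by (auto simp: sqfree_ideal_def)
      then have "v = 0"
        using retr[of w] v(1) 2 by (simp add: Q_def)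
      then show ?thesis
        using 2 by (simp add: Q_def lin_zero[OF lin_bd])
    next
      case 3
      then show ?thesis
        using v(1) by (simp add: Q_def lin_zero[OF lin_bd])
    qed
  qed
  define P :: "nat \<Rightarrow> ('k mpoly, 'k mpoly set + nat \<Rightarrow> 'k mpoly) module"
    where "P i = fun_module (emb ` Q i)" for i
  define d :: "nat \<Rightarrow> ('k mpoly set + nat \<Rightarrow> 'k mpoly) \<Rightarrow> 'k mpoly set + nat \<Rightarrow> 'k mpoly"
    where "d i x = emb (bd n (prj x))" for i x
  define e :: "('k mpoly set + nat \<Rightarrow> 'k mpoly) \<Rightarrow> 'k mpoly set"
    where "e x = sqfree_ideal +>\<^bsub>R\<^esub> prj x {}" for x
  have prj: "prj (emb v :: 'k mpoly set + nat \<Rightarrow> 'k mpoly) = v" if "v \<in> Q i" for v i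
    using QT that prj_emb_T by blast
  have prj0: "prj (emb 0 :: 'k mpoly set + nat \<Rightarrow> 'k mpoly) = 0"
    by (rule prj_emb_T[OF taylor_mod_zero])
  have proj: "(+>\<^bsub>R\<^esub>) sqfree_ideal \<in> ring_hom R (R Quot (sqfree_ideal :: 'k mpoly set))"
    by (rule I.rcos_ring_hom)
  note hom = ring_hom_add[OF proj, simplified] ring_hom_mult[OF proj, simplified] ring_hom_closed[OF proj, simplified]
  have fields: "carrier ?M = carrier (R Quot sqfree_ideal)"
    "add ?M = add (R Quot sqfree_ideal)" "zero ?M = zero (R Quot sqfree_ideal)"
    "smult ?M = (\<lambda>p B. (sqfree_ideal +>\<^bsub>R\<^esub> p) \<otimes>\<^bsub>R Quot sqfree_ideal\<^esub> B)"
    by (simp_all add: quot_module_def ring.extend_def)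
  have vX: "vars (v \<sigma>) \<subseteq> X" if "v \<in> Q i" for v i \<sigma>
    using taylor_mod_D(1)[of v i \<sigma>] QT that lcm_ideal_antimono[of "{}" \<sigma>] by (auto simp: lcm_ideal_empty)
  have e_hom: "e \<in> mod_hom R (P 0) ?M"
    unfolding mod_hom_def P_def
    by (auto simp: fields e_def prj prj_ops fun_ops hom vX)
  have coset0: "sqfree_ideal +>\<^bsub>R\<^esub> p = sqfree_ideal \<longleftrightarrow> p \<in> sqfree_ideal" if "vars p \<subseteq> X" for p :: "'k mpoly"
    using that I.rcos_const_imp_mem[of p] R.a_rcos_zero[OF ideal_sqfree_ideal, of p] by auto
  have zeroM: "zero ?M = sqfree_ideal"
    by (simp add: fields FactRing_def)
  have e_surj: "e ` carrier (P 0) = carrier ?M"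
  proof
    show "e ` carrier (P 0) \<subseteq> carrier ?M"
      using e_hom by (auto simp: mod_hom_def)
    show "carrier ?M \<subseteq> e ` carrier (P 0)"
    proof
      fix B assume "B \<in> carrier ?M"
      then obtain p :: "'k mpoly" where p: "vars p \<subseteq> X" "B = sqfree_ideal +>\<^bsub>R\<^esub> p"
        by (auto simp: fields FactRing_def A_RCOSETS_def' )
      \<comment> \<open>The lift \<open>p\<close> of a coset need not lie in the truncated module when \<open>r = 0\<close>; its projection
        does, and differs from it by a boundary, thus by an element of the ideal.\<close>
      define v where "v = p \<bullet> (ext_one :: 'k mpoly ext)"
      have v: "v \<in> taylor_mod 0" "v {} = p"
        using p taylor_mod_scale[OF _ taylor_mod_ext_one, of p] by (auto simp: v_def lcm_ideal_empty fun_ops ext_basis_def)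
      have Qv: "\<rho> 0 v \<in> Q 0"
        by (rule \<rho>Q[OF v(1)])
      have "p - \<rho> 0 v {} \<in> sqfree_ideal"
      proof (cases "r = 0")
        case True
        then show ?thesis
          using bd_sqfree_ideal[of "s v"] sT[of v] v by (simp add: \<rho>_def fun_ops)
      qed (simp add: \<rho>_def v sqfree_ideal_zero)
      then have "sqfree_ideal +>\<^bsub>R\<^esub> (p - \<rho> 0 v {}) = sqfree_ideal"
        by (subst coset0) (auto simp: sqfree_ideal_def lcm_ideal_empty)
      moreover have "sqfree_ideal +>\<^bsub>R\<^esub> ((p - \<rho> 0 v {}) + \<rho> 0 v {})
          = (sqfree_ideal +>\<^bsub>R\<^esub> (p - \<rho> 0 v {})) \<oplus>\<^bsub>R Quot sqfree_ideal\<^esub> (sqfree_ideal +>\<^bsub>R\<^esub> \<rho> 0 v {})"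
        using \<open>p - \<rho> 0 v {} \<in> sqfree_ideal\<close> by (intro hom vX[OF Qv]) (auto simp: sqfree_ideal_def lcm_ideal_empty)
      moreover have "sqfree_ideal \<oplus>\<^bsub>R Quot sqfree_ideal\<^esub> (sqfree_ideal +>\<^bsub>R\<^esub> \<rho> 0 v {}) = sqfree_ideal +>\<^bsub>R\<^esub> \<rho> 0 v {}"
      proof -
        interpret Quo: cring "R Quot (sqfree_ideal :: 'k mpoly set)" by (rule I.quotient_is_cring[OF poly_ring_cring])
        have "\<zero>\<^bsub>R Quot (sqfree_ideal :: 'k mpoly set)\<^esub> = sqfree_ideal"
          by (simp add: FactRing_def)
        then show ?thesis
          using Quo.l_zero[OF hom(3)[OF vX[OF Qv]]] by simp
      qed
      ultimately have "B = sqfree_ideal +>\<^bsub>R\<^esub> \<rho> 0 v {}"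
        by (simp add: p(2))
      then have "B = e (emb (\<rho> 0 v))"
        by (simp add: e_def prj[OF Qv])
      then show "B \<in> e ` carrier (P 0)"
        using Qv by (auto simp: P_def)
    qed
  qed
  have carrier_P: "carrier (P i) = emb ` Q i" for i
    by (simp add: P_def)
  have image_eq: "d i ` carrier (P (Suc i)) = emb ` {v \<in> Q i. bd n v = 0 \<and> v {} \<in> sqfree_ideal}" for i
  proof -
    have img: "d i ` carrier (P (Suc i)) = emb ` (bd n ` Q (Suc i))"
      by (force simp: d_def P_def prj image_image)
    have "bd n ` Q (Suc i) = {v \<in> Q i. bd n v = 0 \<and> v {} \<in> sqfree_ideal}"
    proof safe
      fix v assume v: "v \<in> Q (Suc i)"
      show "bd n v \<in> Q i"
        by (rule bdQ[OF v])
      show "bd n (bd n v) = 0"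
        by (rule bd_bd)
      show "bd n v {} \<in> sqfree_ideal"
      proof (cases i)
        case 0
        then show ?thesis
          using bd_sqfree_ideal[of v] v QT by blast
      next
        case (Suc j)
        then have "bd n v {} = 0"
          using taylor_mod_D(2)[OF taylor_mod_bd[of v "Suc j"], of "{}"] v QT[of "Suc i"] by force
        then show ?thesis
          by (simp add: sqfree_ideal_zero)
      qed
    qed (rule exact)
    then show ?thesis
      unfolding img by simp
  qed
  have ker_eq: "{x \<in> emb ` Q i. C x} = emb ` {v \<in> Q i. C (emb v)}" for i C
    by blast
  have "projective_resolution R ?M P d e"
    unfolding projective_resolution_def
  proof (intro conjI allI)
    show "projective_module R (P i)" for i
      unfolding P_def by (rule projective_retract[OF submod \<rho>lin \<rho>Q \<rho>id])
    show "d i \<in> mod_hom R (P (Suc i)) (P i)" for i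
      unfolding P_def d_def[abs_def]
      by (rule mod_hom_transport[OF submod _ bdQ])
        (auto simp: lin_on_def lin_add[OF lin_bd] lin_scl[OF lin_bd])
    have "d 0 ` carrier (P (Suc 0)) = mod_ker (P 0) ?M e"
      unfolding image_eq unfolding mod_ker_def zeroM carrier_P ker_eq
    proof (intro arg_cong[of _ _ "(`) emb"] Collect_cong conj_cong refl)
      fix v assume v: "v \<in> Q 0"
      show "bd n v = 0 \<and> v {} \<in> sqfree_ideal \<longleftrightarrow> e (emb v) = sqfree_ideal"
        using v QT[of 0] bd_T0[of v] coset0[OF vX[OF v]] by (auto simp: e_def prj)
    qed
    then show "d 0 ` carrier (P 1) = mod_ker (P 0) ?M e"
      by simp
    show "d (Suc i) ` carrier (P (Suc (Suc i))) = mod_ker (P (Suc i)) (P i) (d i)" for i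
      unfolding image_eq unfolding mod_ker_def carrier_P ker_eq
    proof (intro arg_cong[of _ _ "(`) emb"] Collect_cong conj_cong refl)
      fix v assume v: "v \<in> Q (Suc i)"
      have "v {} = 0"
        using taylor_mod_D(2)[of v "Suc i" "{}"] v QT by force
      moreover have "emb (bd n v) = \<zero>\<^bsub>P i\<^esub> \<longleftrightarrow> bd n v = 0"
      proof
        assume "emb (bd n v) = \<zero>\<^bsub>P i\<^esub>"
        then have "emb (bd n v) = (emb 0 :: 'k mpoly set + nat \<Rightarrow> 'k mpoly)"
          by (simp add: emb_ops P_def)
        from arg_cong[OF this, of prj] show "bd n v = 0"
          by (simp add: prj[OF bdQ[OF v]] prj0)
      qed (simp add: emb_ops P_def)
      ultimately show "bd n v = 0 \<and> v {} \<in> sqfree_ideal \<longleftrightarrow> d i (emb v) = \<zero>\<^bsub>P i\<^esub>"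
        using v by (simp add: d_def prj sqfree_ideal_zero)
    qed
  qed (use e_hom e_surj in auto)
  moreover have "\<forall>i>r. carrier (P i) = {\<zero>\<^bsub>P i\<^esub>}"
    by (auto simp: P_def Q_def emb_ops)
  ultimately show ?thesis
    unfolding proj_dim_def by (intro Inf_lower) blast
qed

end

section \<open>Ideals of monomials and their minimal generators\<close>

lemma poly_idealD:
  assumes "ideal (J :: 'k::field mpoly set) (poly_ring X)"
  shows "0 \<in> J" "p \<in> J \<Longrightarrow> q \<in> J \<Longrightarrow> p + q \<in> J" "vars r \<subseteq> X \<Longrightarrow> p \<in> J \<Longrightarrow> r * p \<in> J"
  using additive_subgroup.zero_closed[OF ideal.axioms(1)[OF assms]]
    additive_subgroup.a_closed[OF ideal.axioms(1)[OF assms], of p q]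
    ideal.I_l_closed[OF assms, of p r] by simp_all

lemma poly_ideal_sum:
  assumes "ideal (J :: 'k::field mpoly set) (poly_ring X)" "\<And>i. i \<in> I \<Longrightarrow> f i \<in> J"
  shows "sum f I \<in> J"
  using assms(2) by (induction I rule: infinite_finite_induct) (auto simp: poly_idealD[OF assms(1)])

lemma vars_sum: "(\<And>i. i \<in> I \<Longrightarrow> vars (f i) \<subseteq> X) \<Longrightarrow> vars (sum f I) \<subseteq> X"
proof (induction I rule: infinite_finite_induct)
  case (insert i I)
  then show ?case
    using vars_add_subset[of "f i" "sum f I"] by auto
qed (simp_all add: vars_zero)

lemma vars_mult: "vars p \<subseteq> X \<Longrightarrow> vars q \<subseteq> X \<Longrightarrow> vars (p * q :: 'k::field mpoly) \<subseteq> X"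
  using vars_mult_subset[of p q] by blast

lemma vars_mon [simp]: "vars (mon e :: 'k::field mpoly) = Poly_Mapping.keys e"
  by (simp add: vars_def)

lemma genideal_comb:
  fixes b :: "nat \<Rightarrow> 'k::field mpoly"
  assumes b: "\<And>i. i < n \<Longrightarrow> vars (b i) \<subseteq> X" and p: "p \<in> Idl\<^bsub>poly_ring X\<^esub> (b ` {..<n})"
  obtains g where "\<And>i. vars (g i) \<subseteq> X" "p = (\<Sum>i<n. g i * b i)"
proof -
  interpret R: cring "poly_ring X :: 'k mpoly ring" by (rule poly_ring_cring)
  let ?J = "{\<Sum>i<n. g i * b i | g. \<forall>i. vars (g i) \<subseteq> X}"
  have "ideal ?J (poly_ring X)"
  proof (rule poly_idealI)
    have "vars (\<Sum>i<n. g i * b i) \<subseteq> X" if "\<forall>i. vars (g i) \<subseteq> X" for g :: "nat \<Rightarrow> 'k mpoly"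
      using that b by (intro vars_sum vars_mult) auto
    then show "?J \<subseteq> {p. vars p \<subseteq> X}"
      by blast
    show "0 \<in> ?J"
      by (auto intro!: exI[of _ "\<lambda>_. 0"] simp: vars_zero)
    show "p + q \<in> ?J" if pq: "p \<in> ?J" "q \<in> ?J" for p q
    proof -
      obtain g h where "p = (\<Sum>i<n. g i * b i)" "q = (\<Sum>i<n. h i * b i)" and v: "\<And>i. vars (g i) \<subseteq> X" "\<And>i. vars (h i) \<subseteq> X"
        using pq by blast
      then have "p + q = (\<Sum>i<n. (g i + h i) * b i)"
        by (simp add: distrib_right sum.distrib)
      moreover have "vars (g i + h i) \<subseteq> X" for i
        using v vars_add_subset by blast
      ultimately show ?thesis
        by (intro CollectI exI[of _ "\<lambda>i. g i + h i"]) simp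
    qed
    show "r * p \<in> ?J" if r: "vars r \<subseteq> X" and p: "p \<in> ?J" for r p
    proof -
      obtain g where "p = (\<Sum>i<n. g i * b i)" and v: "\<And>i. vars (g i) \<subseteq> X"
        using p by blast
      then have "r * p = (\<Sum>i<n. (r * g i) * b i)"
        by (simp add: sum_distrib_left mult.assoc)
      moreover have "vars (r * g i) \<subseteq> X" for i
        using r v by (rule vars_mult)
      ultimately show ?thesis
        by (intro CollectI exI[of _ "\<lambda>i. r * g i"]) simp
    qed
  qed
  moreover have "b ` {..<n} \<subseteq> ?J"
  proof
    fix q assume "q \<in> b ` {..<n}"
    then obtain j where "j < n" "q = b j"
      by blast
    then have "q = (\<Sum>i<n. (if i = j then 1 else 0) * b i)"
      by (simp add: if_distrib[of "\<lambda>x. x * _"] cong: if_cong)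
    moreover have "vars (if i = j then 1 else 0 :: 'k mpoly) \<subseteq> X" for i
      by (simp add: vars_zero vars_one)
    ultimately show "q \<in> ?J"
      by (intro CollectI exI[of _ "\<lambda>i. if i = j then 1 else 0"]) simp
  qed
  ultimately have "p \<in> ?J"
    using R.genideal_minimal p by blast
  then show thesis
    using that by blast
qed

definition edvd :: "(nat \<Rightarrow>\<^sub>0 nat) \<Rightarrow> (nat \<Rightarrow>\<^sub>0 nat) \<Rightarrow> bool"
  where "edvd e m \<longleftrightarrow> (\<forall>x. Poly_Mapping.lookup e x \<le> Poly_Mapping.lookup m x)"

lemma edvd_refl: "edvd e e" and edvd_trans: "edvd a b \<Longrightarrow> edvd b c \<Longrightarrow> edvd a c"
  by (auto simp: edvd_def intro: order_trans)

lemma edvd_antisym: "edvd a b \<Longrightarrow> edvd b a \<Longrightarrow> a = b"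
  unfolding edvd_def by (intro poly_mapping_eqI antisym) auto

definition mon_ideal :: "nat set \<Rightarrow> (nat \<Rightarrow>\<^sub>0 nat) set \<Rightarrow> 'k::field mpoly set"
  where "mon_ideal X E = {p. vars p \<subseteq> X \<and> (\<forall>m\<in>Poly_Mapping.keys p. \<exists>e\<in>E. edvd e m)}"

lemma mon_in_mon_ideal: "mon m \<in> (mon_ideal UNIV E :: 'k::field mpoly set) \<longleftrightarrow> (\<exists>e\<in>E. edvd e m)"
  by (simp add: mon_ideal_def)

lemma ideal_mon_ideal: "ideal (mon_ideal X E :: 'k::field mpoly set) (poly_ring X)"
proof (rule poly_idealI)
  show "mon_ideal X E \<subseteq> {p. vars p \<subseteq> X}"
    by (auto simp: mon_ideal_def)
  show "0 \<in> mon_ideal X E"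
    by (simp add: mon_ideal_def vars_zero)
  show "p + q \<in> mon_ideal X E" if "p \<in> mon_ideal X E" "q \<in> mon_ideal X E" for p q :: "'k mpoly"
    using that vars_add_subset[of p q] Poly_Mapping.keys_add[of p q] unfolding mon_ideal_def by blast
  show "r * p \<in> mon_ideal X E" if "vars r \<subseteq> X" "p \<in> mon_ideal X E" for r p :: "'k mpoly"
  proof -
    have "\<exists>e\<in>E. edvd e m" if m: "m \<in> Poly_Mapping.keys (r * p)" for m
    proof -
      obtain a b where ab: "m = a + b" "b \<in> Poly_Mapping.keys p"
        using m keys_mult[of r p] by blast
      obtain e where "e \<in> E" "edvd e b"
        using \<open>p \<in> mon_ideal X E\<close> ab(2) unfolding mon_ideal_def by blast
      moreover have "edvd b m"
        by (simp add: edvd_def ab(1) lookup_add)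
      ultimately show ?thesis
        using edvd_trans by blast
    qed
    then show ?thesis
      using that by (simp add: mon_ideal_def vars_mult)
  qed
qed

text \<open>Membership in an ideal generated by monomials is decided monomial by monomial.\<close>

lemma genideal_monomials:
  assumes "\<And>e. e \<in> E \<Longrightarrow> Poly_Mapping.keys e \<subseteq> X"
  shows "Idl\<^bsub>poly_ring X\<^esub> (mon ` E) = (mon_ideal X E :: 'k::field mpoly set)"
proof
  interpret R: cring "poly_ring X :: 'k mpoly ring" by (rule poly_ring_cring)
  show "Idl\<^bsub>poly_ring X\<^esub> (mon ` E) \<subseteq> (mon_ideal X E :: 'k mpoly set)"
  proof (rule R.genideal_minimal[OF ideal_mon_ideal])
    show "mon ` E \<subseteq> (mon_ideal X E :: 'k mpoly set)"
      using assms edvd_refl by (simp add: mon_ideal_def image_subset_iff) blast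
  qed
  have car: "mon ` E \<subseteq> carrier (poly_ring X :: 'k mpoly ring)"
    using assms by (simp add: image_subset_iff)
  note I = R.genideal_ideal[OF car]
  show "mon_ideal X E \<subseteq> Idl\<^bsub>poly_ring X\<^esub> (mon ` E :: 'k mpoly set)"
  proof
    fix p :: "'k mpoly" assume p: "p \<in> mon_ideal X E"
    have "Poly_Mapping.single m (Poly_Mapping.lookup p m) \<in> Idl\<^bsub>poly_ring X\<^esub> (mon ` E)"
      if m: "m \<in> Poly_Mapping.keys p" for m
    proof -
      obtain e where e: "e \<in> E" "edvd e m"
        using p m unfolding mon_ideal_def by blast
      have me: "m = (m - e) + e"
        using e(2) exponent_dvd[of e m] by (simp add: edvd_def add.commute)
      then have eq: "Poly_Mapping.single m (Poly_Mapping.lookup p m)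
          = Poly_Mapping.single (m - e) (Poly_Mapping.lookup p m) * mon e"
        by (simp add: Poly_Mapping.mult_single)
      have "Poly_Mapping.keys m \<subseteq> X"
        using p m by (auto simp: mon_ideal_def vars_def)
      then have "Poly_Mapping.keys (m - e) \<subseteq> X"
        by (metis me keys_add_exp Un_subset_iff)
      then have "vars (Poly_Mapping.single (m - e) (Poly_Mapping.lookup p m)) \<subseteq> X"
        by (simp add: vars_def)
      then show ?thesis
        unfolding eq using R.genideal_self[OF car] e(1) by (intro poly_idealD(3)[OF I]) auto
    qed
    then have "(\<Sum>m\<in>Poly_Mapping.keys p. Poly_Mapping.single m (Poly_Mapping.lookup p m))
        \<in> Idl\<^bsub>poly_ring X\<^esub> (mon ` E)"
      by (rule poly_ideal_sum[OF I])
    then show "p \<in> Idl\<^bsub>poly_ring X\<^esub> (mon ` E)"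
      by (simp only: sum_monomials)
  qed
qed

definition min_exps :: "(nat \<Rightarrow>\<^sub>0 nat) set \<Rightarrow> (nat \<Rightarrow>\<^sub>0 nat) set"
  where "min_exps E = {e \<in> E. \<forall>e'\<in>E. edvd e' e \<longrightarrow> e' = e}"

lemma min_exps_below:
  assumes "finite E" "e \<in> E"
  shows "\<exists>e'\<in>min_exps E. edvd e' e"
  using assms(2)
proof (induction "card {e'\<in>E. edvd e' e}" arbitrary: e rule: less_induct)
  case less
  show ?case
  proof (cases "e \<in> min_exps E")
    case False
    then obtain e' where e': "e' \<in> E" "edvd e' e" "e' \<noteq> e"
      using less.prems by (auto simp: min_exps_def)
    then have "{f\<in>E. edvd f e'} \<subset> {f\<in>E. edvd f e}"
      using edvd_trans edvd_antisym edvd_refl less.prems by blast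
    then have "card {f\<in>E. edvd f e'} < card {f\<in>E. edvd f e}"
      using assms(1) by (intro psubset_card_mono) auto
    then show ?thesis
      using less.hyps e' edvd_trans by blast
  qed (use edvd_refl in blast)
qed

lemma mon_ideal_min_exps:
  assumes "finite E"
  shows "mon_ideal X (min_exps E) = mon_ideal X E"
  using min_exps_below[OF assms] edvd_trans unfolding mon_ideal_def min_exps_def by blast

lemma genideal_monomials_UNIV: "Idl\<^bsub>S_inf\<^esub> (mon ` E) = (mon_ideal UNIV E :: 'k::field mpoly set)"
  by (rule genideal_monomials) simp

text \<open>Every set of monomials that generates the ideal contains the monomials with minimal exponents: such a
  monomial is divisible by some member of the set, which in turn is divisible by one of the given
  generators, and by minimality all three coincide. As these monomials also generate, they
  form the only minimal generating set.\<close>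

lemma min_gens_mon_ideal:
  assumes "finite E"
  shows "min_gens (mon_ideal UNIV E) = (mon ` min_exps E :: 'k::field mpoly set)"
proof -
  let ?I = "mon_ideal UNIV E :: 'k mpoly set" and ?M = "mon ` min_exps E :: 'k mpoly set"
  have gen: "Idl\<^bsub>S_inf\<^esub> ?M = ?I"
    by (simp add: genideal_monomials_UNIV mon_ideal_min_exps assms)
  have sub: "?M \<subseteq> G" if G: "G \<subseteq> monomials" "Idl\<^bsub>S_inf\<^esub> G = ?I" for G
  proof
    fix p assume "p \<in> ?M"
    then obtain e where e: "e \<in> min_exps E" "p = mon e"
      by blast
    define F where "F = {f. mon f \<in> G}"
    have "G = mon ` F"
      using G(1) by (auto simp: F_def monomials_def)
    then have I: "mon_ideal UNIV F = ?I"
      using G(2) by (simp add: genideal_monomials_UNIV)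
    have "mon e \<in> ?I"
      using e(1) edvd_refl by (auto simp: mon_in_mon_ideal min_exps_def)
    then obtain f where f: "f \<in> F" "edvd f e"
      unfolding I[symmetric] mon_in_mon_ideal by blast
    have "mon f \<in> ?I"
      unfolding I[symmetric] mon_in_mon_ideal using f(1) edvd_refl by blast
    then obtain e' where e': "e' \<in> E" "edvd e' f"
      unfolding mon_in_mon_ideal by blast
    then have "e' = e"
      using e(1) edvd_trans[OF e'(2) f(2)] by (simp add: min_exps_def)
    then have "f = e"
      using e'(2) f(2) edvd_antisym by blast
    then show "p \<in> G"
      using f(1) e(2) by (simp add: F_def)
  qed
  show ?thesis
    unfolding min_gens_def
  proof (rule the_equality)
    have "?M \<subseteq> monomials"
      by (auto simp: monomials_def)
    then show "?M \<subseteq> monomials \<and> Idl\<^bsub>S_inf\<^esub> ?M = ?I \<and> (\<forall>G'. G' \<subset> ?M \<longrightarrow> Idl\<^bsub>S_inf\<^esub> G' \<noteq> ?I)"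
      using gen sub by blast
  next
    fix G :: "'k mpoly set"
    assume "G \<subseteq> monomials \<and> Idl\<^bsub>S_inf\<^esub> G = ?I \<and> (\<forall>G'. G' \<subset> G \<longrightarrow> Idl\<^bsub>S_inf\<^esub> G' \<noteq> ?I)"
    then show "G = ?M"
      using gen sub[of G] by blast
  qed
qed

lemma sqfree_ideal_min_gens:
  assumes "J \<in> (sqfree_ideals :: 'k::field mpoly set set)"
  shows "finite (min_gens J)" "min_gens J \<subseteq> sqfree_monomials"
    "restr_ideal J = Idl\<^bsub>ideal_ring J\<^esub> (min_gens J)"
proof -
  obtain G :: "'k mpoly set" where G: "finite G" "G \<subseteq> sqfree_monomials" "J = Idl\<^bsub>S_inf\<^esub> G"
    using assms by (auto simp: sqfree_ideals_def)
  define E where "E = {e. mon e \<in> G}"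
  have GE: "G = mon ` E"
    using G(2) by (auto simp: E_def sqfree_monomials_def)
  have "inj_on (mon :: _ \<Rightarrow> 'k mpoly) E"
    by (rule inj_onI) (metis keys_single singleton_inject zero_neq_one)
  then have fin: "finite E"
    using G(1) GE finite_image_iff by blast
  have J: "J = mon_ideal UNIV E"
    using G(3) GE by (simp add: genideal_monomials_UNIV)
  have mg: "min_gens J = mon ` min_exps E"
    unfolding J by (rule min_gens_mon_ideal[OF fin])
  have sub: "min_exps E \<subseteq> E"
    by (auto simp: min_exps_def)
  show "finite (min_gens J)"
    unfolding mg using fin sub finite_subset by blast
  show "min_gens J \<subseteq> sqfree_monomials"
    unfolding mg using G(2) GE sub by blast
  have "Poly_Mapping.keys e \<subseteq> ideal_vars J" if "e \<in> min_exps E" for e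
    using that by (auto simp: ideal_vars_def mg)
  then have "Idl\<^bsub>ideal_ring J\<^esub> (min_gens J) = mon_ideal (ideal_vars J) (min_exps E)"
    unfolding mg by (rule genideal_monomials)
  also have "\<dots> = mon_ideal (ideal_vars J) E"
    by (rule mon_ideal_min_exps[OF fin])
  also have "\<dots> = restr_ideal J"
    by (subst (2) J) (auto simp: mon_ideal_def)
  finally show "restr_ideal J = Idl\<^bsub>ideal_ring J\<^esub> (min_gens J)" ..
qed

section \<open>Radicals and the arithmetical rank\<close>

lemma arith_rank_le:
  "a ` {..<r} \<subseteq> carrier R \<Longrightarrow> radical R (Idl\<^bsub>R\<^esub> (a ` {..<r})) = radical R I \<Longrightarrow> arith_rank R I \<le> enat r"
  unfolding arith_rank_def by (rule Inf_lower) blast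

lemma arith_rankE:
  assumes "arith_rank R I = enat r"
  obtains a where "a ` {..<r} \<subseteq> carrier R" "radical R (Idl\<^bsub>R\<^esub> (a ` {..<r})) = radical R I"
proof -
  let ?S = "{enat r | r. \<exists>a. a ` {..<r} \<subseteq> carrier R \<and> radical R (Idl\<^bsub>R\<^esub> (a ` {..<r})) = radical R I}"
  have "?S \<noteq> {}"
  proof
    assume "?S = {}"
    then have "arith_rank R I = \<infinity>"
      unfolding arith_rank_def by (simp only: Inf_enat_def if_True simp_thms)
    with assms show False by simp
  qed
  then have "Inf ?S \<in> ?S"
    unfolding Inf_enat_def by (metis (no_types, lifting) LeastI_ex ex_in_conv)
  then show thesis
    using that assms unfolding arith_rank_def[symmetric] by auto
qed

context cring
begin

text \<open>This replaces the binomial expansion of \<open>(x + y)\<^bsup>a + b\<^esup>\<close> by an induction on \<open>a + b\<close>; the factor \<open>z\<close>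
  absorbs the powers of \<open>x\<close> and \<open>y\<close> that have been split off.\<close>

lemma radical_add_aux:
  assumes "ideal I R" "x \<in> carrier R" "y \<in> carrier R"
  shows "z \<in> carrier R \<Longrightarrow> x [^] (a::nat) \<otimes> z \<in> I \<Longrightarrow> y [^] (b::nat) \<otimes> z \<in> I \<Longrightarrow> (x \<oplus> y) [^] (a + b) \<otimes> z \<in> I"
proof (induction "a + b" arbitrary: a b z)
  case 0
  then show ?case by simp
next
  case (Suc k)
  interpret I: ideal I R by fact
  have absorb: "(x \<oplus> y) [^] l \<otimes> z \<in> I" if "z \<in> I" for l :: nat
    using that assms by (intro I.I_l_closed) auto
  show ?case
  proof (cases "a = 0 \<or> b = 0")
    case True
    then show ?thesis
      using Suc.prems absorb by auto
  next
    case False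
    then obtain a' b' where ab: "a = Suc a'" "b = Suc b'"
      by (metis not0_implies_Suc)
    have "x [^] a' \<otimes> (x \<otimes> z) = x [^] a \<otimes> z" "y [^] b' \<otimes> (y \<otimes> z) = y [^] b \<otimes> z"
      using Suc.prems assms by (simp_all add: ab m_assoc)
    moreover have "y [^] b \<otimes> (x \<otimes> z) = x \<otimes> (y [^] b \<otimes> z)" "x [^] a \<otimes> (y \<otimes> z) = y \<otimes> (x [^] a \<otimes> z)"
      using Suc.prems assms by (simp_all add: m_lcomm)
    moreover have "x \<otimes> (y [^] b \<otimes> z) \<in> I" "y \<otimes> (x [^] a \<otimes> z) \<in> I"
      using Suc.prems assms by (auto intro: I.I_l_closed)
    ultimately have "(x \<oplus> y) [^] k \<otimes> (x \<otimes> z) \<in> I" "(x \<oplus> y) [^] k \<otimes> (y \<otimes> z) \<in> I"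
      using Suc.hyps(1)[of a' b "x \<otimes> z"] Suc.hyps(1)[of a b' "y \<otimes> z"] Suc.hyps(2) Suc.prems assms
      by (auto simp: ab)
    then have "(x \<oplus> y) [^] k \<otimes> (x \<otimes> z) \<oplus> (x \<oplus> y) [^] k \<otimes> (y \<otimes> z) \<in> I"
      by (rule I.a_closed)
    moreover have "(x \<oplus> y) [^] (a + b) \<otimes> z = (x \<oplus> y) [^] k \<otimes> (x \<otimes> z) \<oplus> (x \<oplus> y) [^] k \<otimes> (y \<otimes> z)"
      using Suc.prems assms unfolding Suc.hyps(2)[symmetric]
      by (simp add: m_assoc l_distr r_distr)
    ultimately show ?thesis
      by simp
  qed
qed

lemma ideal_radical:
  assumes "ideal I R"
  shows "ideal (radical R I) R"
proof -
  interpret I: ideal I R by fact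
  have mult: "z \<otimes> x \<in> radical R I" if x: "x \<in> radical R I" and z: "z \<in> carrier R" for x z
  proof -
    obtain k :: nat where k: "x \<in> carrier R" "x [^] k \<in> I"
      using x by (auto simp: radical_def)
    then have "(z \<otimes> x) [^] k \<in> I"
      using z by (simp add: nat_pow_distrib I.I_l_closed)
    then show ?thesis
      using k z by (auto simp: radical_def)
  qed
  show ?thesis
  proof (rule idealI[OF ring_axioms])
    show "subgroup (radical R I) (add_monoid R)"
    proof (rule add.subgroupI)
      show "radical R I \<subseteq> carrier R"
        by (auto simp: radical_def)
      have "\<zero> [^] (1::nat) \<in> I"
        by simp
      then show "radical R I \<noteq> {}"
        unfolding radical_def by blast
      show "\<ominus> x \<in> radical R I" if x: "x \<in> radical R I" for x
      proof -
        have "\<ominus> x = (\<ominus> \<one>) \<otimes> x"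
          using x by (simp add: radical_def l_minus)
        then show ?thesis
          using mult[OF x, of "\<ominus> \<one>"] by simp
      qed
      show "x \<oplus> y \<in> radical R I" if xy: "x \<in> radical R I" "y \<in> radical R I" for x y
      proof -
        obtain a b :: nat where "x [^] a \<in> I" "y [^] b \<in> I" "x \<in> carrier R" "y \<in> carrier R"
          using xy by (auto simp: radical_def)
        then have "(x \<oplus> y) [^] (a + b) \<otimes> \<one> \<in> I"
          by (intro radical_add_aux[OF assms]) auto
        then have "(x \<oplus> y) [^] (a + b) \<in> I"
          using \<open>x \<in> carrier R\<close> \<open>y \<in> carrier R\<close> by simp
        then show ?thesis
          using \<open>x \<in> carrier R\<close> \<open>y \<in> carrier R\<close> unfolding radical_def by blast
      qed
    qed
    show "z \<otimes> x \<in> radical R I" if "x \<in> radical R I" "z \<in> carrier R" for x z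
      by (rule mult[OF that])
    show "x \<otimes> z \<in> radical R I" if "x \<in> radical R I" "z \<in> carrier R" for x z
      using mult[OF that] that m_comm[of x z] by (simp add: radical_def)
  qed
qed

lemma subset_radical: "ideal I R \<Longrightarrow> I \<subseteq> radical R I"
proof
  fix x assume "ideal I R" "x \<in> I"
  then have "x \<in> carrier R"
    by (rule ideal.Icarr)
  with \<open>x \<in> I\<close> have "x \<in> carrier R" "x [^] (1::nat) \<in> I"
    by simp_all
  then show "x \<in> radical R I"
    unfolding radical_def by blast
qed

lemma radical_subset_radical:
  assumes "I \<subseteq> radical R J"
  shows "radical R I \<subseteq> radical R J"
proof
  fix x assume "x \<in> radical R I"
  then obtain k :: nat where x: "x \<in> carrier R" "x [^] k \<in> I"
    by (auto simp: radical_def)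
  then obtain l :: nat where "(x [^] k) [^] l \<in> J"
    using assms by (auto simp: radical_def)
  then have "x [^] (k * l) \<in> J"
    using x(1) by (simp add: nat_pow_pow)
  then show "x \<in> radical R J"
    using x(1) unfolding radical_def by blast
qed

end

lemma hom_genideal:
  assumes R: "cring R" "cring S" "h \<in> ring_hom R S" and G: "G \<subseteq> carrier R"
  shows "h ` (Idl\<^bsub>R\<^esub> G) \<subseteq> Idl\<^bsub>S\<^esub> (h ` G)"
proof -
  interpret R: cring R by fact
  interpret S: cring S by fact
  interpret h: ring_hom_ring R S h
    by (rule ring_hom_ringI2) (use R in \<open>auto intro: R.ring_axioms S.ring_axioms\<close>)
  have hG: "h ` G \<subseteq> carrier S"
    using G by auto
  interpret J: ideal "Idl\<^bsub>S\<^esub> (h ` G)" S by (rule S.genideal_ideal[OF hG])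
  have "ideal {x \<in> carrier R. h x \<in> Idl\<^bsub>S\<^esub> (h ` G)} R"
    by (rule h.ideal_vimage[OF J.ideal_axioms])
  moreover have "G \<subseteq> {x \<in> carrier R. h x \<in> Idl\<^bsub>S\<^esub> (h ` G)}"
    using G S.genideal_self[OF hG] by auto
  ultimately have "Idl\<^bsub>R\<^esub> G \<subseteq> {x \<in> carrier R. h x \<in> Idl\<^bsub>S\<^esub> (h ` G)}"
    by (rule R.genideal_minimal)
  then show ?thesis
    by blast
qed

text \<open>A ring homomorphism maps a power of \<open>x\<close> to the same power of the image of \<open>x\<close>, so the images of
  elements that generate an ideal up to radical generate the extended ideal up to radical.\<close>

lemma arith_rank_hom:
  assumes R: "cring R" "cring S" "h \<in> ring_hom R S" and G: "G \<subseteq> carrier R"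
  shows "arith_rank S (Idl\<^bsub>S\<^esub> (h ` G)) \<le> arith_rank R (Idl\<^bsub>R\<^esub> G)"
proof (cases "arith_rank R (Idl\<^bsub>R\<^esub> G)")
  case (enat r)
  interpret R: cring R by fact
  interpret S: cring S by fact
  interpret h: ring_hom_ring R S h
    by (rule ring_hom_ringI2) (use R in \<open>auto intro: R.ring_axioms S.ring_axioms\<close>)
  let ?I = "Idl\<^bsub>R\<^esub> G" and ?J = "Idl\<^bsub>S\<^esub> (h ` G)"
  obtain a where a: "a ` {..<r} \<subseteq> carrier R" "radical R (Idl\<^bsub>R\<^esub> (a ` {..<r})) = radical R ?I"
    using enat by (rule arith_rankE)
  let ?b = "(\<lambda>k. h (a k)) ` {..<r}"
  have b: "?b = h ` (a ` {..<r})" "?b \<subseteq> carrier S"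
    using a(1) by (auto simp: image_image)
  have hG: "h ` G \<subseteq> carrier S"
    using G by auto
  note I = R.genideal_ideal[OF G] and J = S.genideal_ideal[OF hG]
    and Ia = R.genideal_ideal[OF a(1)] and Jb = S.genideal_ideal[OF b(2)]
  have pow: "h x [^]\<^bsub>S\<^esub> k = h (x [^]\<^bsub>R\<^esub> k)" if "x \<in> carrier R" for x and k :: nat
    using h.hom_nat_pow[OF that] by simp
  have "radical S (Idl\<^bsub>S\<^esub> ?b) = radical S ?J"
  proof
    have "?b \<subseteq> radical S ?J"
    proof
      fix y assume "y \<in> ?b"
      then obtain k where k: "k < r" "y = h (a k)"
        by blast
      then have ak: "a k \<in> carrier R" "a k \<in> radical R ?I"
        using a R.genideal_self[OF a(1)] R.subset_radical[OF Ia] by auto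
      then obtain l :: nat where "a k [^]\<^bsub>R\<^esub> l \<in> ?I"
        by (auto simp: radical_def)
      then have "y [^]\<^bsub>S\<^esub> l \<in> ?J"
        using hom_genideal[OF R G] pow[OF ak(1)] k by auto
      then show "y \<in> radical S ?J"
        using h.hom_closed[OF ak(1)] k unfolding radical_def by blast
    qed
    then have "Idl\<^bsub>S\<^esub> ?b \<subseteq> radical S ?J"
      by (rule S.genideal_minimal[OF S.ideal_radical[OF J]])
    then show "radical S (Idl\<^bsub>S\<^esub> ?b) \<subseteq> radical S ?J"
      by (rule S.radical_subset_radical)
    have "h ` G \<subseteq> radical S (Idl\<^bsub>S\<^esub> ?b)"
    proof
      fix y assume "y \<in> h ` G"
      then obtain x where x: "x \<in> G" "y = h x"
        by blast
      then have xr: "x \<in> carrier R" "x \<in> radical R (Idl\<^bsub>R\<^esub> (a ` {..<r}))"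
        unfolding a(2) using G R.genideal_self[OF G] R.subset_radical[OF I] by auto
      then obtain l :: nat where "x [^]\<^bsub>R\<^esub> l \<in> Idl\<^bsub>R\<^esub> (a ` {..<r})"
        by (auto simp: radical_def)
      then have "y [^]\<^bsub>S\<^esub> l \<in> Idl\<^bsub>S\<^esub> ?b"
        using hom_genideal[OF R a(1)] pow[OF xr(1)] x b(1) by auto
      then show "y \<in> radical S (Idl\<^bsub>S\<^esub> ?b)"
        using h.hom_closed[OF xr(1)] x unfolding radical_def by blast
    qed
    then have "?J \<subseteq> radical S (Idl\<^bsub>S\<^esub> ?b)"
      by (rule S.genideal_minimal[OF S.ideal_radical[OF Jb]])
    then show "radical S ?J \<subseteq> radical S (Idl\<^bsub>S\<^esub> ?b)"
      by (rule S.radical_subset_radical)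
  qed
  then show ?thesis
    unfolding enat using b(2) by (intro arith_rank_le)
qed simp


section \<open>Specialization\<close>

text \<open>The effect on exponents of substituting \<open>x\<^bsup>E t\<^esup>\<close> for the variable \<open>t\<close>, for all \<open>t \<in> X\<close>.\<close>

definition subst_exp :: "nat set \<Rightarrow> (nat \<Rightarrow> (nat \<Rightarrow>\<^sub>0 nat)) \<Rightarrow> (nat \<Rightarrow>\<^sub>0 nat) \<Rightarrow> (nat \<Rightarrow>\<^sub>0 nat)"
  where "subst_exp X E m = (\<Sum>t\<in>X. stretch (Poly_Mapping.lookup m t) (E t))"

lemma subst_exp_add: "subst_exp X E (a + b) = subst_exp X E a + subst_exp X E b"
proof -
  have "stretch (k + l) e = stretch k e + stretch l e" for k l e
    by (rule poly_mapping_eqI) (simp add: lookup_add distrib_right)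
  then show ?thesis
    by (simp add: subst_exp_def lookup_add sum.distrib)
qed

lemma stretch_01: "stretch 0 e = 0" "stretch 1 e = e"
  by (rule poly_mapping_eqI, simp)+

lemma keys_subst_exp:
  assumes "finite X" "\<And>t. t \<in> X \<Longrightarrow> Poly_Mapping.keys (E t) \<subseteq> Y"
  shows "Poly_Mapping.keys (subst_exp X E m) \<subseteq> Y"
proof -
  have "Poly_Mapping.keys (stretch k e) \<subseteq> Poly_Mapping.keys e" for k e
    by (auto simp: in_keys_iff)
  then have "Poly_Mapping.keys (stretch (Poly_Mapping.lookup m t) (E t)) \<subseteq> Y" if "t \<in> X" for t
    using assms(2)[OF that] by blast
  then show ?thesis
    unfolding subst_exp_def using keys_sum by (blast dest: subsetD[OF keys_sum])
qed

lemma subst_ring_hom: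
  assumes "finite X" "\<And>t. t \<in> X \<Longrightarrow> Poly_Mapping.keys (E t) \<subseteq> Y"
  shows "exp_map (subst_exp X E) \<in> ring_hom (poly_ring X :: 'k::field mpoly ring) (poly_ring Y)"
proof (rule ring_hom_memI)
  show "exp_map (subst_exp X E) p \<in> carrier (poly_ring Y)" for p :: "'k mpoly"
    using keys_exp_map[of "subst_exp X E" p] keys_subst_exp[of X E Y, OF assms] by (fastforce simp: vars_def)
  show "exp_map (subst_exp X E) \<one>\<^bsub>poly_ring X\<^esub> = (\<one>\<^bsub>poly_ring Y\<^esub> :: 'k mpoly)"
    by (simp add: exp_map_one subst_exp_def stretch_01)
qed (simp_all add: exp_map_add exp_map_mult subst_exp_add)

lemma sqfree_monomialE:
  assumes "p \<in> (sqfree_monomials :: 'k::field mpoly set)"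
  shows "p = mon (flat_exp 1 (vars p))" "finite (vars p)"
proof -
  obtain m where m: "p = mon m" "\<forall>i. Poly_Mapping.lookup m i \<le> 1"
    using assms by (auto simp: sqfree_monomials_def)
  have "m = flat_exp 1 (Poly_Mapping.keys m)"
  proof (rule poly_mapping_eqI)
    fix i
    show "Poly_Mapping.lookup m i = Poly_Mapping.lookup (flat_exp 1 (Poly_Mapping.keys m)) i"
      using m(2)[rule_format, of i] by (subst lookup_flat_exp) (auto simp: in_keys_iff)
  qed
  with m(1) show "p = mon (flat_exp 1 (vars p))" "finite (vars p)"
    by simp_all
qed

lemma prod_mon: "(\<Prod>t\<in>S. mon (E t)) = (mon (\<Sum>t\<in>S. E t) :: 'k::field mpoly)"
  by (induction S rule: infinite_finite_induct) (simp_all add: mon_add)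

lemma arith_rank_specialization:
  fixes m m' :: "nat \<Rightarrow> 'k::field mpoly"
  assumes I: "I \<in> sqfree_ideals" and J: "J \<in> sqfree_ideals"
    and m': "m' ` {1..\<mu>} = min_gens I" and m: "m ` {1..\<mu>} = min_gens J"
    and M: "\<And>t. t \<in> ideal_vars I \<Longrightarrow> M t \<in> sqfree_monomials \<and> vars (M t) \<subseteq> ideal_vars J"
    and prod: "\<And>i. i \<in> {1..\<mu>} \<Longrightarrow> (\<Prod>t\<in>vars (m' i). M t) = m i"
  shows "arith_rank (ideal_ring J) (restr_ideal J) \<le> arith_rank (ideal_ring I) (restr_ideal I)"
proof -
  note gI = sqfree_ideal_min_gens[OF I] and gJ = sqfree_ideal_min_gens[OF J]
  define E where "E t = flat_exp 1 (vars (M t))" for t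
  have ME: "M t = mon (E t)" "Poly_Mapping.keys (E t) \<subseteq> ideal_vars J" if "t \<in> ideal_vars I" for t
    using M[OF that] sqfree_monomialE[of "M t"] by (simp_all add: E_def keys_flat_exp)
  have finX: "finite (ideal_vars I)"
    unfolding ideal_vars_def using gI(1,2) sqfree_monomialE(2) by blast
  let ?\<psi> = "exp_map (subst_exp (ideal_vars I) E) :: 'k mpoly \<Rightarrow> 'k mpoly"
  have \<psi>: "?\<psi> (m' i) = m i" if i: "i \<in> {1..\<mu>}" for i
  proof -
    have mi: "m' i \<in> min_gens I"
      using m' i by blast
    then have sub: "vars (m' i) \<subseteq> ideal_vars I"
      by (auto simp: ideal_vars_def)
    have e: "m' i = mon (flat_exp 1 (vars (m' i)))" and fin: "finite (vars (m' i))"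
      using sqfree_monomialE gI(2) mi by blast+
    have "subst_exp (ideal_vars I) E (flat_exp 1 (vars (m' i)))
        = (\<Sum>t\<in>ideal_vars I. if t \<in> vars (m' i) then E t else 0)"
      unfolding subst_exp_def lookup_flat_exp[OF fin] by (intro sum.cong refl) (simp add: stretch_01[simplified])
    also have "\<dots> = (\<Sum>t\<in>vars (m' i). E t)"
      using finX sub by (simp add: sum.If_cases Int_absorb1)
    finally have "?\<psi> (m' i) = (\<Prod>t\<in>vars (m' i). mon (E t))"
      by (subst e) (simp add: prod_mon)
    also have "\<dots> = (\<Prod>t\<in>vars (m' i). M t)"
      using ME(1) sub by (intro prod.cong) auto
    finally show ?thesis
      using prod[OF i] by simp
  qed
  have "?\<psi> ` min_gens I = min_gens J"
    unfolding m'[symmetric] m[symmetric] image_image using \<psi> by (intro image_cong) auto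
  moreover have "min_gens I \<subseteq> carrier (ideal_ring I)"
    by (auto simp: ideal_vars_def)
  moreover have "?\<psi> \<in> ring_hom (ideal_ring I) (ideal_ring J)"
    by (rule subst_ring_hom[OF finX ME(2)])
  ultimately show ?thesis
    using arith_rank_hom[OF poly_ring_cring poly_ring_cring, of ?\<psi> "ideal_vars I" "ideal_vars J" "min_gens I"]
    unfolding gI(3) gJ(3) by simp
qed

section \<open>Projective dimension and arithmetical rank\<close>

lemma poly_ring_pow: "x [^]\<^bsub>poly_ring X\<^esub> (k::nat) = (x :: 'k::field mpoly) ^ k"
  by (induction k) (simp_all add: mult.commute)

lemma mon_flat_pow: "mon (flat_exp 1 S) ^ k = (mon (flat_exp k S) :: 'k::field mpoly)"
proof (induction k)
  case 0
  have "flat_exp 0 S = 0"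
    by (simp add: flat_exp_def)
  then show ?case
    by simp
next
  case (Suc k)
  then show ?case
    using flat_exp_add[of 1 k S] by (simp add: mon_add)
qed

text \<open>Lyubeznik's inequality. Given elements that generate the ideal up to radical, suitable powers of
  them lie in the ideal and still generate it up to radical, so powers of the monomial generators
  are combinations of them and \<open>syzygy_retraction\<close> applies.\<close>

theorem proj_dim_le_arith_rank:
  assumes J: "J \<in> (sqfree_ideals :: 'k::field mpoly set set)"
  shows "proj_dim (ideal_ring J) (quot_module (ideal_ring J) (restr_ideal J))
    \<le> arith_rank (ideal_ring J) (restr_ideal J)"
proof (cases "arith_rank (ideal_ring J) (restr_ideal J)")
  case (enat r)
  note g = sqfree_ideal_min_gens[OF J]
  define X where "X = ideal_vars J"
  interpret R: cring "poly_ring X :: 'k mpoly ring" by (rule poly_ring_cring)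
  define n where "n = card (min_gens J)"
  obtain gen where "bij_betw gen {0..<n} (min_gens J)"
    using ex_bij_betw_nat_finite[OF g(1)] by (auto simp: n_def)
  then have gen: "gen ` {..<n} = min_gens J"
    by (simp add: bij_betw_def lessThan_atLeast0)
  define A where "A j = vars (gen j)" for j
  have gen_mem: "gen j \<in> min_gens J" if "j < n" for j
    using gen that by blast
  have A: "finite (A j)" "A j \<subseteq> X" "gen j = mon (flat_exp 1 (A j))" if "j < n" for j
    using sqfree_monomialE[of "gen j"] gen_mem[OF that] g(2) by (auto simp: A_def X_def ideal_vars_def)
  interpret taylor X n A
    by standard (use A in auto)
  define I :: "'k mpoly set" where "I = Idl\<^bsub>poly_ring X\<^esub> (gen ` {..<n})"
  have restr: "restr_ideal J = I"
    using g(3) by (simp add: I_def gen X_def)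
  have gen_car: "gen ` {..<n} \<subseteq> carrier (poly_ring X)"
    using A(2) by (auto simp: A_def)
  note idI = R.genideal_ideal[OF gen_car, folded I_def]
  have face: "I = sqfree_ideal"
  proof -
    have "gen ` {..<n} = mon ` ((\<lambda>j. flat_exp 1 (A j)) ` {..<n})"
      unfolding image_image by (intro image_cong) (auto simp: A(3))
    moreover have "Poly_Mapping.keys e \<subseteq> X" if "e \<in> (\<lambda>j. flat_exp 1 (A j)) ` {..<n}" for e
      using that by (elim imageE) (simp add: keys_flat_exp A(1,2))
    ultimately have "I = mon_ideal X ((\<lambda>j. flat_exp 1 (A j)) ` {..<n})"
      unfolding I_def by (simp only: genideal_monomials)
    moreover have "edvd (flat_exp 1 (A j)) e \<longleftrightarrow> A j \<subseteq> Poly_Mapping.keys e" if "j < n" for j e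
      using A(1)[OF that] by (auto simp: edvd_def lookup_flat_exp in_keys_iff Suc_le_eq split: if_splits)
    ultimately show ?thesis
      by (simp add: mon_ideal_def sqfree_ideal_def lcm_ideal_empty Bex_def cong: conj_cong)
  qed
  obtain a where a: "a ` {..<r} \<subseteq> carrier (poly_ring X)"
    "radical (poly_ring X) (Idl\<^bsub>poly_ring X\<^esub> (a ` {..<r})) = radical (poly_ring X) I"
    by (rule arith_rankE[OF enat[unfolded restr, folded X_def]])
  note ida = R.genideal_ideal[OF a(1)]
  have "\<exists>l. a k ^ l \<in> I" if "k < r" for k
  proof -
    have "a k \<in> radical (poly_ring X) I"
      using that R.genideal_self[OF a(1)] R.subset_radical[OF ida] unfolding a(2)[symmetric] by blast
    then show ?thesis
      by (auto simp: radical_def poly_ring_pow)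
  qed
  then obtain l where l: "\<And>k. k < r \<Longrightarrow> a k ^ l k \<in> I"
    by metis
  define f where "f k = a k ^ l k" for k
  have f_vars: "vars (f k) \<subseteq> X" if "k < r" for k
    using ideal.Icarr[OF idI l[OF that]] by (simp add: f_def)
  then have f_car: "f ` {..<r} \<subseteq> carrier (poly_ring X)"
    by auto
  note idf = R.genideal_ideal[OF f_car]
  have "a ` {..<r} \<subseteq> radical (poly_ring X) (Idl\<^bsub>poly_ring X\<^esub> (f ` {..<r}))"
  proof
    fix y assume "y \<in> a ` {..<r}"
    then obtain k where k: "k < r" "y = a k"
      by blast
    then have "y ^ l k \<in> Idl\<^bsub>poly_ring X\<^esub> (f ` {..<r})" "vars y \<subseteq> X"
      using R.genideal_self[OF f_car] a(1) by (auto simp: f_def)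
    then show "y \<in> radical (poly_ring X) (Idl\<^bsub>poly_ring X\<^esub> (f ` {..<r}))"
      by (auto simp: radical_def poly_ring_pow)
  qed
  then have "Idl\<^bsub>poly_ring X\<^esub> (a ` {..<r}) \<subseteq> radical (poly_ring X) (Idl\<^bsub>poly_ring X\<^esub> (f ` {..<r}))"
    by (rule R.genideal_minimal[OF R.ideal_radical[OF idf]])
  from R.radical_subset_radical[OF this]
  have rad: "I \<subseteq> radical (poly_ring X) (Idl\<^bsub>poly_ring X\<^esub> (f ` {..<r}))"
    using R.subset_radical[OF idI] unfolding a(2) by blast
  have "\<exists>b c. (\<forall>k. vars (c k) \<subseteq> X) \<and> mon (flat_exp b (A j)) = (\<Sum>k<r. c k * f k)" if j: "j < n" for j
  proof -
    have "gen j \<in> I"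
      using R.genideal_self[OF gen_car] j unfolding I_def by blast
    then obtain b where "gen j ^ b \<in> Idl\<^bsub>poly_ring X\<^esub> (f ` {..<r})"
      using rad by (auto simp: radical_def poly_ring_pow)
    then obtain c where "\<And>k. vars (c k) \<subseteq> X" "gen j ^ b = (\<Sum>k<r. c k * f k)"
      using genideal_comb[of r f X "gen j ^ b"] f_vars by blast
    then show ?thesis
      by (intro exI[of _ b] exI[of _ c]) (simp only: A(3)[OF j] mon_flat_pow, simp)
  qed
  then obtain b c where c: "\<And>j k. j < n \<Longrightarrow> vars (c j k) \<subseteq> X"
    "\<And>j. j < n \<Longrightarrow> mon (flat_exp (b j) (A j)) = (\<Sum>k<r. c j k * f k)"
    by metis
  have "\<exists>g. (\<forall>i. vars (g i) \<subseteq> X) \<and> f k = (\<Sum>i<n. g i * mon (flat_exp 1 (A i)))" if k: "k < r" for k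
  proof -
    have "f k \<in> Idl\<^bsub>poly_ring X\<^esub> (gen ` {..<n})"
      using l[OF k] by (simp add: f_def I_def)
    then obtain g where "\<And>i. vars (g i) \<subseteq> X" "f k = (\<Sum>i<n. g i * gen i)"
      using genideal_comb[of n gen X "f k"] A(2) unfolding A_def by blast
    then show ?thesis
      by (intro exI[of _ g]) (simp add: A(3))
  qed
  then obtain h where h: "\<And>k i. k < r \<Longrightarrow> vars (h k i) \<subseteq> X"
    "\<And>k. k < r \<Longrightarrow> f k = (\<Sum>i<n. h k i * mon (flat_exp 1 (A i)))"
    by metis
  have comb: "mon (flat_exp (b j) (A j)) = (\<Sum>k<r. c j k * (\<Sum>i<n. h k i * mon (flat_exp 1 (A i))))"
    if "j < n" for j
    unfolding c(2)[OF that] by (intro sum.cong refl) (simp only: h(2) lessThan_iff)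
  have cL: "c j k \<in> lcm_ideal {}" if "j < n" "k < r" for j k
    using c(1) that by (simp add: lcm_ideal_empty)
  have hL: "h k i \<in> lcm_ideal {}" if "k < r" "i < n" for k i
    using h(1) that by (simp add: lcm_ideal_empty)
  have "proj_dim (poly_ring X) (quot_module (poly_ring X) (sqfree_ideal :: 'k mpoly set)) \<le> enat r"
  proof (rule syzygy_retraction[OF comb cL hL])
    fix s :: "'k mpoly ext \<Rightarrow> 'k mpoly ext"
    assume s: "\<And>v. v \<in> taylor_mod r \<Longrightarrow> s v \<in> taylor_mod (Suc r)"
      "\<And>v w. v \<in> taylor_mod r \<Longrightarrow> w \<in> taylor_mod r \<Longrightarrow> s (v + w) = s v + s w"
      "\<And>p v. v \<in> taylor_mod r \<Longrightarrow> s (p \<bullet> v) = p \<bullet> s v"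
      "\<And>y. y \<in> taylor_mod (Suc r) \<Longrightarrow> bd n (s (bd n y)) = bd n y"
    show "proj_dim (poly_ring X) (quot_module (poly_ring X) (sqfree_ideal :: 'k mpoly set)) \<le> enat r"
      by (rule proj_dim_le[OF s])
  qed
  then show ?thesis
    unfolding enat unfolding restr face by (simp add: X_def)
qed simp

theorem proposition5p3:
  fixes C :: "'k::field mpoly set \<Rightarrow> bool"
    and A :: "'k mpoly set set"
  assumes "generic_set C A"
    and "\<And>I J. I \<in> satisfying C \<Longrightarrow> J \<in> satisfying C \<Longrightarrow>
      proj_dim (ideal_ring I) (quot_module (ideal_ring I) (restr_ideal I)) =
      proj_dim (ideal_ring J) (quot_module (ideal_ring J) (restr_ideal J))"
    and "\<And>I. I \<in> A \<Longrightarrow>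
      arith_rank (ideal_ring I) (restr_ideal I) =
      proj_dim (ideal_ring I) (quot_module (ideal_ring I) (restr_ideal I))"
  shows "\<forall>I \<in> satisfying C.
      arith_rank (ideal_ring I) (restr_ideal I) =
      proj_dim (ideal_ring I) (quot_module (ideal_ring I) (restr_ideal I))"
proof
  fix J assume J: "J \<in> satisfying C"
  then have sqJ: "J \<in> sqfree_ideals"
    by (simp add: satisfying_def)
  define \<mu> where "\<mu> = card (min_gens J)"
  obtain m where m: "bij_betw m {1..\<mu>} (min_gens J)"
    using ex_bij_betw_nat_finite_1[OF sqfree_ideal_min_gens(1)[OF sqJ]] by (auto simp: \<mu>_def)
  obtain I m' M where I: "I \<in> A" "bij_betw m' {1..\<mu>} (min_gens I)"
    "\<forall>t\<in>ideal_vars I. M t \<in> sqfree_monomials \<and> vars (M t) \<subseteq> ideal_vars J"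
    "\<forall>i\<in>{1..\<mu>}. (\<Prod>t\<in>vars (m' i). M t) = m i"
    using assms(1) J m unfolding generic_set_def by blast
  have satI: "I \<in> satisfying C"
    using assms(1) I(1) unfolding generic_set_def by blast
  have "arith_rank (ideal_ring J) (restr_ideal J) \<le> arith_rank (ideal_ring I) (restr_ideal I)"
    using satI I(2-) m
    by (intro arith_rank_specialization[OF _ sqJ, of I m' \<mu> m M]) (auto simp: satisfying_def bij_betw_def)
  also have "\<dots> = proj_dim (ideal_ring J) (quot_module (ideal_ring J) (restr_ideal J))"
    using assms(3)[OF I(1)] assms(2)[OF satI J] by simp
  finally show "arith_rank (ideal_ring J) (restr_ideal J) =
      proj_dim (ideal_ring J) (quot_module (ideal_ring J) (restr_ideal J))"
    using proj_dim_le_arith_rank[OF sqJ] by (rule antisym)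
qed

end
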